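(* Let $U$ be a theory in a countable language which extends $\mathrm{PA}$ and imposes $\mathcal L_{\mathrm{PA}}$-recursive saturation. Then $U$ semantically defines $\mathrm{UTB}^-(\mathcal L_{\mathrm{PA}})$ modulo $\mathcal L_{\mathrm{PA}}$.
   Context: $\mathcal L_{\mathrm{PA}}=\{0,1,+,\times,<\}$; $U$ is only assumed to contain the axioms of $\mathrm{PA}$ (induction for $\mathcal L_{\mathrm{PA}}$-formulae), not induction for its full language. $U$ imposes $\mathcal L_{\mathrm{PA}}$-recursive saturation if for every $\mathcal M\models U$ the reduct $\mathcal M\restriction_{\mathcal L_{\mathrm{PA}}}$ is recursively saturated. $\mathrm{UTB}^-(\mathcal L_{\mathrm{PA}})$ is the theory in $\mathcal L_{\mathrm{PA}}\cup\{T\}$ ($T$ a fresh unary predicate) consisting of $\mathrm{PA}$ and all sentences $\forall t\,(T(\ulcorner\phi(t)\urcorner)\leftrightarrow\phi(t^\circ))$, for $\phi(x)$ an $\mathcal L_{\mathrm{PA}}$-formula; here $t$ ranges over codes of closed arithmetical terms, $t^\circ$ is the value of $t$, and $\ulcorner\phi(t)\urcorner$ is the code of the result of substituting $t$ for $x$ in $\phi$. No induction for formulae containing $T$ is assumed. $U$ semantically defines $V$ (in $\mathcal L_{\mathrm{PA}}\cup\{T\}$) modulo $\mathcal L_{\mathrm{PA}}$ if for every $\mathcal M\models U$ there is a formula $\theta(x)$ of the language of $U$, with parameters from $\mathcal M$, such that $\mathcal M\models\Phi[\theta/T]$ for every axiom $\Phi$ of $V$ (the $\mathcal L_{\mathrm{PA}}$-symbols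 being left unchanged). *)

theory Defs
  imports "HOL-Library.Countable_Set"
begin

section \<open>First-order syntax over extensions of the language of arithmetic\<close>

text \<open>
  Terms and formulae are in de Bruijn style: \<open>Var 0\<close> refers to the innermost enclosing
  quantifier. The symbols \<open>0, 1, +, \<times>, <\<close> and equality are built in; \<open>'f\<close> and \<open>'r\<close>
  supply the names of the remaining function and relation symbols.
\<close>

datatype 'f tm =
    Var nat
  | Zero
  | One
  | Add "'f tm" "'f tm"
  | Mul "'f tm" "'f tm"
  | Fn 'f "'f tm list"

datatype ('f, 'r) fm =
    Fls
  | Eq "'f tm" "'f tm"
  | Less "'f tm" "'f tm"
  | Rel 'r "'f tm list"
  | Imp "('f, 'r) fm" "('f, 'r) fm"
  | Uni "('f, 'r) fm"

abbreviation Neg :: "('f, 'r) fm \<Rightarrow> ('f, 'r) fm" where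
  "Neg p \<equiv> Imp p Fls"

abbreviation Or :: "('f, 'r) fm \<Rightarrow> ('f, 'r) fm \<Rightarrow> ('f, 'r) fm" where
  "Or p q \<equiv> Imp (Neg p) q"

abbreviation And :: "('f, 'r) fm \<Rightarrow> ('f, 'r) fm \<Rightarrow> ('f, 'r) fm" where
  "And p q \<equiv> Neg (Imp p (Neg q))"

abbreviation Iff :: "('f, 'r) fm \<Rightarrow> ('f, 'r) fm \<Rightarrow> ('f, 'r) fm" where
  "Iff p q \<equiv> And (Imp p q) (Imp q p)"

abbreviation Exi :: "('f, 'r) fm \<Rightarrow> ('f, 'r) fm" where
  "Exi p \<equiv> Neg (Uni (Neg p))"

text \<open>
  A language is given by its symbols other than \<open>0, 1, +, \<times>, <\<close>: a set of function symbols
  and a set of relation symbols, a symbol being a name together with an arity.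
\<close>

type_synonym ('f, 'r) lang = "('f \<times> nat) set \<times> ('r \<times> nat) set"

definition L_PA :: "('f, 'r) lang" where
  "L_PA = ({}, {})"

definition countable_lang :: "('f, 'r) lang \<Rightarrow> bool" where
  "countable_lang L \<longleftrightarrow> countable (fst L) \<and> countable (snd L)"

primrec wf_tm :: "('f \<times> nat) set \<Rightarrow> 'f tm \<Rightarrow> bool" where
  "wf_tm F (Var i) \<longleftrightarrow> True"
| "wf_tm F Zero \<longleftrightarrow> True"
| "wf_tm F One \<longleftrightarrow> True"
| "wf_tm F (Add s t) \<longleftrightarrow> wf_tm F s \<and> wf_tm F t"
| "wf_tm F (Mul s t) \<longleftrightarrow> wf_tm F s \<and> wf_tm F t"
| "wf_tm F (Fn f ts) \<longleftrightarrow> (f, length ts) \<in> F \<and> list_all id (map (wf_tm F) ts)"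

primrec wf_fm :: "('f, 'r) lang \<Rightarrow> ('f, 'r) fm \<Rightarrow> bool" where
  "wf_fm L Fls \<longleftrightarrow> True"
| "wf_fm L (Eq s t) \<longleftrightarrow> wf_tm (fst L) s \<and> wf_tm (fst L) t"
| "wf_fm L (Less s t) \<longleftrightarrow> wf_tm (fst L) s \<and> wf_tm (fst L) t"
| "wf_fm L (Rel r ts) \<longleftrightarrow> (r, length ts) \<in> snd L \<and> list_all (wf_tm (fst L)) ts"
| "wf_fm L (Imp p q) \<longleftrightarrow> wf_fm L p \<and> wf_fm L q"
| "wf_fm L (Uni p) \<longleftrightarrow> wf_fm L p"

text \<open>\<open>fvb p\<close> is the least \<open>n\<close> such that all free indices of \<open>p\<close> are below \<open>n\<close>.\<close>

primrec fvb_tm :: "'f tm \<Rightarrow> nat" where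
  "fvb_tm (Var i) = Suc i"
| "fvb_tm Zero = 0"
| "fvb_tm One = 0"
| "fvb_tm (Add s t) = max (fvb_tm s) (fvb_tm t)"
| "fvb_tm (Mul s t) = max (fvb_tm s) (fvb_tm t)"
| "fvb_tm (Fn f ts) = foldr max (map fvb_tm ts) 0"

primrec fvb :: "('f, 'r) fm \<Rightarrow> nat" where
  "fvb Fls = 0"
| "fvb (Eq s t) = max (fvb_tm s) (fvb_tm t)"
| "fvb (Less s t) = max (fvb_tm s) (fvb_tm t)"
| "fvb (Rel r ts) = foldr max (map fvb_tm ts) 0"
| "fvb (Imp p q) = max (fvb p) (fvb q)"
| "fvb (Uni p) = fvb p - 1"

definition formulas :: "('f, 'r) lang \<Rightarrow> ('f, 'r) fm set" where
  "formulas L = {p. wf_fm L p}"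

definition sentences :: "('f, 'r) lang \<Rightarrow> ('f, 'r) fm set" where
  "sentences L = {p \<in> formulas L. fvb p = 0}"

definition univ_close :: "('f, 'r) fm \<Rightarrow> ('f, 'r) fm" where
  "univ_close p = (Uni ^^ fvb p) p"

primrec subst_tm :: "(nat \<Rightarrow> 'f tm) \<Rightarrow> 'f tm \<Rightarrow> 'f tm" where
  "subst_tm \<sigma> (Var i) = \<sigma> i"
| "subst_tm \<sigma> Zero = Zero"
| "subst_tm \<sigma> One = One"
| "subst_tm \<sigma> (Add s t) = Add (subst_tm \<sigma> s) (subst_tm \<sigma> t)"
| "subst_tm \<sigma> (Mul s t) = Mul (subst_tm \<sigma> s) (subst_tm \<sigma> t)"
| "subst_tm \<sigma> (Fn f ts) = Fn f (map (subst_tm \<sigma>) ts)"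

abbreviation lift_tm :: "'f tm \<Rightarrow> 'f tm" where
  "lift_tm \<equiv> subst_tm (\<lambda>i. Var (Suc i))"

definition up :: "(nat \<Rightarrow> 'f tm) \<Rightarrow> nat \<Rightarrow> 'f tm" where
  "up \<sigma> = case_nat (Var 0) (\<lambda>i. lift_tm (\<sigma> i))"

primrec subst_fm :: "(nat \<Rightarrow> 'f tm) \<Rightarrow> ('f, 'r) fm \<Rightarrow> ('f, 'r) fm" where
  "subst_fm \<sigma> Fls = Fls"
| "subst_fm \<sigma> (Eq s t) = Eq (subst_tm \<sigma> s) (subst_tm \<sigma> t)"
| "subst_fm \<sigma> (Less s t) = Less (subst_tm \<sigma> s) (subst_tm \<sigma> t)"
| "subst_fm \<sigma> (Rel r ts) = Rel r (map (subst_tm \<sigma>) ts)"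
| "subst_fm \<sigma> (Imp p q) = Imp (subst_fm \<sigma> p) (subst_fm \<sigma> q)"
| "subst_fm \<sigma> (Uni p) = Uni (subst_fm (up \<sigma>) p)"


section \<open>Structures and satisfaction\<close>

record ('f, 'r, 'm) struct =
  carr :: "'m set"
  izero :: 'm
  ione :: 'm
  iadd :: "'m \<Rightarrow> 'm \<Rightarrow> 'm"
  imul :: "'m \<Rightarrow> 'm \<Rightarrow> 'm"
  iless :: "'m \<Rightarrow> 'm \<Rightarrow> bool"
  ifun :: "'f \<Rightarrow> 'm list \<Rightarrow> 'm"
  irel :: "'r \<Rightarrow> 'm list \<Rightarrow> bool"

definition is_struct :: "('f, 'r) lang \<Rightarrow> ('f, 'r, 'm) struct \<Rightarrow> bool" where
  "is_struct L M \<longleftrightarrow>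
     izero M \<in> carr M \<and> ione M \<in> carr M \<and>
     (\<forall>x\<in>carr M. \<forall>y\<in>carr M. iadd M x y \<in> carr M \<and> imul M x y \<in> carr M) \<and>
     (\<forall>(f, n)\<in>fst L. \<forall>xs. length xs = n \<and> set xs \<subseteq> carr M \<longrightarrow> ifun M f xs \<in> carr M)"

primrec val_tm :: "('f, 'r, 'm) struct \<Rightarrow> (nat \<Rightarrow> 'm) \<Rightarrow> 'f tm \<Rightarrow> 'm" where
  "val_tm M e (Var i) = e i"
| "val_tm M e Zero = izero M"
| "val_tm M e One = ione M"
| "val_tm M e (Add s t) = iadd M (val_tm M e s) (val_tm M e t)"
| "val_tm M e (Mul s t) = imul M (val_tm M e s) (val_tm M e t)"
| "val_tm M e (Fn f ts) = ifun M f (map (val_tm M e) ts)"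

primrec sat :: "('f, 'r, 'm) struct \<Rightarrow> (nat \<Rightarrow> 'm) \<Rightarrow> ('f, 'r) fm \<Rightarrow> bool" where
  "sat M e Fls \<longleftrightarrow> False"
| "sat M e (Eq s t) \<longleftrightarrow> val_tm M e s = val_tm M e t"
| "sat M e (Less s t) \<longleftrightarrow> iless M (val_tm M e s) (val_tm M e t)"
| "sat M e (Rel r ts) \<longleftrightarrow> irel M r (map (val_tm M e) ts)"
| "sat M e (Imp p q) \<longleftrightarrow> (sat M e p \<longrightarrow> sat M e q)"
| "sat M e (Uni p) \<longleftrightarrow> (\<forall>x\<in>carr M. sat M (case_nat x e) p)"

definition assignments :: "('f, 'r, 'm) struct \<Rightarrow> (nat \<Rightarrow> 'm) set" where
  "assignments M = {e. range e \<subseteq> carr M}"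

definition is_model :: "('f, 'r) lang \<Rightarrow> ('f, 'r, 'm) struct \<Rightarrow> ('f, 'r) fm set \<Rightarrow> bool" where
  "is_model L M U \<longleftrightarrow> is_struct L M \<and> (\<forall>e\<in>assignments M. \<forall>p\<in>U. sat M e p)"


section \<open>Peano arithmetic\<close>

text \<open>The axioms of discretely ordered semirings, followed by the induction scheme for \<open>L_PA\<close>.\<close>

definition PA_minus :: "('f, 'r) fm set" where
  "PA_minus = (let x = Var 0; y = Var 1; z = Var 2 in univ_close `
    {Eq (Add (Add x y) z) (Add x (Add y z)),
     Eq (Add x y) (Add y x),
     Eq (Mul (Mul x y) z) (Mul x (Mul y z)),
     Eq (Mul x y) (Mul y x),
     Eq (Mul x (Add y z)) (Add (Mul x y) (Mul x z)),
     Eq (Add x Zero) x,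
     Eq (Mul x Zero) Zero,
     Eq (Mul x One) x,
     Imp (And (Less x y) (Less y z)) (Less x z),
     Neg (Less x x),
     Or (Less x y) (Or (Eq x y) (Less y x)),
     Imp (Less x y) (Less (Add x z) (Add y z)),
     Imp (And (Less Zero z) (Less x y)) (Less (Mul x z) (Mul y z)),
     Imp (Less x y) (Exi (Eq (Add (lift_tm x) (Var 0)) (lift_tm y))),
     Less Zero One,
     Imp (Less Zero x) (Or (Less One x) (Eq One x)),
     Or (Less Zero x) (Eq Zero x)})"

text \<open>In \<open>induction_axiom p\<close> the induction variable of \<open>p\<close> is index 0; the other free indices
  of \<open>p\<close> are parameters.\<close>

definition induction_axiom :: "('f, 'r) fm \<Rightarrow> ('f, 'r) fm" where
  "induction_axiom p = univ_close
     (Imp (And (subst_fm (case_nat Zero Var) p)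
               (Uni (Imp p (subst_fm (case_nat (Add (Var 0) One) (\<lambda>i. Var (Suc i))) p))))
          (Uni p))"

definition PA :: "('f, 'r) fm set" where
  "PA = PA_minus \<union> induction_axiom ` formulas L_PA"


section \<open>Goedel numbering of the arithmetical language\<close>

text \<open>The injective pairing \<open>(a, b) \<mapsto> (a + b)\<^sup>2 + a + 1\<close> has the advantage of being
  expressed by a term of \<open>L_PA\<close>, and its values exceed both arguments.\<close>

definition opair :: "nat \<Rightarrow> nat \<Rightarrow> nat" where
  "opair a b = (a + b) * (a + b) + a + 1"

text \<open>Codes are only meant for \<open>L_PA\<close>-syntax; all other symbols receive the junk code 0.\<close>

primrec code_tm :: "'f tm \<Rightarrow> nat" where
  "code_tm (Var i) = opair 0 i"
| "code_tm Zero = opair 1 0"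
| "code_tm One = opair 2 0"
| "code_tm (Add s t) = opair 3 (opair (code_tm s) (code_tm t))"
| "code_tm (Mul s t) = opair 4 (opair (code_tm s) (code_tm t))"
| "code_tm (Fn f ts) = 0"

primrec code :: "('f, 'r) fm \<Rightarrow> nat" where
  "code Fls = opair 0 0"
| "code (Eq s t) = opair 1 (opair (code_tm s) (code_tm t))"
| "code (Less s t) = opair 2 (opair (code_tm s) (code_tm t))"
| "code (Imp p q) = opair 3 (opair (code p) (code q))"
| "code (Uni p) = opair 4 (code p)"
| "code (Rel r ts) = 0"


section \<open>Recursive saturation\<close>

text \<open>\<open>recursive_fun n f\<close>: \<open>f\<close>, restricted to argument lists of length \<open>n\<close>, is an \<open>n\<close>-ary
  (total) recursive function; minimisation is only applied to regular functions.\<close>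

inductive recursive_fun :: "nat \<Rightarrow> (nat list \<Rightarrow> nat) \<Rightarrow> bool" where
  zero: "recursive_fun n (\<lambda>xs. 0)"
| succ: "recursive_fun 1 (\<lambda>xs. Suc (xs ! 0))"
| proj: "i < n \<Longrightarrow> recursive_fun n (\<lambda>xs. xs ! i)"
| comp: "recursive_fun (length hs) g \<Longrightarrow> (\<And>h. h \<in> set hs \<Longrightarrow> recursive_fun n h) \<Longrightarrow>
         recursive_fun n (\<lambda>xs. g (map (\<lambda>h. h xs) hs))"
| prim_rec: "recursive_fun n g \<Longrightarrow> recursive_fun (Suc (Suc n)) h \<Longrightarrow>
         recursive_fun (Suc n)
           (\<lambda>xs. rec_nat (g (tl xs)) (\<lambda>k r. h (k # r # tl xs)) (hd xs))"
| minim: "recursive_fun (Suc n) g \<Longrightarrow> (\<And>xs. length xs = n \<Longrightarrow> \<exists>y. g (y # xs) = 0) \<Longrightarrow>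
         recursive_fun n (\<lambda>xs. LEAST y. g (y # xs) = 0)"

definition recursive_set :: "nat set \<Rightarrow> bool" where
  "recursive_set A \<longleftrightarrow> (\<exists>f. recursive_fun 1 f \<and> (\<forall>k. f [k] = (if k \<in> A then 1 else 0)))"

text \<open>
  Recursive saturation of the \<open>L_PA\<close>-reduct of \<open>M\<close>; the reduct need not be formed, since only
  \<open>L_PA\<close>-formulae are evaluated. In a type \<open>p(x, y\<^sub>1, \<dots>, y\<^sub>n)\<close> the variable \<open>x\<close> is index 0, and
  \<open>e\<close> supplies the parameters for \<open>y\<^sub>1, \<dots>, y\<^sub>n\<close>, which are the indices \<open>1, \<dots>, n\<close>.
\<close>

definition PA_recursively_saturated :: "('f, 'r, 'm) struct \<Rightarrow> bool" where
  "PA_recursively_saturated M \<longleftrightarrow>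
     (\<forall>(p :: ('f, 'r) fm set) n. \<forall>e\<in>assignments M.
        p \<subseteq> formulas L_PA \<and> (\<forall>\<phi>\<in>p. fvb \<phi> \<le> Suc n) \<and> recursive_set (code ` p) \<and>
        (\<forall>q\<subseteq>p. finite q \<longrightarrow> (\<exists>x\<in>carr M. \<forall>\<phi>\<in>q. sat M (case_nat x e) \<phi>)) \<longrightarrow>
        (\<exists>x\<in>carr M. \<forall>\<phi>\<in>p. sat M (case_nat x e) \<phi>))"

text \<open>
  The type \<open>'m\<close> is the universe from which models are drawn: a model is carried by an arbitrary
  subset of \<open>'m\<close>. As HOL cannot quantify over types inside a formula, \<open>'m\<close> is a parameter of
  the notions that quantify over all models.
\<close>

definition imposes_PA_recursive_saturation ::
    "'m itself \<Rightarrow> ('f, 'r) lang \<Rightarrow> ('f, 'r) fm set \<Rightarrow> bool" where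
  "imposes_PA_recursive_saturation _ L U \<longleftrightarrow>
     (\<forall>M :: ('f, 'r, 'm) struct. is_model L M U \<longrightarrow> PA_recursively_saturated M)"


section \<open>Arithmetised syntax and \<open>UTB\<^sup>-\<close>\<close>

primrec num :: "nat \<Rightarrow> 'f tm" where
  "num 0 = Zero"
| "num (Suc n) = Add (num n) One"

definition Opair :: "'f tm \<Rightarrow> 'f tm \<Rightarrow> 'f tm" where
  "Opair s t = Add (Add (Mul (Add s t) (Add s t)) s) One"

definition Code_Zero :: "'f tm" where "Code_Zero = Opair (num 1) (num 0)"
definition Code_One :: "'f tm" where "Code_One = Opair (num 2) (num 0)"
definition Code_Add :: "'f tm \<Rightarrow> 'f tm \<Rightarrow> 'f tm" where "Code_Add s t = Opair (num 3) (Opair s t)"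
definition Code_Mul :: "'f tm \<Rightarrow> 'f tm \<Rightarrow> 'f tm" where "Code_Mul s t = Opair (num 4) (Opair s t)"

text \<open>Finite sets are coded by triples: \<open>u\<close> belongs to the set coded by \<open>a, b, c\<close> iff
  \<open>u < c\<close> and \<open>1 + (u + 1) b\<close> divides \<open>a\<close>.\<close>

definition Mem :: "'f tm \<Rightarrow> 'f tm \<Rightarrow> 'f tm \<Rightarrow> 'f tm \<Rightarrow> ('f, 'r) fm" where
  "Mem u a b c = And (Less u c)
     (Exi (Eq (lift_tm a) (Mul (Add (Mul (Add (lift_tm u) One) (lift_tm b)) One) (Var 0))))"

text \<open>
  The closed terms of \<open>L_PA\<close>: \<open>Var 0\<close> belongs to some coded finite set each of whose elements is
  the code of \<open>0\<close> or \<open>1\<close>, or of a sum or product of elements of the set.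
\<close>

definition Closed_Term :: "('f, 'r) fm" where
  "Closed_Term =
     Exi (Exi (Exi (And
       (Mem (Var 3) (Var 2) (Var 1) (Var 0))
       (Uni (Imp (Mem (Var 0) (Var 3) (Var 2) (Var 1))
         (Or (Eq (Var 0) Code_Zero)
         (Or (Eq (Var 0) Code_One)
         (Exi (Exi (And (Mem (Var 0) (Var 5) (Var 4) (Var 3))
                 (And (Mem (Var 1) (Var 5) (Var 4) (Var 3))
                 (Or (Eq (Var 2) (Code_Add (Var 0) (Var 1)))
                     (Eq (Var 2) (Code_Mul (Var 0) (Var 1)))))))))))))))"

text \<open>
  \<open>Var 0\<close> is the value of the closed term coded by \<open>Var 1\<close>: the pair of the latter and the former
  belongs to a coded finite set of pairs which is closed backwards under the recursion for values.
\<close>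

definition Value :: "('f, 'r) fm" where
  "Value =
     Exi (Exi (Exi (And
       (Mem (Opair (Var 4) (Var 3)) (Var 2) (Var 1) (Var 0))
       (Uni (Uni (Imp (Mem (Opair (Var 1) (Var 0)) (Var 4) (Var 3) (Var 2))
         (Or (And (Eq (Var 1) Code_Zero) (Eq (Var 0) Zero))
         (Or (And (Eq (Var 1) Code_One) (Eq (Var 0) One))
         (Exi (Exi (Exi (Exi
           (And (Mem (Opair (Var 3) (Var 1)) (Var 8) (Var 7) (Var 6))
           (And (Mem (Opair (Var 2) (Var 0)) (Var 8) (Var 7) (Var 6))
           (Or (And (Eq (Var 5) (Code_Add (Var 3) (Var 2))) (Eq (Var 4) (Add (Var 1) (Var 0))))
               (And (Eq (Var 5) (Code_Mul (Var 3) (Var 2)))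
                    (Eq (Var 4) (Mul (Var 1) (Var 0)))))))))))))))))))"

text \<open>
  For an \<open>L_PA\<close>-formula \<open>p\<close>, the term \<open>Code_Inst 0 t p\<close> denotes, as a function of the code \<open>t\<close> of
  a closed term, the code of the result of substituting that closed term for index 0 in \<open>p\<close>; the
  first argument counts the quantifiers passed so far.
\<close>

primrec Code_Inst_tm :: "nat \<Rightarrow> 'f tm \<Rightarrow> 'f tm \<Rightarrow> 'f tm" where
  "Code_Inst_tm k t (Var i) =
     (if i = k then t else Opair (num 0) (num (if i < k then i else i - 1)))"
| "Code_Inst_tm k t Zero = Code_Zero"
| "Code_Inst_tm k t One = Code_One"
| "Code_Inst_tm k t (Add r s) = Code_Add (Code_Inst_tm k t r) (Code_Inst_tm k t s)"
| "Code_Inst_tm k t (Mul r s) = Code_Mul (Code_Inst_tm k t r) (Code_Inst_tm k t s)"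
| "Code_Inst_tm k t (Fn f ts) = Zero"

primrec Code_Inst :: "nat \<Rightarrow> 'f tm \<Rightarrow> ('f, 'r) fm \<Rightarrow> 'f tm" where
  "Code_Inst k t Fls = Opair (num 0) (num 0)"
| "Code_Inst k t (Eq r s) =
     Opair (num 1) (Opair (Code_Inst_tm k t r) (Code_Inst_tm k t s))"
| "Code_Inst k t (Less r s) =
     Opair (num 2) (Opair (Code_Inst_tm k t r) (Code_Inst_tm k t s))"
| "Code_Inst k t (Imp p q) = Opair (num 3) (Opair (Code_Inst k t p) (Code_Inst k t q))"
| "Code_Inst k t (Uni p) = Opair (num 4) (Code_Inst (Suc k) t p)"
| "Code_Inst k t (Rel r ts) = Zero"

text \<open>The language \<open>L_PA \<union> {T}\<close>: formulae whose only relation symbol besides \<open><\<close> is the unary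
  \<open>Tr\<close>, distinct from all symbols of \<open>'r\<close> by typing.\<close>

datatype truth = Tr

definition UTB_axiom :: "('f, truth) fm \<Rightarrow> ('f, truth) fm" where
  "UTB_axiom p =
     Uni (Imp Closed_Term
       (Exi (And Value (Iff (Rel Tr [Code_Inst 0 (Var 1) p]) p))))"

definition UTB_minus :: "('f, truth) fm set" where
  "UTB_minus = PA \<union> UTB_axiom ` {p \<in> formulas L_PA. fvb p \<le> 1}"


section \<open>Semantic definability\<close>

text \<open>
  \<open>T_subst \<theta> 0 \<Phi>\<close> is \<open>\<Phi>[\<theta>/T]\<close> for a sentence \<open>\<Phi>\<close> in the language with \<open>T\<close>. The variable \<open>x\<close> of
  \<open>\<theta>(x)\<close> is index 0 of \<open>\<theta>\<close>, while its parameters are the indices \<open>1, 2, \<dots>\<close>, which appear as the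
  free indices \<open>0, 1, \<dots>\<close> of the result. The second argument counts the quantifiers passed so far.
\<close>

primrec T_subst :: "('f, 'r) fm \<Rightarrow> nat \<Rightarrow> ('f, truth) fm \<Rightarrow> ('f, 'r) fm" where
  "T_subst \<theta> k Fls = Fls"
| "T_subst \<theta> k (Eq s t) = Eq s t"
| "T_subst \<theta> k (Less s t) = Less s t"
| "T_subst \<theta> k (Rel _ ts) = subst_fm (case_nat (hd ts) (\<lambda>j. Var (k + j))) \<theta>"
| "T_subst \<theta> k (Imp p q) = Imp (T_subst \<theta> k p) (T_subst \<theta> k q)"
| "T_subst \<theta> k (Uni p) = Uni (T_subst \<theta> (Suc k) p)"

definition semantically_defines ::
    "'m itself \<Rightarrow> ('f, 'r) lang \<Rightarrow> ('f, 'r) fm set \<Rightarrow> ('f, truth) fm set \<Rightarrow> bool" where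
  "semantically_defines _ L U V \<longleftrightarrow>
     (\<forall>M :: ('f, 'r, 'm) struct. is_model L M U \<longrightarrow>
        (\<exists>\<theta>\<in>formulas L. \<exists>e\<in>assignments M. \<forall>\<Phi>\<in>V. sat M e (T_subst \<theta> 0 \<Phi>)))"

end

theory Submission
  imports Defs
begin

text \<open>
  Let \<open>M\<close> be a model of \<open>U\<close>. Consider the recursive type \<open>\<tau>(x, d)\<close> saying of every arithmetical
  formula \<open>p\<close> that \<open>x\<close> codes a set deciding \<open>p(t)\<close> correctly for all closed terms \<open>t < d\<close>. It is
  finitely satisfiable in every model of \<open>PA\<close>, for every \<open>d\<close>.

  Build a countable model \<open>N \<equiv> M\<close> with a distinguished element \<open>d\<close> by a generic (Henkin)
  construction whose conditions are the formulae that hold in \<open>M\<close> for unboundedly many values of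
  \<open>d\<close>. If the realisations of \<open>\<tau>\<close> could always be avoided, \<open>N\<close> would be a model of \<open>U\<close> whose
  arithmetical reduct is not recursively saturated. So some condition \<open>p\<close> isolates \<open>\<tau>\<close> at some
  index \<open>n\<close>: for every arithmetical formula there is a bound in \<open>M\<close> beyond which the \<open>n\<close>-th
  coordinate of any solution of \<open>p\<close> codes its truth set below \<open>d\<close>. Membership in these sets for
  arbitrarily large \<open>d\<close> then defines a truth predicate satisfying \<open>UTB\<^sup>-\<close>.
\<close>

section \<open>Substitution and satisfaction\<close>

text \<open>Saturation of \<open>M\<close> itself does not give the definition: a realisation of the
  type covers only the terms below one \<open>d\<close>, no \<open>d\<close> lies above all terms,
  and nothing so far selects realisations for different \<open>d\<close> definably. One formula is
  needed that works for cofinally many \<open>d\<close>, and isolation provides it. Hence the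
  hypothesis on \<open>U\<close> is applied not to \<open>M\<close> but to a model built to omit the
  type. Countability of the language lets all demands on that model be met along one sequence of
  conditions. The bound beyond which an isolating condition is correct depends on the arithmetical
  formula, and no single bound need serve all of them; so the truth predicate cannot fix one
  \<open>d\<close> and asks for arbitrarily large ones. Finite satisfiability rests on comprehension
  for bounded definable sets, for which induction for arithmetical formulae suffices. This part is
  carried out in structures whose carrier is the whole type \<open>nat\<close>, where algebraic
  locales apply, and is transferred to \<open>M\<close> along elementary equivalence.\<close>

lemma le_foldr_max: "x \<in> set xs \<Longrightarrow> x \<le> foldr max xs (0::nat)"
  by (induction xs) auto

lemma foldr_max_le: "foldr max xs (0::nat) \<le> k \<longleftrightarrow> (\<forall>x\<in>set xs. x \<le> k)"
  by (induction xs) auto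

lemma val_tm_cong: "(\<And>i. i < fvb_tm t \<Longrightarrow> e i = e' i) \<Longrightarrow> val_tm M e t = val_tm M e' t"
proof (induction t)
  case (Fn f ts)
  have "val_tm M e s = val_tm M e' s" if "s \<in> set ts" for s
  proof (rule Fn.IH[OF that])
    fix i assume "i < fvb_tm s"
    also have "\<dots> \<le> fvb_tm (Fn f ts)"
      using that by (auto intro!: le_foldr_max)
    finally show "e i = e' i" by (rule Fn.prems)
  qed
  then show ?case by (auto cong: map_cong)
qed auto

lemma sat_cong: "(\<And>i. i < fvb p \<Longrightarrow> e i = e' i) \<Longrightarrow> sat M e p \<longleftrightarrow> sat M e' p"
proof (induction p arbitrary: e e')
  case (Eq s t)
  then have "val_tm M e s = val_tm M e' s" "val_tm M e t = val_tm M e' t"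
    by (auto intro: val_tm_cong)
  then show ?case by simp
next
  case (Less s t)
  then have "val_tm M e s = val_tm M e' s" "val_tm M e t = val_tm M e' t"
    by (auto intro: val_tm_cong)
  then show ?case by simp
next
  case (Rel r ts)
  have "val_tm M e s = val_tm M e' s" if "s \<in> set ts" for s
  proof (rule val_tm_cong)
    fix i assume "i < fvb_tm s"
    also have "\<dots> \<le> fvb (Rel r ts)"
      using that by (auto intro!: le_foldr_max)
    finally show "e i = e' i" by (rule Rel.prems)
  qed
  then show ?case by (auto cong: map_cong)
next
  case (Imp p q)
  have "sat M e p = sat M e' p" "sat M e q = sat M e' q"
    by (rule Imp.IH; simp add: Imp.prems)+
  then show ?case by simp
next
  case (Uni p)
  have "sat M (case_nat x e) p = sat M (case_nat x e') p" for x
    by (rule Uni.IH) (auto split: nat.split intro: Uni.prems)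
  then show ?case by simp
qed auto

lemma val_subst_tm: "val_tm M e (subst_tm \<sigma> t) = val_tm M (\<lambda>i. val_tm M e (\<sigma> i)) t"
  by (induction t) (auto cong: map_cong)

lemma sat_subst_fm: "sat M e (subst_fm \<sigma> p) \<longleftrightarrow> sat M (\<lambda>i. val_tm M e (\<sigma> i)) p"
proof (induction p arbitrary: e \<sigma>)
  case (Uni p)
  have "(\<lambda>i. val_tm M (case_nat x e) (up \<sigma> i)) = case_nat x (\<lambda>i. val_tm M e (\<sigma> i))" for x
    by (rule ext) (simp add: up_def val_subst_tm split: nat.split)
  then show ?case by (simp add: Uni.IH)
qed (auto simp: val_subst_tm comp_def)

lemma wf_subst_tm: "wf_tm F t \<Longrightarrow> (\<And>i. wf_tm F (\<sigma> i)) \<Longrightarrow> wf_tm F (subst_tm \<sigma> t)"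
  by (induction t) (auto simp: list_all_iff)

lemma wf_subst_fm: "wf_fm L p \<Longrightarrow> (\<And>i. wf_tm (fst L) (\<sigma> i)) \<Longrightarrow> wf_fm L (subst_fm \<sigma> p)"
proof (induction p arbitrary: \<sigma>)
  case (Uni p)
  have "wf_tm (fst L) (up \<sigma> i)" for i
    using Uni.prems(2) by (cases i) (simp_all add: up_def wf_subst_tm)
  then show ?case using Uni by simp
qed (auto simp: wf_subst_tm list_all_iff)

lemma wf_tm_mono: "wf_tm F t \<Longrightarrow> F \<subseteq> G \<Longrightarrow> wf_tm G t"
  by (induction t) (auto simp: list_all_iff)

lemma wf_fm_mono: "wf_fm L p \<Longrightarrow> fst L \<subseteq> fst L' \<Longrightarrow> snd L \<subseteq> snd L' \<Longrightarrow> wf_fm L' p"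
  by (induction p) (auto simp: list_all_iff wf_tm_mono)

lemma formulas_L_PA_subset: "formulas L_PA \<subseteq> formulas L"
  by (auto simp: formulas_def L_PA_def intro: wf_fm_mono)

lemma case_nat_in_assignments:
  "x \<in> carr M \<Longrightarrow> e \<in> assignments M \<Longrightarrow> case_nat x e \<in> assignments M"
  by (auto simp: assignments_def image_subset_iff split: nat.split)

lemma assignmentsD: "e \<in> assignments M \<Longrightarrow> e i \<in> carr M"
  by (auto simp: assignments_def)

lemma assignmentsI: "(\<And>i. e i \<in> carr M) \<Longrightarrow> e \<in> assignments M"
  by (auto simp: assignments_def)

lemma val_tm_in_carr:
  assumes "is_struct L M" "e \<in> assignments M" "wf_tm (fst L) t"
  shows "val_tm M e t \<in> carr M"
  using assms(3)
proof (induction t)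
  case (Fn f ts)
  then have "(f, length ts) \<in> fst L" "set (map (val_tm M e) ts) \<subseteq> carr M"
    by (auto simp: list_all_iff)
  then show ?case
    using assms(1) unfolding is_struct_def by fastforce
qed (use assms in \<open>auto simp: is_struct_def assignments_def\<close>)

lemma sat_Uni_funpow:
  assumes "e \<in> assignments M"
  shows "sat M e ((Uni ^^ k) p) \<longleftrightarrow>
    (\<forall>f\<in>assignments M. sat M (\<lambda>i. if i < k then f i else e (i - k)) p)"
  using assms
proof (induction k arbitrary: e)
  case 0
  then show ?case by auto
next
  case (Suc k)
  \<comment> \<open>The outermost of the \<open>Suc k\<close> quantifiers is the one that the matrix
    sees at index \<open>k\<close>, whence the update of \<open>f\<close> there.\<close>
  have env: "(\<lambda>i. if i < k then f i else case_nat x e (i - k)) =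
    (\<lambda>i. if i < Suc k then (f(k := x)) i else e (i - Suc k))" for f x
  proof (rule ext)
    fix i
    consider "i < k" | "i = k" | j where "i = Suc (k + j)"
      by (metis less_imp_Suc_add linorder_neqE_nat)
    then show "(if i < k then f i else case_nat x e (i - k)) =
      (if i < Suc k then (f(k := x)) i else e (i - Suc k))"
      by cases (auto simp: Suc_diff_le)
  qed
  have "sat M e ((Uni ^^ Suc k) p) \<longleftrightarrow> (\<forall>x\<in>carr M. \<forall>f\<in>assignments M.
    sat M (\<lambda>i. if i < Suc k then (f(k := x)) i else e (i - Suc k)) p)"
    using Suc.prems by (simp add: Suc.IH case_nat_in_assignments env)
  also have "\<dots> \<longleftrightarrow> (\<forall>f\<in>assignments M.
    sat M (\<lambda>i. if i < Suc k then f i else e (i - Suc k)) p)"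
  proof (intro iffI ballI)
    fix f assume *: "\<forall>x\<in>carr M. \<forall>f\<in>assignments M.
      sat M (\<lambda>i. if i < Suc k then (f(k := x)) i else e (i - Suc k)) p" "f \<in> assignments M"
    then show "sat M (\<lambda>i. if i < Suc k then f i else e (i - Suc k)) p"
      using bspec[OF bspec[OF *(1), of "f k"], of f] assignmentsD[OF *(2)]
      by (simp only: fun_upd_triv)
  next
    fix f x assume *: "\<forall>f\<in>assignments M.
      sat M (\<lambda>i. if i < Suc k then f i else e (i - Suc k)) p" "f \<in> assignments M" "x \<in> carr M"
    then have "f(k := x) \<in> assignments M"
      by (auto simp: assignments_def)
    then show "sat M (\<lambda>i. if i < Suc k then (f(k := x)) i else e (i - Suc k)) p"
      using *(1) by blast
  qed
  finally show ?case .
qed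

lemma sat_univ_close:
  assumes "e \<in> assignments M"
  shows "sat M e (univ_close p) \<longleftrightarrow> (\<forall>f\<in>assignments M. sat M f p)"
proof -
  have "sat M (\<lambda>i. if i < fvb p then f i else e (i - fvb p)) p \<longleftrightarrow> sat M f p" for f
    by (rule sat_cong) simp
  then show ?thesis using assms by (simp add: univ_close_def sat_Uni_funpow)
qed

lemma sat_Exi_funpow:
  assumes "e \<in> assignments M"
  shows "sat M e (((\<lambda>p. Exi p) ^^ k) p) \<longleftrightarrow>
    (\<exists>f\<in>assignments M. sat M (\<lambda>i. if i < k then f i else e (i - k)) p)"
proof -
  have "sat M e (((\<lambda>p. Exi p) ^^ k) p) \<longleftrightarrow> \<not> sat M e ((Uni ^^ k) (Neg p))"
    if "e \<in> assignments M" for e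
    using that
    by (induction k arbitrary: e) (auto simp: case_nat_in_assignments)
  then show ?thesis using assms by (simp add: sat_Uni_funpow)
qed

section \<open>Countability of the set of formulae\<close>

instance tm :: (countable) countable by countable_datatype
instance fm :: (countable, countable) countable by countable_datatype

lemma set_tm_wf: "wf_tm F t \<Longrightarrow> set_tm t \<subseteq> fst ` F"
proof (induction t)
  case (Fn f ts)
  then have "f \<in> fst ` F" "\<forall>t\<in>set ts. set_tm t \<subseteq> fst ` F"
    by (auto simp: list_all_iff intro: rev_image_eqI)
  then show ?case by auto
qed auto

lemma set_fm_wf: "wf_fm L p \<Longrightarrow> set1_fm p \<subseteq> fst ` fst L \<and> set2_fm p \<subseteq> fst ` snd L"
proof (induction p)
  case (Rel r ts)
  then have "r \<in> fst ` snd L" "\<forall>t\<in>set ts. set_tm t \<subseteq> fst ` fst L"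
    by (auto simp: list_all_iff set_tm_wf intro: rev_image_eqI)
  then show ?case by auto
next
  case (Eq s t)
  then show ?case using set_tm_wf[of "fst L"] by auto
next
  case (Less s t)
  then show ?case using set_tm_wf[of "fst L"] by auto
qed auto

text \<open>The types of names may be uncountable, so the symbols are renamed to natural numbers;
  the renaming is injective only on names that belong to \<open>L\<close>, which is enough because
  no others occur.\<close>

lemma countable_formulas:
  assumes "countable_lang L"
  shows "countable (formulas L)"
proof -
  let ?g = "to_nat_on (fst ` fst L)" and ?h = "to_nat_on (fst ` snd L)"
  have "countable (fst ` fst L)" "countable (fst ` snd L)"
    using assms by (auto simp: countable_lang_def)
  then have inj: "inj_on ?g (fst ` fst L)" "inj_on ?h (fst ` snd L)"
    by (auto intro: inj_on_to_nat_on)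
  have "inj_on (map_fm ?g ?h) (formulas L)"
  proof (rule inj_onI)
    fix p q assume "p \<in> formulas L" "q \<in> formulas L" and eq: "map_fm ?g ?h p = map_fm ?g ?h q"
    then have sub: "set1_fm p \<subseteq> fst ` fst L" "set1_fm q \<subseteq> fst ` fst L"
      "set2_fm p \<subseteq> fst ` snd L" "set2_fm q \<subseteq> fst ` snd L"
      by (simp_all add: formulas_def set_fm_wf)
    show "p = q"
    proof (rule fm.inj_map_strong[OF _ _ eq])
      show "z = z'" if "z \<in> set1_fm p" "z' \<in> set1_fm q" "?g z = ?g z'" for z z'
        using inj_onD[OF inj(1) that(3)] sub that by blast
      show "z = z'" if "z \<in> set2_fm p" "z' \<in> set2_fm q" "?h z = ?h z'" for z z'
        using inj_onD[OF inj(2) that(3)] sub that by blast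
    qed
  qed
  then show ?thesis
    by (rule countable_image_inj_on[rotated]) auto
qed

section \<open>Generic term models\<close>

text \<open>Consequence over the assignments of the one structure \<open>M\<close>, in place of
  derivability. Whatever \<open>M\<close> satisfies under all assignments follows from the empty
  set, which is what makes the generic models elementarily equivalent to \<open>M\<close>.\<close>

definition entails :: "('f, 'r, 'm) struct \<Rightarrow> ('f, 'r) fm set \<Rightarrow> ('f, 'r) fm \<Rightarrow> bool" where
  "entails M \<Delta> p \<longleftrightarrow> (\<forall>e\<in>assignments M. (\<forall>q\<in>\<Delta>. sat M e q) \<longrightarrow> sat M e p)"

text \<open>Variables double as Henkin constants: in a Henkin set the free index \<open>i\<close>
  names an element, and \<open>inst i\<close> plugs that name into the bound index 0.\<close>

abbreviation inst :: "nat \<Rightarrow> ('f, 'r) fm \<Rightarrow> ('f, 'r) fm" where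
  "inst i p \<equiv> subst_fm (case_nat (Var i) Var) p"

definition henkin :: "('f, 'r) lang \<Rightarrow> ('f, 'r, 'm) struct \<Rightarrow> ('f, 'r) fm set \<Rightarrow> bool" where
  "henkin L M \<Gamma> \<longleftrightarrow> \<Gamma> \<subseteq> formulas L \<and> Fls \<notin> \<Gamma> \<and>
     (\<forall>p\<in>formulas L. p \<in> \<Gamma> \<or> Neg p \<in> \<Gamma>) \<and>
     (\<forall>\<Delta> p. finite \<Delta> \<and> \<Delta> \<subseteq> \<Gamma> \<and> p \<in> formulas L \<and> entails M \<Delta> p \<longrightarrow> p \<in> \<Gamma>) \<and>
     (\<forall>p. Neg (Uni p) \<in> \<Gamma> \<longrightarrow> (\<exists>i. Neg (inst i p) \<in> \<Gamma>))"

text \<open>The forcing conditions: index 0 stands for the element \<open>d\<close>, the others for arbitrary witnesses.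
  No parameters from \<open>M\<close> are allowed, so there are only countably many conditions even if \<open>M\<close> is
  uncountable.\<close>

definition unbounded_sat :: "('f, 'r, 'm) struct \<Rightarrow> ('f, 'r) fm \<Rightarrow> bool" where
  "unbounded_sat M p \<longleftrightarrow>
     (\<forall>m\<in>carr M. \<exists>e\<in>assignments M. iless M m (e 0) \<and> sat M e p)"

locale unbounded_struct =
  fixes L :: "('f, 'r) lang" and M :: "('f, 'r, 'm) struct"
  assumes lang: "countable_lang L" and struct: "is_struct L M"
    and directed: "\<lbrakk>m \<in> carr M; m' \<in> carr M\<rbrakk> \<Longrightarrow>
      \<exists>m''\<in>carr M. \<forall>x\<in>carr M. iless M m'' x \<longrightarrow> iless M m x \<and> iless M m' x"
    and unbounded: "m \<in> carr M \<Longrightarrow> \<exists>x\<in>carr M. iless M m x"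
begin

text \<open>If \<open>p\<close> and \<open>q\<close> hold together only up to some bound, then
  beyond a common bound of that one and the required one every solution of \<open>p\<close> refutes
  \<open>q\<close>.\<close>

lemma unbounded_sat_split:
  assumes "unbounded_sat M p" "\<not> unbounded_sat M (And p q)"
  shows "unbounded_sat M (And p (Neg q))"
  unfolding unbounded_sat_def
proof
  fix m assume m: "m \<in> carr M"
  obtain m' where m': "m' \<in> carr M"
    "\<And>e. e \<in> assignments M \<Longrightarrow> iless M m' (e 0) \<Longrightarrow> sat M e p \<Longrightarrow> \<not> sat M e q"
    using assms(2) by (auto simp: unbounded_sat_def)
  obtain m'' where m'': "m'' \<in> carr M"
    "\<forall>x\<in>carr M. iless M m'' x \<longrightarrow> iless M m x \<and> iless M m' x"
    using directed[OF m m'(1)] by blast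
  obtain e where "e \<in> assignments M" "iless M m'' (e 0)" "sat M e p"
    using assms(1) m''(1) by (auto simp: unbounded_sat_def)
  then show "\<exists>e\<in>assignments M. iless M m (e 0) \<and> sat M e (And p (Neg q))"
    using m''(2) m'(2) by (intro bexI[of _ e]) (auto dest: assignmentsD)
qed

lemma unbounded_sat_Neg_Uni:
  assumes "unbounded_sat M p" "entails M {p} (Neg (Uni q))"
  shows "\<exists>i. unbounded_sat M (And p (Neg (inst i q)))"
proof -
  \<comment> \<open>Beyond all free indices of \<open>p\<close> and \<open>q\<close>, hence free to
    name the counterexample; the successor also keeps it away from index 0, which holds
    \<open>d\<close>.\<close>
  define i where "i = Suc (max (fvb p) (fvb q))"
  have "unbounded_sat M (And p (Neg (inst i q)))"
    unfolding unbounded_sat_def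
  proof
    fix m assume "m \<in> carr M"
    then obtain e where e: "e \<in> assignments M" "iless M m (e 0)" "sat M e p"
      using assms(1) by (auto simp: unbounded_sat_def)
    then obtain x where x: "x \<in> carr M" "\<not> sat M (case_nat x e) q"
      using assms(2) by (auto simp: entails_def)
    have "sat M (e(i := x)) p \<longleftrightarrow> sat M e p"
      by (rule sat_cong) (auto simp: i_def)
    moreover have "sat M (e(i := x)) (inst i q) \<longleftrightarrow> sat M (case_nat x e) q"
      unfolding sat_subst_fm by (rule sat_cong) (auto simp: i_def split: nat.split)
    moreover have "(e(i := x)) 0 = e 0" "e(i := x) \<in> assignments M"
      using e(1) x(1) by (auto simp: i_def assignments_def)
    ultimately show "\<exists>e\<in>assignments M. iless M m (e 0) \<and> sat M e (And p (Neg (inst i q)))"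
      using e x by (intro bexI[of _ "e(i := x)"]) auto
  qed
  then show ?thesis ..
qed

text \<open>One round of the construction: \<open>q\<close> is decided, a refuted universal formula
  receives a counterexample, and the dense set \<open>R\<close> is entered. The outcome is recorded
  through entailment because that is inherited by all stronger conditions.\<close>

lemma unbounded_sat_refine:
  assumes p: "p \<in> formulas L" "unbounded_sat M p" and q: "q \<in> formulas L"
    and R: "R \<subseteq> formulas L"
      "\<And>p. p \<in> formulas L \<Longrightarrow> unbounded_sat M p \<Longrightarrow> \<exists>r\<in>R. unbounded_sat M (And p r)"
  shows "\<exists>p'\<in>formulas L. unbounded_sat M p' \<and> entails M {p'} p \<and>
    (entails M {p'} q \<or> entails M {p'} (Neg q) \<and>
      (\<forall>q'. q = Uni q' \<longrightarrow> (\<exists>i. entails M {p'} (Neg (inst i q'))))) \<and>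
    (\<exists>r\<in>R. entails M {p'} r)"
proof -
  have "\<exists>p'\<in>formulas L. unbounded_sat M p' \<and> entails M {p'} p \<and>
    (entails M {p'} q \<or> entails M {p'} (Neg q) \<and>
      (\<forall>q'. q = Uni q' \<longrightarrow> (\<exists>i. entails M {p'} (Neg (inst i q')))))"
  proof (cases "unbounded_sat M (And p q)")
    case True
    then show ?thesis
      using p q by (intro bexI[of _ "And p q"]) (auto simp: entails_def formulas_def)
  next
    case False
    then have *: "unbounded_sat M (And p (Neg q))"
      using p unbounded_sat_split by blast
    have pq: "And p (Neg q) \<in> formulas L"
      using p q by (auto simp: formulas_def)
    show ?thesis
    proof (cases "\<exists>q'. q = Uni q'")
      case False
      then show ?thesis
        using * pq by (intro bexI[of _ "And p (Neg q)"]) (auto simp: entails_def)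
    next
      case True
      then obtain q' where q': "q = Uni q'" ..
      have "entails M {And p (Neg q)} (Neg (Uni q'))"
        by (auto simp: entails_def q')
      from unbounded_sat_Neg_Uni[OF * this] obtain i
        where i: "unbounded_sat M (And (And p (Neg q)) (Neg (inst i q')))" ..
      have "And (And p (Neg q)) (Neg (inst i q')) \<in> formulas L"
        using pq q by (auto simp: q' formulas_def intro!: wf_subst_fm split: nat.split)
      then show ?thesis
        using i by (intro bexI[of _ "And (And p (Neg q)) (Neg (inst i q'))"])
          (auto simp: entails_def q')
    qed
  qed
  then obtain p' where p': "p' \<in> formulas L" "unbounded_sat M p'" "entails M {p'} p"
    "entails M {p'} q \<or> entails M {p'} (Neg q) \<and>
      (\<forall>q'. q = Uni q' \<longrightarrow> (\<exists>i. entails M {p'} (Neg (inst i q'))))"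
    by blast
  obtain r where r: "r \<in> R" "unbounded_sat M (And p' r)"
    using R(2)[OF p'(1,2)] by blast
  have mono: "entails M {And p' r} s" if "entails M {p'} s" for s
    using that by (auto simp: entails_def)
  show ?thesis
  proof (rule bexI[of _ "And p' r"], intro conjI)
    show "unbounded_sat M (And p' r)" by fact
    show "entails M {And p' r} p" using p' mono by blast
    show "entails M {And p' r} q \<or> entails M {And p' r} (Neg q) \<and>
      (\<forall>q'. q = Uni q' \<longrightarrow> (\<exists>i. entails M {And p' r} (Neg (inst i q'))))"
      using p'(4) mono by blast
    show "\<exists>r'\<in>R. entails M {And p' r} r'"
      using r by (intro bexI[of _ r]) (auto simp: entails_def)
    show "And p' r \<in> formulas L"
      using p' r R(1) by (auto simp: formulas_def)
  qed
qed

text \<open>A generic set in the style of Rasiowa and Sikorski: step \<open>n\<close> decides the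
  n-th formula and meets the n-th dense set.\<close>

lemma henkin_exists:
  assumes R: "\<And>n. R n \<subseteq> formulas L"
    "\<And>n p. p \<in> formulas L \<Longrightarrow> unbounded_sat M p \<Longrightarrow> \<exists>r\<in>R n. unbounded_sat M (And p r)"
  shows "\<exists>\<Gamma>. henkin L M \<Gamma> \<and> (\<forall>n::nat. R n \<inter> \<Gamma> \<noteq> {})"
proof -
  have ne: "formulas L \<noteq> {}"
    by (auto simp: formulas_def intro!: exI[of _ Fls])
  define \<phi> where "\<phi> = from_nat_into (formulas L)"
  have \<phi>: "range \<phi> = formulas L"
    unfolding \<phi>_def using countable_formulas[OF lang] ne by (rule range_from_nat_into[rotated])
  let ?Q = "\<lambda>n p p'. entails M {p'} p \<and>
      (entails M {p'} (\<phi> n) \<or> entails M {p'} (Neg (\<phi> n)) \<and>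
        (\<forall>q'. \<phi> n = Uni q' \<longrightarrow> (\<exists>i. entails M {p'} (Neg (inst i q'))))) \<and>
      (\<exists>r\<in>R n. entails M {p'} r)"
  have "\<exists>s. \<forall>n. (s n \<in> formulas L \<and> unbounded_sat M (s n)) \<and> ?Q n (s n) (s (Suc n))"
  proof (rule dependent_nat_choice)
    show "\<exists>p. p \<in> formulas L \<and> unbounded_sat M p"
    proof (intro exI[of _ "Neg Fls"] conjI)
      show "unbounded_sat M (Neg Fls)"
        unfolding unbounded_sat_def
      proof
        fix m assume "m \<in> carr M"
        then obtain x where "x \<in> carr M" "iless M m x" using unbounded by blast
        then show "\<exists>e\<in>assignments M. iless M m (e 0) \<and> sat M e (Neg Fls)"
          by (intro bexI[of _ "\<lambda>_. x"]) (auto simp: assignments_def)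
      qed
    qed (simp add: formulas_def)
  next
    fix p n assume "p \<in> formulas L \<and> unbounded_sat M p"
    moreover have "\<phi> n \<in> formulas L" using \<phi> by blast
    ultimately show "\<exists>p'. (p' \<in> formulas L \<and> unbounded_sat M p') \<and> ?Q n p p'"
      using unbounded_sat_refine[of p "\<phi> n" "R n", OF _ _ _ R(1) R(2)] by blast
  qed
  then obtain s where s: "\<And>n. s n \<in> formulas L" "\<And>n. unbounded_sat M (s n)"
    "\<And>n. ?Q n (s n) (s (Suc n))"
    by blast
  have mono: "entails M {s j} (s i)" if "i \<le> j" for i j
    using that
  proof (induction rule: dec_induct)
    case base
    then show ?case by (simp add: entails_def)
  next
    case (step n)
    then show ?case using s(3)[of n] by (auto simp: entails_def)
  qed
  define \<Gamma> where "\<Gamma> = {p \<in> formulas L. \<exists>n. entails M {s n} p}"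
  have fin: "\<exists>n. \<forall>q\<in>\<Delta>. entails M {s n} q" if "finite \<Delta>" "\<Delta> \<subseteq> \<Gamma>" for \<Delta>
    using that
  proof (induction rule: finite_induct)
    case (insert q \<Delta>)
    then obtain n m where n: "\<forall>q\<in>\<Delta>. entails M {s n} q" and m: "entails M {s m} q"
      by (auto simp: \<Gamma>_def)
    have "entails M {s (max n m)} r" if "r \<in> insert q \<Delta>" for r
      using n m that mono[of n "max n m"] mono[of m "max n m"] by (auto simp: entails_def)
    then show ?case by blast
  qed auto
  have "carr M \<noteq> {}" using struct by (auto simp: is_struct_def)
  have "Fls \<notin> \<Gamma>"
  proof
    assume "Fls \<in> \<Gamma>"
    then obtain n where "entails M {s n} Fls" by (auto simp: \<Gamma>_def)
    then show False
      using s(2)[of n] \<open>carr M \<noteq> {}\<close> by (auto simp: entails_def unbounded_sat_def)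
  qed
  moreover have "p \<in> \<Gamma> \<or> Neg p \<in> \<Gamma>" if p: "p \<in> formulas L" for p
  proof -
    obtain n where "p = \<phi> n" using \<phi> p by blast
    then show ?thesis using s(3)[of n] p by (auto simp: \<Gamma>_def formulas_def)
  qed
  moreover have closed: "p \<in> \<Gamma>"
    if *: "finite \<Delta>" "\<Delta> \<subseteq> \<Gamma>" "p \<in> formulas L" "entails M \<Delta> p" for \<Delta> p
  proof -
    obtain n where "\<forall>q\<in>\<Delta>. entails M {s n} q" using fin[OF *(1,2)] by blast
    then have "entails M {s n} p" using *(4) by (auto simp: entails_def)
    then show ?thesis using * by (auto simp: \<Gamma>_def)
  qed
  moreover have "\<exists>i. Neg (inst i p) \<in> \<Gamma>" if "Neg (Uni p) \<in> \<Gamma>" for p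
  proof -
    have "Uni p \<in> formulas L" using that by (auto simp: \<Gamma>_def formulas_def)
    then obtain n where n: "Uni p = \<phi> n" using \<phi> by blast
    \<comment> \<open>With the first alternative of \<open>?Q\<close> excluded, the second one
      supplies the counterexample.\<close>
    have "\<not> entails M {s (Suc n)} (Uni p)"
    proof
      assume "entails M {s (Suc n)} (Uni p)"
      then have "Uni p \<in> \<Gamma>" using \<open>Uni p \<in> formulas L\<close> by (auto simp: \<Gamma>_def)
      then have "Fls \<in> \<Gamma>"
        using closed[of "{Uni p, Neg (Uni p)}" Fls] that
        by (auto simp: entails_def formulas_def)
      then show False using \<open>Fls \<notin> \<Gamma>\<close> by blast
    qed
    then obtain i where "entails M {s (Suc n)} (Neg (inst i p))"
      using s(3)[of n] n by metis
    moreover have "Neg (inst i p) \<in> formulas L"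
      using \<open>Uni p \<in> formulas L\<close>
      by (auto simp: formulas_def intro!: wf_subst_fm split: nat.split)
    ultimately show ?thesis by (auto simp: \<Gamma>_def)
  qed
  ultimately have "henkin L M \<Gamma>"
    by (auto simp: henkin_def \<Gamma>_def)
  moreover have "R n \<inter> \<Gamma> \<noteq> {}" for n
    using s(3)[of n] R(1)[of n] by (auto simp: \<Gamma>_def)
  ultimately show ?thesis by blast
qed

end

text \<open>Here \<open>q\<close> is an arbitrary enumeration, with the kernel prescribed by \<open>\<Gamma>\<close>, of the
  carrier of the term model, so that the universe of the model may be chosen freely.\<close>

lemma henkin_model:
  fixes M :: "('f, 'r, 'm) struct" and q :: "nat \<Rightarrow> 'n"
  assumes "henkin L M \<Gamma>" "is_struct L M"
    and q: "\<And>i j. q i = q j \<longleftrightarrow> Eq (Var i) (Var j) \<in> \<Gamma>"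
  shows "\<exists>N :: ('f, 'r, 'n) struct. carr N = range q \<and> is_struct L N \<and>
    (\<forall>p\<in>formulas L. \<forall>\<rho>. sat N (\<lambda>i. q (\<rho> i)) p \<longleftrightarrow> subst_fm (\<lambda>i. Var (\<rho> i)) p \<in> \<Gamma>)"
proof -
  have sub: "\<Gamma> \<subseteq> formulas L" and Fls: "Fls \<notin> \<Gamma>"
    and compl: "\<And>p. p \<in> formulas L \<Longrightarrow> p \<in> \<Gamma> \<or> Neg p \<in> \<Gamma>"
    and closed: "\<And>\<Delta> p. finite \<Delta> \<Longrightarrow> \<Delta> \<subseteq> \<Gamma> \<Longrightarrow> p \<in> formulas L \<Longrightarrow> entails M \<Delta> p \<Longrightarrow> p \<in> \<Gamma>"
    and witness: "\<And>p. Neg (Uni p) \<in> \<Gamma> \<Longrightarrow> \<exists>i. Neg (inst i p) \<in> \<Gamma>"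
    using assms(1) unfolding henkin_def by blast+
  have Neg: "Neg p \<in> \<Gamma> \<longleftrightarrow> p \<notin> \<Gamma>" if "p \<in> formulas L" for p
  proof
    assume "Neg p \<in> \<Gamma>"
    show "p \<notin> \<Gamma>"
    proof
      assume "p \<in> \<Gamma>"
      then have "Fls \<in> \<Gamma>"
        using \<open>Neg p \<in> \<Gamma>\<close> by (intro closed[of "{p, Neg p}"]) (auto simp: entails_def formulas_def)
      then show False using Fls by blast
    qed
  qed (use compl that in blast)
  have equiv: "p \<in> \<Gamma> \<longleftrightarrow> p' \<in> \<Gamma>"
    if "p \<in> formulas L" "p' \<in> formulas L" "\<And>e. e \<in> assignments M \<Longrightarrow> sat M e p \<longleftrightarrow> sat M e p'"
    for p p'
    using closed[of "{p}" p'] closed[of "{p'}" p] that by (auto simp: entails_def)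
  have wf_sub: "subst_fm (\<lambda>i. Var (\<rho> i)) p \<in> formulas L" if "p \<in> formulas L" for p \<rho>
    using that by (auto simp: formulas_def intro!: wf_subst_fm)
  have Uni_in: "Uni p \<in> \<Gamma> \<longleftrightarrow> (\<forall>i. inst i p \<in> \<Gamma>)" if "Uni p \<in> formulas L" for p
  proof (intro iffI allI)
    fix i assume "Uni p \<in> \<Gamma>"
    moreover have "sat M e (inst i p)" if "sat M e (Uni p)" "e \<in> assignments M" for e
    proof -
      have "(\<lambda>j. val_tm M e (case_nat (Var i) Var j)) = case_nat (e i) e"
        by (rule ext) (simp split: nat.split)
      then show ?thesis using that by (simp add: sat_subst_fm assignmentsD)
    qed
    ultimately show "inst i p \<in> \<Gamma>"
      using that by (intro closed[of "{Uni p}"])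
        (auto simp: entails_def formulas_def intro!: wf_subst_fm split: nat.split)
  next
    assume *: "\<forall>i. inst i p \<in> \<Gamma>"
    show "Uni p \<in> \<Gamma>"
    proof (rule ccontr)
      assume "Uni p \<notin> \<Gamma>"
      then have "Neg (Uni p) \<in> \<Gamma>" using compl[OF that] by simp
      then obtain i where "Neg (inst i p) \<in> \<Gamma>" using witness by blast
      then show False using * Neg sub by blast
    qed
  qed
  define wft where "wft = {t. wf_tm (fst L) t}"
  have eq_trans: "Eq b c \<in> \<Gamma>" if "Eq a b \<in> \<Gamma>" "Eq a c \<in> \<Gamma>" for a b c
    using that sub
    by (intro closed[of "{Eq a b, Eq a c}"]) (auto simp: entails_def formulas_def)
  have eq_refl: "Eq a a \<in> \<Gamma>" if "a \<in> wft" for a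
    using that by (intro closed[of "{}"]) (auto simp: entails_def formulas_def wft_def)
  have less_cong: "Less s t \<in> \<Gamma>"
    if "Less a b \<in> \<Gamma>" "Eq a s \<in> \<Gamma>" "Eq b t \<in> \<Gamma>" for a b s t
  proof (rule closed)
    show "entails M {Less a b, Eq a s, Eq b t} (Less s t)"
      unfolding entails_def by (metis insertI1 insertI2 sat.simps(2,3))
  qed (use that sub in \<open>auto simp: formulas_def\<close>)
  \<comment> \<open>\<open>M\<close> satisfies that some element equals \<open>s\<close>, and the
    Henkin property names it. Hence the classes of variables already exhaust the values of all
    terms.\<close>
  have name: "\<exists>k. Eq s (Var k) \<in> \<Gamma>" if "s \<in> wft" for s
  proof -
    let ?p = "Neg (Eq (lift_tm s) (Var 0))"
    have "Neg (Uni ?p) \<in> \<Gamma>"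
    proof (rule closed[of "{}"])
      show "Neg (Uni ?p) \<in> formulas L"
        using that by (auto simp: formulas_def wft_def intro!: wf_subst_tm)
      show "entails M {} (Neg (Uni ?p))"
        using that val_tm_in_carr[OF assms(2)]
        by (auto simp: entails_def val_subst_tm wft_def)
    qed auto
    then obtain k where k: "Neg (inst k ?p) \<in> \<Gamma>" using witness by blast
    have "Eq s (Var k) \<in> \<Gamma>"
    proof (rule closed[of "{Neg (inst k ?p)}"])
      show "entails M {Neg (inst k ?p)} (Eq s (Var k))"
        by (auto simp: entails_def val_subst_tm)
    qed (use k that in \<open>auto simp: formulas_def wft_def\<close>)
    then show ?thesis ..
  qed
  define tv where "tv s = q (SOME k. Eq s (Var k) \<in> \<Gamma>)" for s
  have tv: "Eq s (Var k) \<in> \<Gamma> \<longleftrightarrow> tv s = q k" if s: "s \<in> wft" for s k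
  proof -
    obtain l where l: "tv s = q l" "Eq s (Var l) \<in> \<Gamma>"
      using someI_ex[OF name[OF s]] by (auto simp: tv_def)
    have "Eq s (Var k) \<in> \<Gamma> \<longleftrightarrow> Eq (Var l) (Var k) \<in> \<Gamma>"
      using l(2) eq_trans eq_refl[OF s] by blast
    then show ?thesis using q l(1) by metis
  qed
  have tv_eq: "tv s = tv t \<longleftrightarrow> Eq s t \<in> \<Gamma>" if st: "s \<in> wft" "t \<in> wft" for s t
  proof -
    obtain k where k: "tv t = q k" "Eq t (Var k) \<in> \<Gamma>"
      using name[OF st(2)] tv[OF st(2)] by blast
    have "Eq s (Var k) \<in> \<Gamma> \<longleftrightarrow> Eq s t \<in> \<Gamma>"
      using k(2) eq_trans eq_refl[OF st(1)] eq_refl[OF st(2)] by blast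
    then show ?thesis using tv[OF st(1)] k(1) by metis
  qed
  have tv_range: "tv s \<in> range q" for s
    by (simp add: tv_def)
  \<comment> \<open>Operations on the carrier are computed on a chosen variable \<open>r x\<close>
    for each element; \<open>reps\<close> below makes this choice harmless.\<close>
  define r where "r x = (SOME i. q i = x)" for x
  have r: "q (r x) = x" if "x \<in> range q" for x
    unfolding r_def using that by (metis (mono_tags, lifting) imageE someI)
  have tv_r: "tv (Var (r x)) = x" if "x \<in> range q" for x
  proof -
    have "Eq (Var (r x)) (Var (r x)) \<in> \<Gamma>"
      using q[of "r x" "r x"] by simp
    then show ?thesis using tv[of "Var (r x)" "r x"] r[OF that] by (simp add: wft_def)
  qed
  define N :: "('f, 'r, 'n) struct" where "N = \<lparr>carr = range q, izero = tv Zero, ione = tv One,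
    iadd = \<lambda>x y. tv (Add (Var (r x)) (Var (r y))), imul = \<lambda>x y. tv (Mul (Var (r x)) (Var (r y))),
    iless = \<lambda>x y. Less (Var (r x)) (Var (r y)) \<in> \<Gamma>,
    ifun = \<lambda>f xs. tv (Fn f (map (\<lambda>x. Var (r x)) xs)),
    irel = \<lambda>R xs. Rel R (map (\<lambda>x. Var (r x)) xs) \<in> \<Gamma>\<rparr>"
  have reps: "Eq (Var (r (tv s))) s \<in> \<Gamma>" if "s \<in> wft" for s
    using tv_eq[of "Var (r (tv s))" s] tv_r[OF tv_range] that by (simp add: wft_def)
  have repss: "(\<lambda>s. Eq (Var (r (tv s))) s) ` set ss \<subseteq> \<Gamma>" if "set ss \<subseteq> wft" for ss
    using reps that by auto
  have val: "val_tm N (\<lambda>i. q (\<rho> i)) t = tv (subst_tm (\<lambda>i. Var (\<rho> i)) t)" if "t \<in> wft" for t \<rho>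
    using that
  proof (induction t)
    case (Var i)
    have "Eq (Var (\<rho> i)) (Var (\<rho> i)) \<in> \<Gamma>" using q by blast
    then show ?case using tv[of "Var (\<rho> i)" "\<rho> i"] by (simp add: wft_def)
  next
    case (Add s t)
    let ?s = "subst_tm (\<lambda>i. Var (\<rho> i)) s" and ?t = "subst_tm (\<lambda>i. Var (\<rho> i)) t"
    have wf: "?s \<in> wft" "?t \<in> wft" using Add.prems by (auto simp: wft_def wf_subst_tm)
    then have "Eq (Add (Var (r (tv ?s))) (Var (r (tv ?t)))) (Add ?s ?t) \<in> \<Gamma>"
      using repss[of "[?s, ?t]"] by (intro closed[OF _ repss[of "[?s, ?t]"]])
        (auto simp: entails_def formulas_def wft_def)
    then show ?case using Add wf by (auto simp: N_def tv_eq wft_def)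
  next
    case (Mul s t)
    let ?s = "subst_tm (\<lambda>i. Var (\<rho> i)) s" and ?t = "subst_tm (\<lambda>i. Var (\<rho> i)) t"
    have wf: "?s \<in> wft" "?t \<in> wft" using Mul.prems by (auto simp: wft_def wf_subst_tm)
    then have "Eq (Mul (Var (r (tv ?s))) (Var (r (tv ?t)))) (Mul ?s ?t) \<in> \<Gamma>"
      using repss[of "[?s, ?t]"] by (intro closed[OF _ repss[of "[?s, ?t]"]])
        (auto simp: entails_def formulas_def wft_def)
    then show ?case using Mul wf by (auto simp: N_def tv_eq wft_def)
  next
    case (Fn f ts)
    let ?ts = "map (subst_tm (\<lambda>i. Var (\<rho> i))) ts"
    have ts: "set ts \<subseteq> wft" using Fn.prems by (auto simp: wft_def list_all_iff)
    have wf: "set ?ts \<subseteq> wft" using ts by (auto simp: wft_def wf_subst_tm)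
    have wfFn: "Fn f ?ts \<in> wft" "Fn f (map (\<lambda>s. Var (r (tv s))) ?ts) \<in> wft"
      using Fn.prems wf by (auto simp: wft_def list_all_iff)
    have "Eq (Fn f (map (\<lambda>s. Var (r (tv s))) ?ts)) (Fn f ?ts) \<in> \<Gamma>"
    proof (rule closed[OF _ repss[OF wf]])
      show "entails M ((\<lambda>s. Eq (Var (r (tv s))) s) ` set ?ts)
        (Eq (Fn f (map (\<lambda>s. Var (r (tv s))) ?ts)) (Fn f ?ts))"
        by (auto simp: entails_def intro!: arg_cong[where f = "ifun M f"])
    qed (use wfFn in \<open>auto simp: formulas_def wft_def\<close>)
    then have "tv (Fn f (map (\<lambda>s. Var (r (tv s))) ?ts)) = tv (Fn f ?ts)"
      using tv_eq wfFn by blast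
    moreover have "map (val_tm N (\<lambda>i. q (\<rho> i))) ts = map tv ?ts"
      using Fn.IH ts by auto
    moreover have "ifun N f (map tv ?ts) = tv (Fn f (map (\<lambda>s. Var (r (tv s))) ?ts))"
      by (simp add: N_def comp_def)
    ultimately show ?case by (simp only: val_tm.simps subst_tm.simps)
  qed (auto simp: N_def)
  have struct: "is_struct L N"
    by (auto simp: is_struct_def N_def tv_range)
  have sat: "sat N (\<lambda>i. q (\<rho> i)) p \<longleftrightarrow> subst_fm (\<lambda>i. Var (\<rho> i)) p \<in> \<Gamma>" if "p \<in> formulas L" for p \<rho>
    using that
  proof (induction p arbitrary: \<rho>)
    case Fls
    then show ?case using \<open>Fls \<notin> \<Gamma>\<close> by simp
  next
    case (Eq s t)
    then have "s \<in> wft" "t \<in> wft" by (auto simp: formulas_def wft_def)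
    then show ?case by (simp add: val tv_eq wft_def wf_subst_tm)
  next
    case (Less s t)
    let ?s = "subst_tm (\<lambda>i. Var (\<rho> i)) s" and ?t = "subst_tm (\<lambda>i. Var (\<rho> i)) t"
    have st: "s \<in> wft" "t \<in> wft" using Less by (auto simp: formulas_def wft_def)
    then have wf: "?s \<in> wft" "?t \<in> wft" by (auto simp: wft_def wf_subst_tm)
    have "Less (Var (r (tv ?s))) (Var (r (tv ?t))) \<in> \<Gamma> \<longleftrightarrow> Less ?s ?t \<in> \<Gamma>"
    proof
      assume "Less (Var (r (tv ?s))) (Var (r (tv ?t))) \<in> \<Gamma>"
      from less_cong[OF this reps[OF wf(1)] reps[OF wf(2)]] show "Less ?s ?t \<in> \<Gamma>" .
    next
      assume "Less ?s ?t \<in> \<Gamma>"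
      moreover have "Eq ?s (Var (r (tv ?s))) \<in> \<Gamma>" "Eq ?t (Var (r (tv ?t))) \<in> \<Gamma>"
        using eq_trans[OF reps[OF wf(1)] eq_refl] eq_trans[OF reps[OF wf(2)] eq_refl]
        by (simp_all add: wft_def)
      ultimately show "Less (Var (r (tv ?s))) (Var (r (tv ?t))) \<in> \<Gamma>"
        by (rule less_cong)
    qed
    then show ?case using st by (simp add: val) (simp add: N_def)
  next
    case (Rel R ts)
    let ?ts = "map (subst_tm (\<lambda>i. Var (\<rho> i))) ts"
    have ts: "set ts \<subseteq> wft" using Rel.prems by (auto simp: wft_def list_all_iff formulas_def)
    have wf: "set ?ts \<subseteq> wft" using ts by (auto simp: wft_def wf_subst_tm)
    have wfR: "Rel R ?ts \<in> formulas L" "Rel R (map (\<lambda>s. Var (r (tv s))) ?ts) \<in> formulas L"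
      using Rel.prems wf by (auto simp: wft_def list_all_iff formulas_def)
    let ?E = "(\<lambda>s. Eq (Var (r (tv s))) s) ` set ?ts"
    have E: "map (val_tm M e) (map (\<lambda>s. Var (r (tv s))) ?ts) = map (val_tm M e) ?ts"
      if "\<forall>q\<in>?E. sat M e q" for e
      using that by auto
    have "Rel R (map (\<lambda>s. Var (r (tv s))) ?ts) \<in> \<Gamma> \<longleftrightarrow> Rel R ?ts \<in> \<Gamma>"
    proof
      assume *: "Rel R (map (\<lambda>s. Var (r (tv s))) ?ts) \<in> \<Gamma>"
      show "Rel R ?ts \<in> \<Gamma>"
      proof (rule closed[of "insert (Rel R (map (\<lambda>s. Var (r (tv s))) ?ts)) ?E"])
        show "entails M (insert (Rel R (map (\<lambda>s. Var (r (tv s))) ?ts)) ?E) (Rel R ?ts)"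
          unfolding entails_def
        proof (intro ballI impI)
          fix e assume "\<forall>p\<in>insert (Rel R (map (\<lambda>s. Var (r (tv s))) ?ts)) ?E. sat M e p"
          then have "\<forall>p\<in>?E. sat M e p" "sat M e (Rel R (map (\<lambda>s. Var (r (tv s))) ?ts))"
            by blast+
          from E[OF this(1)] this(2) show "sat M e (Rel R ?ts)"
            by (simp only: sat.simps)
        qed
      qed (use * wfR repss[OF wf] in auto)
    next
      assume *: "Rel R ?ts \<in> \<Gamma>"
      show "Rel R (map (\<lambda>s. Var (r (tv s))) ?ts) \<in> \<Gamma>"
      proof (rule closed[of "insert (Rel R ?ts) ?E"])
        show "entails M (insert (Rel R ?ts) ?E) (Rel R (map (\<lambda>s. Var (r (tv s))) ?ts))"
          unfolding entails_def
        proof (intro ballI impI)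
          fix e assume "\<forall>p\<in>insert (Rel R ?ts) ?E. sat M e p"
          then have "\<forall>p\<in>?E. sat M e p" "sat M e (Rel R ?ts)"
            by blast+
          from E[OF this(1)] this(2) show "sat M e (Rel R (map (\<lambda>s. Var (r (tv s))) ?ts))"
            by (simp only: sat.simps)
        qed
      qed (use * wfR repss[OF wf] in auto)
    qed
    moreover have "map (val_tm N (\<lambda>i. q (\<rho> i))) ts = map tv ?ts"
      using val ts by auto
    moreover have "irel N R (map tv ?ts) \<longleftrightarrow> Rel R (map (\<lambda>s. Var (r (tv s))) ?ts) \<in> \<Gamma>"
      by (simp add: N_def comp_def)
    ultimately show ?case by (simp only: sat.simps subst_fm.simps)
  next
    case (Imp p p')
    then have wf: "p \<in> formulas L" "p' \<in> formulas L" by (auto simp: formulas_def)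
    let ?p = "subst_fm (\<lambda>i. Var (\<rho> i)) p" and ?p' = "subst_fm (\<lambda>i. Var (\<rho> i)) p'"
    have wf': "?p \<in> formulas L" "?p' \<in> formulas L" using wf_sub wf by auto
    then have wfI: "Imp ?p ?p' \<in> formulas L" by (simp add: formulas_def)
    have "Imp ?p ?p' \<in> \<Gamma> \<longleftrightarrow> (?p \<in> \<Gamma> \<longrightarrow> ?p' \<in> \<Gamma>)"
    proof (intro iffI impI)
      assume "Imp ?p ?p' \<in> \<Gamma>" "?p \<in> \<Gamma>"
      then show "?p' \<in> \<Gamma>"
        using wf' by (intro closed[of "{?p, Imp ?p ?p'}"]) (simp_all add: entails_def)
    next
      assume "?p \<in> \<Gamma> \<longrightarrow> ?p' \<in> \<Gamma>"
      then consider "Neg ?p \<in> \<Gamma>" | "?p' \<in> \<Gamma>"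
        using Neg[OF wf'(1)] by blast
      then show "Imp ?p ?p' \<in> \<Gamma>"
      proof cases
        case 1
        then show ?thesis
          using wfI by (intro closed[of "{Neg ?p}"]) (simp_all add: entails_def)
      next
        case 2
        then show ?thesis
          using wfI by (intro closed[of "{?p'}"]) (simp_all add: entails_def)
      qed
    qed
    then show ?case using Imp.IH wf by simp
  next
    case (Uni p)
    then have wf: "p \<in> formulas L" by (auto simp: formulas_def)
    have wfU: "Uni (subst_fm (up (\<lambda>i. Var (\<rho> i))) p) \<in> formulas L"
      using wf_sub[OF Uni.prems] by simp
    have "sat N (case_nat (q i) (\<lambda>i. q (\<rho> i))) p \<longleftrightarrow>
      inst i (subst_fm (up (\<lambda>i. Var (\<rho> i))) p) \<in> \<Gamma>" for i
    proof -
      have "case_nat (q i) (\<lambda>i. q (\<rho> i)) = (\<lambda>j. q (case_nat i \<rho> j))"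
        by (rule ext) (simp split: nat.split)
      then have "sat N (case_nat (q i) (\<lambda>i. q (\<rho> i))) p \<longleftrightarrow>
        subst_fm (\<lambda>j. Var (case_nat i \<rho> j)) p \<in> \<Gamma>"
        using Uni.IH[OF wf] by simp
      also have "\<dots> \<longleftrightarrow> inst i (subst_fm (up (\<lambda>i. Var (\<rho> i))) p) \<in> \<Gamma>"
      proof (rule equiv)
        fix e
        have "(\<lambda>j. e (case_nat i \<rho> j)) = (\<lambda>j. val_tm M (\<lambda>j. val_tm M e (case_nat (Var i) Var j))
          (up (\<lambda>i. Var (\<rho> i)) j))"
          by (rule ext) (simp add: up_def split: nat.split)
        then show "sat M e (subst_fm (\<lambda>j. Var (case_nat i \<rho> j)) p) =
          sat M e (inst i (subst_fm (up (\<lambda>i. Var (\<rho> i))) p))"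
          by (simp add: sat_subst_fm)
      qed (use wf_sub[OF wf] wfU in \<open>auto simp: formulas_def intro!: wf_subst_fm split: nat.split\<close>)
      finally show ?thesis .
    qed
    then show ?case
      using Uni_in[OF wfU] by (simp add: N_def)
  qed
  show ?thesis
    using struct sat by (intro exI[of _ N]) (auto simp: N_def)
qed

section \<open>Models of arithmetic\<close>

lemma
  fixes M :: "('f, 'r, 'm) struct"
  assumes PA: "\<And>p e. p \<in> PA_minus \<Longrightarrow> e \<in> assignments M \<Longrightarrow> sat M e p"
    and x: "x \<in> carr M" and y: "y \<in> carr M" and z: "z \<in> carr M"
  shows PA_add_assoc: "iadd M (iadd M x y) z = iadd M x (iadd M y z)"
    and PA_add_commute: "iadd M x y = iadd M y x"
    and PA_mult_assoc: "imul M (imul M x y) z = imul M x (imul M y z)"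
    and PA_mult_commute: "imul M x y = imul M y x"
    and PA_distrib: "imul M x (iadd M y z) = iadd M (imul M x y) (imul M x z)"
    and PA_add_0: "iadd M x (izero M) = x"
    and PA_mult_0: "imul M x (izero M) = izero M"
    and PA_mult_1: "imul M x (ione M) = x"
    and PA_less_trans: "iless M x y \<Longrightarrow> iless M y z \<Longrightarrow> iless M x z"
    and PA_less_irrefl: "\<not> iless M x x"
    and PA_less_linear: "iless M x y \<or> x = y \<or> iless M y x"
    and PA_add_mono: "iless M x y \<Longrightarrow> iless M (iadd M x z) (iadd M y z)"
    and PA_mult_mono: "iless M (izero M) z \<Longrightarrow> iless M x y \<Longrightarrow> iless M (imul M x z) (imul M y z)"
    and PA_less_diff: "iless M x y \<Longrightarrow> \<exists>w\<in>carr M. iadd M x w = y"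
    and PA_zero_less_one: "iless M (izero M) (ione M)"
    and PA_discrete: "iless M (izero M) x \<Longrightarrow> iless M (ione M) x \<or> ione M = x"
    and PA_nonneg: "iless M (izero M) x \<or> izero M = x"
proof -
  define f where "f = case_nat x (case_nat y (\<lambda>_. z))"
  have f: "f \<in> assignments M"
    using x y z by (auto simp: f_def assignments_def split: nat.split)
  have f_simps: "f 0 = x" "f 1 = y" "f (Suc 0) = y" "f 2 = z"
    by (simp_all add: f_def)
  have ax: "sat M f p" if "univ_close p \<in> PA_minus" for p
    using PA[OF that f] f by (simp add: sat_univ_close)
  show "iadd M (iadd M x y) z = iadd M x (iadd M y z)"
    using ax[of "Eq (Add (Add (Var 0) (Var 1)) (Var 2)) (Add (Var 0) (Add (Var 1) (Var 2)))"] by (auto simp: PA_minus_def Let_def f_simps)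
  show "iadd M x y = iadd M y x"
    using ax[of "Eq (Add (Var 0) (Var 1)) (Add (Var 1) (Var 0))"] by (auto simp: PA_minus_def Let_def f_simps)
  show "imul M (imul M x y) z = imul M x (imul M y z)"
    using ax[of "Eq (Mul (Mul (Var 0) (Var 1)) (Var 2)) (Mul (Var 0) (Mul (Var 1) (Var 2)))"] by (auto simp: PA_minus_def Let_def f_simps)
  show "imul M x y = imul M y x"
    using ax[of "Eq (Mul (Var 0) (Var 1)) (Mul (Var 1) (Var 0))"] by (auto simp: PA_minus_def Let_def f_simps)
  show "imul M x (iadd M y z) = iadd M (imul M x y) (imul M x z)"
    using ax[of "Eq (Mul (Var 0) (Add (Var 1) (Var 2))) (Add (Mul (Var 0) (Var 1)) (Mul (Var 0) (Var 2)))"] by (auto simp: PA_minus_def Let_def f_simps)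
  show "iadd M x (izero M) = x"
    using ax[of "Eq (Add (Var 0) Zero) (Var 0)"] by (auto simp: PA_minus_def Let_def f_simps)
  show "imul M x (izero M) = izero M"
    using ax[of "Eq (Mul (Var 0) Zero) Zero"] by (auto simp: PA_minus_def Let_def f_simps)
  show "imul M x (ione M) = x"
    using ax[of "Eq (Mul (Var 0) One) (Var 0)"] by (auto simp: PA_minus_def Let_def f_simps)
  show "iless M x z" if "iless M x y" "iless M y z"
    using ax[of "Imp (And (Less (Var 0) (Var 1)) (Less (Var 1) (Var 2))) (Less (Var 0) (Var 2))"] that by (auto simp: PA_minus_def Let_def f_simps)
  show "\<not> iless M x x"
    using ax[of "Neg (Less (Var 0) (Var 0))"] by (auto simp: PA_minus_def Let_def f_simps)
  show "iless M x y \<or> x = y \<or> iless M y x"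
    using ax[of "Or (Less (Var 0) (Var 1)) (Or (Eq (Var 0) (Var 1)) (Less (Var 1) (Var 0)))"] by (auto simp: PA_minus_def Let_def f_simps)
  show "iless M (iadd M x z) (iadd M y z)" if "iless M x y"
    using ax[of "Imp (Less (Var 0) (Var 1)) (Less (Add (Var 0) (Var 2)) (Add (Var 1) (Var 2)))"] that by (auto simp: PA_minus_def Let_def f_simps)
  show "iless M (imul M x z) (imul M y z)" if "iless M (izero M) z" "iless M x y"
    using ax[of "Imp (And (Less Zero (Var 2)) (Less (Var 0) (Var 1))) (Less (Mul (Var 0) (Var 2)) (Mul (Var 1) (Var 2)))"] that by (auto simp: PA_minus_def Let_def f_simps)
  show "\<exists>w\<in>carr M. iadd M x w = y" if "iless M x y"
    using ax[of "Imp (Less (Var 0) (Var 1)) (Exi (Eq (Add (lift_tm (Var 0)) (Var 0)) (lift_tm (Var 1))))"] that by (auto simp: PA_minus_def Let_def f_simps)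
  show "iless M (izero M) (ione M)"
    using ax[of "Less Zero One"] by (auto simp: PA_minus_def Let_def f_simps)
  show "iless M (ione M) x \<or> ione M = x" if "iless M (izero M) x"
    using ax[of "Imp (Less Zero (Var 0)) (Or (Less One (Var 0)) (Eq One (Var 0)))"] that by (auto simp: PA_minus_def Let_def f_simps)
  show "iless M (izero M) x \<or> izero M = x"
    using ax[of "Or (Less Zero (Var 0)) (Eq Zero (Var 0))"] by (auto simp: PA_minus_def Let_def f_simps)
qed

lemma formulas_L_PA [simp]:
  "Fls \<in> formulas L_PA"
  "Eq s t \<in> formulas L_PA \<longleftrightarrow> wf_tm {} s \<and> wf_tm {} t"
  "Less s t \<in> formulas L_PA \<longleftrightarrow> wf_tm {} s \<and> wf_tm {} t"
  "Rel r ts \<notin> formulas L_PA"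
  "Imp p q \<in> formulas L_PA \<longleftrightarrow> p \<in> formulas L_PA \<and> q \<in> formulas L_PA"
  "Uni p \<in> formulas L_PA \<longleftrightarrow> p \<in> formulas L_PA"
  by (auto simp: formulas_def L_PA_def)

text \<open>A type-based algebraic locale can only be interpreted if the carrier is a whole type.
  Here \<open>nat\<close> is just an infinite countable set; its own arithmetic is unrelated to the
  operations of \<open>S\<close>.\<close>

locale pa =
  fixes S :: "('f, 'r, nat) struct"
  assumes carr: "carr S = UNIV" and PA: "p \<in> PA \<Longrightarrow> sat S e p"
begin

lemma assignments: "e \<in> assignments S"
  by (simp add: assignments_def carr)

abbreviation zero' ("\<zero>") where "\<zero> \<equiv> izero S"
abbreviation one' ("\<one>") where "\<one> \<equiv> ione S"
abbreviation add' (infixl "\<oplus>" 65) where "x \<oplus> y \<equiv> iadd S x y"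
abbreviation mul' (infixl "\<otimes>" 70) where "x \<otimes> y \<equiv> imul S x y"
abbreviation less' (infix "\<sqsubset>" 50) where "x \<sqsubset> y \<equiv> iless S x y"
definition leq_S (infix "\<sqsubseteq>" 50) where "x \<sqsubseteq> y \<longleftrightarrow> x \<sqsubset> y \<or> x = y"
text \<open>Truncated subtraction is demanded by \<open>linordered_semidom\<close>; in
  \<open>divides_cancel\<close> it is what removes a common multiple.\<close>

definition minus_S where "minus_S x y = (if y \<sqsubseteq> x then THE z. z \<oplus> y = x else \<zero>)"

lemma PA_minus: "p \<in> PA_minus \<Longrightarrow> e \<in> assignments S \<Longrightarrow> sat S e p"
  by (simp add: Defs.PA_def PA)

lemmas ax = PA_add_assoc[OF PA_minus] PA_add_commute[OF PA_minus] PA_mult_assoc[OF PA_minus]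
  PA_mult_commute[OF PA_minus] PA_distrib[OF PA_minus] PA_add_0[OF PA_minus] PA_mult_0[OF PA_minus]
  PA_mult_1[OF PA_minus] PA_less_trans[OF PA_minus] PA_less_irrefl[OF PA_minus]
  PA_less_linear[OF PA_minus] PA_add_mono[OF PA_minus] PA_mult_mono[OF PA_minus]
  PA_less_diff[OF PA_minus] PA_zero_less_one[OF PA_minus] PA_discrete[OF PA_minus]
  PA_nonneg[OF PA_minus]

lemmas pa_ax = ax[unfolded carr, simplified]

lemma minus_eq: "y \<oplus> z = x \<Longrightarrow> minus_S x y = z"
proof -
  assume *: "y \<oplus> z = x"
  have uniq: "u = z" if "u \<oplus> y = x" for u
    using pa_ax(2)[of u y] pa_ax(2)[of z y] pa_ax(11)[of u z] pa_ax(12)[of u z y]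
      pa_ax(12)[of z u y] pa_ax(10) that * by metis
  have "y \<sqsubseteq> x"
    using pa_ax(12)[of \<zero> z y] pa_ax(17)[of z] pa_ax(2,6) * by (metis leq_S_def)
  then show ?thesis
    unfolding minus_S_def using uniq * pa_ax(2) by (auto intro!: the_equality)
qed

lemma leq_iff: "x \<sqsubseteq> y \<longleftrightarrow> (\<exists>z. x \<oplus> z = y)"
proof
  assume "x \<sqsubseteq> y"
  then show "\<exists>z. x \<oplus> z = y" using pa_ax(14)[of x y] pa_ax(6)[of x] by (auto simp: leq_S_def)
next
  assume "\<exists>z. x \<oplus> z = y"
  then obtain z where "x \<oplus> z = y" ..
  then show "x \<sqsubseteq> y"
    using pa_ax(12)[of \<zero> z x] pa_ax(17)[of z] pa_ax(2,6) by (metis leq_S_def)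
qed

lemma not_leq_minus: "\<not> y \<sqsubseteq> x \<Longrightarrow> minus_S x y = \<zero>"
  by (simp add: minus_S_def)

sublocale R: linordered_semidom
  where plus = "iadd S" and times = "imul S" and zero = "izero S" and one = "ione S"
    and minus = minus_S and less_eq = leq_S and less = "iless S"
proof
  note [simp] = pa_ax(6,7,8,10)
  show "a \<oplus> b \<oplus> c = a \<oplus> (b \<oplus> c)" "a \<oplus> b = b \<oplus> a" "a \<otimes> b \<otimes> c = a \<otimes> (b \<otimes> c)"
    "a \<otimes> b = b \<otimes> a" "a \<otimes> (b \<oplus> c) = a \<otimes> b \<oplus> a \<otimes> c" for a b c
    by (fact pa_ax)+
  show zero_add: "\<zero> \<oplus> a = a" for a by (metis pa_ax(2,6))
  show "\<one> \<otimes> a = a" for a by (metis pa_ax(4,8))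
  show "\<zero> \<otimes> a = \<zero>" "a \<otimes> \<zero> = \<zero>" for a by (metis pa_ax(4,7))+
  show "(a \<oplus> b) \<otimes> c = a \<otimes> c \<oplus> b \<otimes> c" for a b c by (metis pa_ax(4,5))
  show "minus_S (a \<oplus> b) a = b" for a b by (rule minus_eq) simp
  show "\<zero> \<noteq> \<one>" using pa_ax(15) by (metis pa_ax(10))
  have sum_leq: "b \<sqsubseteq> a \<and> c \<sqsubseteq> minus_S a b" if "b \<oplus> c \<sqsubseteq> a" for a b c
    using that minus_eq by (metis leq_iff pa_ax(1))
  have sum_leq': "b \<oplus> c \<sqsubseteq> a" if "b \<sqsubseteq> a" "c \<sqsubseteq> minus_S a b" for a b c
    using that minus_eq by (metis leq_iff pa_ax(1))
  have minus_zero: "minus_S \<zero> a = \<zero>" for a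
  proof (cases "a \<sqsubseteq> \<zero>")
    case True
    then have "a = \<zero>" using pa_ax(17)[of a] pa_ax(9)[of a \<zero> a] by (auto simp: leq_S_def)
    then show ?thesis using minus_eq[of \<zero> \<zero> \<zero>] by simp
  qed (simp add: not_leq_minus)
  show "minus_S (minus_S a b) c = minus_S a (b \<oplus> c)" for a b c
  proof (cases "b \<oplus> c \<sqsubseteq> a")
    case True
    then obtain d where "b \<oplus> c \<oplus> d = a" using leq_iff by blast
    then have "minus_S a (b \<oplus> c) = d" "minus_S a b = c \<oplus> d"
      by (simp_all only: minus_eq pa_ax(1))
    then show ?thesis using minus_eq[of c d] by simp
  next
    case False
    show ?thesis
    proof (cases "b \<sqsubseteq> a")
      case True
      have "\<not> c \<sqsubseteq> minus_S a b" using sum_leq'[OF True] False by blast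
      then show ?thesis using False by (simp add: not_leq_minus)
    qed (use False in \<open>simp add: not_leq_minus minus_zero\<close>)
  qed
  show "(a \<sqsubset> b) = (a \<sqsubseteq> b \<and> \<not> b \<sqsubseteq> a)" for a b by (metis leq_S_def pa_ax(9,10))
  show "a \<sqsubseteq> a" for a by (simp add: leq_S_def)
  show "a \<sqsubseteq> b \<Longrightarrow> b \<sqsubseteq> c \<Longrightarrow> a \<sqsubseteq> c" for a b c by (metis leq_S_def pa_ax(9))
  show "a \<sqsubseteq> b \<Longrightarrow> b \<sqsubseteq> a \<Longrightarrow> a = b" for a b by (metis leq_S_def pa_ax(9,10))
  show "a \<sqsubseteq> b \<or> b \<sqsubseteq> a" for a b by (metis leq_S_def pa_ax(11))
  show "a \<sqsubseteq> b \<Longrightarrow> c \<oplus> a \<sqsubseteq> c \<oplus> b" for a b c by (metis leq_S_def pa_ax(2,12))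
  show mono: "a \<sqsubset> b \<Longrightarrow> \<zero> \<sqsubset> c \<Longrightarrow> c \<otimes> a \<sqsubset> c \<otimes> b" for a b c by (metis pa_ax(4,13))
  show "\<zero> \<sqsubset> \<one>" by (fact pa_ax(15))
  show "b \<sqsubseteq> a \<Longrightarrow> minus_S a b \<oplus> b = a" for a b by (metis leq_iff minus_eq pa_ax(2))
  show "a \<otimes> b \<noteq> \<zero>" if "a \<noteq> \<zero>" "b \<noteq> \<zero>" for a b
    using mono[of \<zero> b a] pa_ax(17)[of a] pa_ax(17)[of b] that by auto
  show "a \<otimes> minus_S b c = minus_S (a \<otimes> b) (a \<otimes> c)" for a b c
  proof (cases "c \<sqsubseteq> b")
    case True
    then obtain d where d: "c \<oplus> d = b" using leq_iff by blast
    then have "a \<otimes> c \<oplus> a \<otimes> d = a \<otimes> b" using pa_ax(5)[of a c d] by simp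
    then show ?thesis using minus_eq[OF d] by (simp only: minus_eq)
  next
    case False
    then have "b \<sqsubset> c" using pa_ax(11)[of b c] by (auto simp: leq_S_def)
    then have "a = \<zero> \<or> a \<otimes> b \<sqsubset> a \<otimes> c" using mono pa_ax(17)[of a] by auto
    moreover have "\<zero> \<otimes> a = \<zero>" for a by (metis pa_ax(4,7))
    ultimately consider "a = \<zero>" | "\<not> a \<otimes> c \<sqsubseteq> a \<otimes> b"
      using pa_ax(9)[of "a \<otimes> b" "a \<otimes> c" "a \<otimes> b"] pa_ax(10)[of "a \<otimes> b"]
      by (metis leq_S_def)
    then show ?thesis
      by cases (use False \<open>\<And>a. \<zero> \<otimes> a = \<zero>\<close> in \<open>simp_all add: not_leq_minus minus_zero\<close>)
  qed
qed

lemma zero_le [simp]: "\<zero> \<sqsubseteq> x"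
  using pa_ax(17)[of x] by (auto simp: leq_S_def)

lemma less_iff_Suc_le: "x \<sqsubset> y \<longleftrightarrow> x \<oplus> \<one> \<sqsubseteq> y"
proof
  assume "x \<sqsubset> y"
  then obtain z where z: "x \<oplus> z = y" using pa_ax(14) by blast
  then have "z \<noteq> \<zero>" using \<open>x \<sqsubset> y\<close> by auto
  then have "\<one> \<sqsubseteq> z" using pa_ax(16,17)[of z] by (auto simp: leq_S_def)
  then show "x \<oplus> \<one> \<sqsubseteq> y" using z R.add_left_mono by blast
next
  assume "x \<oplus> \<one> \<sqsubseteq> y"
  moreover have "x \<sqsubset> x \<oplus> \<one>" using pa_ax(12)[of \<zero> \<one> x] by (simp add: R.add_commute)
  ultimately show "x \<sqsubset> y" by (rule R.less_le_trans[rotated])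
qed

lemma less_Suc_iff: "x \<sqsubset> y \<oplus> \<one> \<longleftrightarrow> x \<sqsubseteq> y"
  by (metis less_iff_Suc_le R.not_less)

section \<open>Definable relations\<close>

text \<open>Even indices of an environment hold the arguments of a relation; every element \<open>c\<close> of the
  universe is available as a parameter, at the odd index \<open>2 * c + 1\<close>.\<close>

definition with_params :: "(nat \<Rightarrow> nat) \<Rightarrow> nat \<Rightarrow> nat" where
  "with_params e j = (if even j then e (j div 2) else j div 2)"

text \<open>A certificate that a HOL predicate on environments is arithmetical. Induction and
  comprehension can then be applied to ordinary HOL expressions, and \<open>definable_intros\<close>
  assembles the formula from their shape.\<close>

definition definable :: "((nat \<Rightarrow> nat) \<Rightarrow> bool) \<Rightarrow> bool" where
  "definable P \<longleftrightarrow>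
     (\<exists>p::('f, 'r) fm. p \<in> formulas L_PA \<and> (\<forall>e. P e \<longleftrightarrow> sat S (with_params e) p))"

definition term_fun :: "((nat \<Rightarrow> nat) \<Rightarrow> nat) \<Rightarrow> bool" where
  "term_fun F \<longleftrightarrow>
     (\<exists>t::'f tm. wf_tm {} t \<and> (\<forall>e. F e = val_tm S (with_params e) t))"

lemma term_fun_var: "term_fun (\<lambda>e. e i)"
  unfolding term_fun_def by (rule exI[of _ "Var (2 * i)"]) (simp add: with_params_def)

lemma term_fun_const: "term_fun (\<lambda>e. c)"
  unfolding term_fun_def by (rule exI[of _ "Var (2 * c + 1)"]) (simp add: with_params_def)

lemma term_fun_add: "term_fun F \<Longrightarrow> term_fun G \<Longrightarrow> term_fun (\<lambda>e. F e \<oplus> G e)"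
  unfolding term_fun_def by (metis val_tm.simps(4) wf_tm.simps(4))

lemma term_fun_mul: "term_fun F \<Longrightarrow> term_fun G \<Longrightarrow> term_fun (\<lambda>e. F e \<otimes> G e)"
  unfolding term_fun_def by (metis val_tm.simps(5) wf_tm.simps(5))

lemma definable_const: "definable (\<lambda>e. b)"
  unfolding definable_def
  by (rule exI[of _ "if b then Neg Fls else Fls"]) simp

lemma definable_eq: "term_fun F \<Longrightarrow> term_fun G \<Longrightarrow> definable (\<lambda>e. F e = G e)"
  unfolding definable_def term_fun_def by (metis formulas_L_PA(2) sat.simps(2))

lemma definable_less: "term_fun F \<Longrightarrow> term_fun G \<Longrightarrow> definable (\<lambda>e. F e \<sqsubset> G e)"
  unfolding definable_def term_fun_def by (metis formulas_L_PA(3) sat.simps(3))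

lemma definable_imp: "definable P \<Longrightarrow> definable Q \<Longrightarrow> definable (\<lambda>e. P e \<longrightarrow> Q e)"
  unfolding definable_def by (metis formulas_L_PA(5) sat.simps(5))

lemma definable_not: "definable P \<Longrightarrow> definable (\<lambda>e. \<not> P e)"
  using definable_imp[OF _ definable_const[of False]] by simp

lemma definable_conj: "definable P \<Longrightarrow> definable Q \<Longrightarrow> definable (\<lambda>e. P e \<and> Q e)"
  using definable_not[OF definable_imp[OF _ definable_not]] by simp

lemma definable_disj: "definable P \<Longrightarrow> definable Q \<Longrightarrow> definable (\<lambda>e. P e \<or> Q e)"
  using definable_imp[OF definable_not, of P Q] by (simp add: disj_imp)

lemma definable_iff: "definable P \<Longrightarrow> definable Q \<Longrightarrow> definable (\<lambda>e. P e \<longleftrightarrow> Q e)"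
  unfolding iff_conv_conj_imp by (intro definable_conj definable_imp)

lemma definable_leq: "term_fun F \<Longrightarrow> term_fun G \<Longrightarrow> definable (\<lambda>e. F e \<sqsubseteq> G e)"
  unfolding leq_S_def by (intro definable_disj definable_less definable_eq)

lemma definable_subst:
  assumes "definable P" "\<And>i. term_fun (\<lambda>e. \<sigma> e i)"
  shows "definable (\<lambda>e. P (\<sigma> e))"
proof -
  obtain p :: "('f, 'r) fm" where p: "p \<in> formulas L_PA" "\<And>e. P e \<longleftrightarrow> sat S (with_params e) p"
    using assms(1) by (auto simp: definable_def)
  obtain t :: "nat \<Rightarrow> 'f tm"
    where t: "\<And>i. wf_tm {} (t i)" "\<And>i e. \<sigma> e i = val_tm S (with_params e) (t i)"
    using assms(2) unfolding term_fun_def by metis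
  let ?\<tau> = "\<lambda>j. if even j then t (j div 2) else Var j"
  have "with_params (\<sigma> e) = (\<lambda>j. val_tm S (with_params e) (?\<tau> j))" for e
    by (rule ext) (auto simp: with_params_def[of "\<sigma> e"] t, simp add: with_params_def)
  then have "P (\<sigma> e) \<longleftrightarrow> sat S (with_params e) (subst_fm ?\<tau> p)" for e
    by (simp add: p sat_subst_fm)
  moreover have "subst_fm ?\<tau> p \<in> formulas L_PA"
    using p(1) t(1) by (auto simp: formulas_def L_PA_def intro!: wf_subst_fm)
  ultimately show ?thesis unfolding definable_def by blast
qed

lemma definable_all:
  assumes "definable (\<lambda>e. P (e 0) (\<lambda>i. e (Suc i)))"
  shows "definable (\<lambda>e. \<forall>x. P x e)"
proof -
  obtain p :: "('f, 'r) fm" where p: "p \<in> formulas L_PA"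
    "\<And>e. P (e 0) (\<lambda>i. e (Suc i)) \<longleftrightarrow> sat S (with_params e) p"
    using assms by (auto simp: definable_def)
  \<comment> \<open>Passing the quantifier shifts every index by one and so exchanges the parities
    of arguments and parameters. The renaming restores them: argument \<open>i\<close> is found at
    the odd index \<open>2 * i + 1\<close>, a parameter one place later than before.\<close>
  let ?\<tau> = "\<lambda>j. Var (if j = 0 then 0 else if even j then j - 1 else Suc j) :: 'f tm"
  have "with_params (case_nat x e) = (\<lambda>j. val_tm S (case_nat x (with_params e)) (?\<tau> j))" for x e
  proof
    fix j
    consider "j = 0" | i where "j = 2 * Suc i" | i where "j = 2 * i + 1"
      by (metis evenE not0_implies_Suc oddE mult_0_right)
    then show "with_params (case_nat x e) j = val_tm S (case_nat x (with_params e)) (?\<tau> j)"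
      by cases (simp_all add: with_params_def)
  qed
  then have "(\<forall>x. P x e) \<longleftrightarrow> sat S (with_params e) (Uni (subst_fm ?\<tau> p))" for e
    using p(2)[of "case_nat _ e"] by (simp add: sat_subst_fm carr)
  moreover have "Uni (subst_fm ?\<tau> p) \<in> formulas L_PA"
    using p(1) by (auto simp: formulas_def L_PA_def intro!: wf_subst_fm)
  ultimately show ?thesis unfolding definable_def by blast
qed

lemma definable_ex:
  assumes "definable (\<lambda>e. P (e 0) (\<lambda>i. e (Suc i)))"
  shows "definable (\<lambda>e. \<exists>x. P x e)"
  using definable_not[OF definable_all[of "\<lambda>x e. \<not> P x e", OF definable_not[OF assms]]] by simp

lemma definable_app:
  assumes "definable (\<lambda>e. P (e 0))" "term_fun F"
  shows "definable (\<lambda>e. P (F e))"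
  using definable_subst[OF assms(1), of "\<lambda>e _. F e"] assms(2) by simp

lemmas definable_intros = term_fun_var term_fun_const term_fun_add term_fun_mul definable_const
  definable_eq definable_less definable_leq definable_imp definable_not definable_conj
  definable_disj definable_iff definable_all definable_ex

lemma induction:
  assumes "definable (\<lambda>e. P (e 0))" "P \<zero>" "\<And>x. P x \<Longrightarrow> P (x \<oplus> \<one>)"
  shows "P x"
proof -
  obtain p :: "('f, 'r) fm" where p: "p \<in> formulas L_PA" "\<And>e. P (e 0) \<longleftrightarrow> sat S (with_params e) p"
    using assms(1) by (auto simp: definable_def)
  \<comment> \<open>The parameters of the induction formula, with the place of the induction
    variable removed; arguments other than the first are filled with \<open>\<zero>\<close>, as
    \<open>P\<close> looks at the first one only.\<close>
  define g where "g i = with_params (\<lambda>_. \<zero>) (Suc i)" for i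
  have "case_nat x g = with_params ((\<lambda>_. \<zero>)(0 := x))" for x
    by (rule ext) (auto simp: g_def with_params_def split: nat.split)
  then have P: "P x \<longleftrightarrow> sat S (case_nat x g) p" for x
    using p(2)[of "(\<lambda>_. \<zero>)(0 := x)"] by simp
  have "induction_axiom p \<in> PA"
    using p(1) by (simp add: Defs.PA_def)
  then have "sat S g (Imp (And (subst_fm (case_nat Zero Var) p)
    (Uni (Imp p (subst_fm (case_nat (Add (Var 0) One) (\<lambda>i. Var (Suc i))) p)))) (Uni p))"
    using PA assignments unfolding induction_axiom_def by (metis sat_univ_close)
  moreover have "sat S g (subst_fm (case_nat Zero Var) p) \<longleftrightarrow> P \<zero>"
  proof -
    have "(\<lambda>i. val_tm S g (case_nat Zero Var i)) = case_nat \<zero> g"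
      by (rule ext) (simp split: nat.split)
    then show ?thesis by (simp only: sat_subst_fm P)
  qed
  moreover have "sat S (case_nat x g)
    (subst_fm (case_nat (Add (Var 0) One) (\<lambda>i. Var (Suc i))) p) \<longleftrightarrow> P (x \<oplus> \<one>)" for x
  proof -
    have "(\<lambda>i. val_tm S (case_nat x g) (case_nat (Add (Var 0) One) (\<lambda>i. Var (Suc i)) i)) =
      case_nat (x \<oplus> \<one>) g"
      by (rule ext) (simp split: nat.split)
    then show ?thesis by (simp only: sat_subst_fm P)
  qed
  ultimately show ?thesis
    using assms(2,3) by (simp add: carr flip: P)
qed

lemma strong_induction:
  assumes P: "definable (\<lambda>e. P (e 0))" and step: "\<And>x. (\<And>y. y \<sqsubset> x \<Longrightarrow> P y) \<Longrightarrow> P x"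
  shows "P x"
proof -
  have "\<forall>y. y \<sqsubset> x \<longrightarrow> P y" for x
  proof (rule induction[of "\<lambda>x. \<forall>y. y \<sqsubset> x \<longrightarrow> P y"])
    show "definable (\<lambda>e. \<forall>y. y \<sqsubset> e 0 \<longrightarrow> P y)"
      by (intro definable_intros definable_app[OF P])
    show "\<forall>y. y \<sqsubset> \<zero> \<longrightarrow> P y" using zero_le R.not_less by blast
    show "\<forall>y. y \<sqsubset> x \<oplus> \<one> \<longrightarrow> P y" if "\<forall>y. y \<sqsubset> x \<longrightarrow> P y" for x
      using that step by (auto simp: less_Suc_iff leq_S_def)
  qed
  then show ?thesis using step by blast
qed

lemma definable_app2:
  assumes "definable (\<lambda>e. P (e 0) (e (Suc 0)))" "term_fun F" "term_fun G"
  shows "definable (\<lambda>e. P (F e) (G e))"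
proof -
  have "term_fun (\<lambda>e. case_nat (F e) (\<lambda>_. G e) i)" for i
    using assms(2,3) by (cases i) simp_all
  from definable_subst[OF assms(1), of "\<lambda>e. case_nat (F e) (\<lambda>_. G e)", OF this]
  show ?thesis by simp
qed

section \<open>Finite sets coded by divisibility\<close>

definition divides where "divides x y \<longleftrightarrow> (\<exists>q. y = x \<otimes> q)"

lemma divides_mult: "divides x y \<Longrightarrow> divides x (y \<otimes> z)" "divides x y \<Longrightarrow> divides x (z \<otimes> y)"
  unfolding divides_def by (metis R.mult.assoc R.mult.commute)+

lemma divides_cancel: "divides x (x \<otimes> z \<oplus> w) \<Longrightarrow> divides x w"
  unfolding divides_def by (metis R.add_diff_cancel_left' R.right_diff_distrib')

lemma definable_divides: "term_fun F \<Longrightarrow> term_fun G \<Longrightarrow> definable (\<lambda>e. divides (F e) (G e))"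
  unfolding divides_def by (rule definable_app2[where P = "\<lambda>x y. \<exists>q. y = x \<otimes> q"])
    (intro definable_intros)

text \<open>Takes the place of the factorial of \<open>c\<close> in Goedel's beta function. Only its
  existence matters, and the step multiplies by the next number.\<close>

lemma common_multiple: "\<exists>b. \<zero> \<sqsubset> b \<and> (\<forall>x. \<zero> \<sqsubset> x \<longrightarrow> x \<sqsubseteq> c \<longrightarrow> divides x b)"
proof (rule induction[of "\<lambda>c. \<exists>b. \<zero> \<sqsubset> b \<and> (\<forall>x. \<zero> \<sqsubset> x \<longrightarrow> x \<sqsubseteq> c \<longrightarrow> divides x b)"])
  show "definable (\<lambda>e. \<exists>b. \<zero> \<sqsubset> b \<and> (\<forall>x. \<zero> \<sqsubset> x \<longrightarrow> x \<sqsubseteq> e 0 \<longrightarrow> divides x b))"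
    by (intro definable_intros definable_divides)
  show "\<exists>b. \<zero> \<sqsubset> b \<and> (\<forall>x. \<zero> \<sqsubset> x \<longrightarrow> x \<sqsubseteq> \<zero> \<longrightarrow> divides x b)"
    using R.not_less R.zero_less_one by blast
next
  fix c assume "\<exists>b. \<zero> \<sqsubset> b \<and> (\<forall>x. \<zero> \<sqsubset> x \<longrightarrow> x \<sqsubseteq> c \<longrightarrow> divides x b)"
  then obtain b where b: "\<zero> \<sqsubset> b" "\<And>x. \<zero> \<sqsubset> x \<Longrightarrow> x \<sqsubseteq> c \<Longrightarrow> divides x b" by blast
  have "\<zero> \<sqsubset> c \<oplus> \<one>" by (simp add: less_Suc_iff)
  then have "\<zero> \<sqsubset> b \<otimes> (c \<oplus> \<one>)" using b(1) by (rule R.mult_pos_pos[rotated])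
  moreover have "divides x (b \<otimes> (c \<oplus> \<one>))" if "\<zero> \<sqsubset> x" "x \<sqsubseteq> c \<oplus> \<one>" for x
  proof (cases "x \<sqsubseteq> c")
    case True
    then show ?thesis using b(2) that divides_mult(1) by blast
  next
    case False
    then have "x = c \<oplus> \<one>" using that(2) by (metis R.order.antisym R.not_le less_iff_Suc_le)
    then show ?thesis by (metis divides_def divides_mult(2) R.mult_1_right)
  qed
  ultimately show "\<exists>b. \<zero> \<sqsubset> b \<and> (\<forall>x. \<zero> \<sqsubset> x \<longrightarrow> x \<sqsubseteq> c \<oplus> \<one> \<longrightarrow> divides x b)" by blast
qed

text \<open>The numbers \<open>(u + 1) * b + 1\<close> are pairwise coprime for \<open>u < c\<close>: their differences divide
  powers of \<open>b\<close>, which is invertible modulo each of them.\<close>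

lemma divides_coprime:
  assumes "divides ((u \<oplus> \<one>) \<otimes> b \<oplus> \<one>) (b \<otimes> w)"
  shows "divides ((u \<oplus> \<one>) \<otimes> b \<oplus> \<one>) w"
proof -
  let ?m = "(u \<oplus> \<one>) \<otimes> b \<oplus> \<one>"
  have "divides ?m ((u \<oplus> \<one>) \<otimes> (b \<otimes> w) \<oplus> w)"
  proof -
    have "(u \<oplus> \<one>) \<otimes> (b \<otimes> w) \<oplus> w = ?m \<otimes> w"
      by (simp add: R.distrib_right R.mult.assoc)
    then show ?thesis by (metis divides_def)
  qed
  moreover obtain q where "(u \<oplus> \<one>) \<otimes> (b \<otimes> w) = ?m \<otimes> q"
    using divides_mult(2)[OF assms] by (auto simp: divides_def)
  ultimately have "divides ?m (?m \<otimes> q \<oplus> w)" by simp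
  then show "divides ?m w" by (rule divides_cancel)
qed

text \<open>Modulo the modulus of \<open>u\<close>, the modulus of \<open>k\<close> is plus or minus
  \<open>j \<otimes> b\<close>, where \<open>j\<close> is the distance of \<open>u\<close> and
  \<open>k\<close>. Since \<open>j\<close> is at most \<open>c\<close> it divides \<open>b\<close>,
  so divisibility passes to \<open>b \<otimes> (b \<otimes> z)\<close>, and \<open>b\<close> is
  cancelled twice by \<open>divides_coprime\<close>.\<close>

lemma divides_modulus:
  assumes b: "\<And>x. \<zero> \<sqsubset> x \<Longrightarrow> x \<sqsubseteq> c \<Longrightarrow> divides x b"
    and u: "u \<sqsubset> c" "k \<sqsubset> c" "u \<noteq> k"
    and dvd: "divides ((u \<oplus> \<one>) \<otimes> b \<oplus> \<one>) (((k \<oplus> \<one>) \<otimes> b \<oplus> \<one>) \<otimes> z)"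
  shows "divides ((u \<oplus> \<one>) \<otimes> b \<oplus> \<one>) z"
proof -
  let ?m = "\<lambda>u. (u \<oplus> \<one>) \<otimes> b \<oplus> \<one>"
  have "\<exists>j. \<zero> \<sqsubset> j \<and> j \<sqsubseteq> c \<and> divides (?m u) (j \<otimes> b \<otimes> z)"
  proof (cases "u \<sqsubset> k")
    case True
    then obtain j where j: "u \<oplus> j = k" using pa_ax(14) by blast
    have "?m k \<otimes> z = ?m u \<otimes> z \<oplus> j \<otimes> b \<otimes> z"
      unfolding j[symmetric] by (simp add: R.distrib_right R.distrib_left algebra_simps)
    then have "divides (?m u) (j \<otimes> b \<otimes> z)" using dvd divides_cancel by metis
    moreover have "\<zero> \<sqsubset> j" using True j pa_ax(17)[of j] by auto
    moreover have "j \<sqsubseteq> c" using u(2) j by (metis R.add.commute R.less_imp_le R.order.trans leq_iff)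
    ultimately show ?thesis by blast
  next
    case False
    then have "k \<sqsubset> u" using u(3) by (metis R.linorder_cases)
    then obtain j where j: "k \<oplus> j = u" using pa_ax(14) by blast
    have "?m u \<otimes> z = ?m k \<otimes> z \<oplus> j \<otimes> b \<otimes> z"
      unfolding j[symmetric] by (simp add: R.distrib_right R.distrib_left algebra_simps)
    moreover obtain q where "?m k \<otimes> z = ?m u \<otimes> q" using dvd by (auto simp: divides_def)
    moreover have "divides (?m u) (?m u \<otimes> z)" by (auto simp: divides_def)
    ultimately have "divides (?m u) (j \<otimes> b \<otimes> z)" using divides_cancel by metis
    moreover have "\<zero> \<sqsubset> j" using \<open>k \<sqsubset> u\<close> j pa_ax(17)[of j] by auto
    moreover have "j \<sqsubseteq> c" using u(1) j by (metis R.add.commute R.less_imp_le R.order.trans leq_iff)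
    ultimately show ?thesis by blast
  qed
  then obtain j where j: "\<zero> \<sqsubset> j" "j \<sqsubseteq> c" "divides (?m u) (j \<otimes> b \<otimes> z)" by blast
  obtain i where "b = j \<otimes> i" using b[OF j(1,2)] by (auto simp: divides_def)
  then have "b \<otimes> (b \<otimes> z) = i \<otimes> (j \<otimes> b \<otimes> z)"
    by (metis R.mult.assoc R.mult.commute)
  then have "divides (?m u) (b \<otimes> (b \<otimes> z))" using divides_mult(2)[OF j(3)] by metis
  then show ?thesis using divides_coprime by blast
qed

text \<open>By induction on \<open>k\<close>, the number \<open>a\<close> is the product of the
  moduli of those elements of \<open>X\<close> that lie below \<open>k\<close> and \<open>c\<close>;
  by \<open>divides_modulus\<close>, a further factor does not affect divisibility by the other
  moduli. The cut at \<open>c\<close> is forced, as \<open>b\<close> is chosen for differences up to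
  \<open>c\<close>.\<close>

lemma comprehension:
  assumes X: "definable (\<lambda>e. X (e 0))"
  shows "\<exists>a b. \<forall>u. u \<sqsubset> c \<longrightarrow> (X u \<longleftrightarrow> divides ((u \<oplus> \<one>) \<otimes> b \<oplus> \<one>) a)"
proof -
  obtain b where b: "\<zero> \<sqsubset> b" "\<And>x. \<zero> \<sqsubset> x \<Longrightarrow> x \<sqsubseteq> c \<Longrightarrow> divides x b"
    using common_multiple by blast
  let ?m = "\<lambda>u. (u \<oplus> \<one>) \<otimes> b \<oplus> \<one>"
  have "\<exists>a. \<forall>u. u \<sqsubset> c \<longrightarrow> (X u \<and> u \<sqsubset> k \<longleftrightarrow> divides (?m u) a)" for k
  proof (rule induction[of "\<lambda>k. \<exists>a. \<forall>u. u \<sqsubset> c \<longrightarrow> (X u \<and> u \<sqsubset> k \<longleftrightarrow> divides (?m u) a)"])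
    show "definable (\<lambda>e. \<exists>a. \<forall>u. u \<sqsubset> c \<longrightarrow> (X u \<and> u \<sqsubset> e 0 \<longleftrightarrow> divides (?m u) a))"
      by (intro definable_intros definable_divides definable_app[OF X])
    \<comment> \<open>The empty product: as \<open>b\<close> is positive, every modulus exceeds
      \<open>\<one>\<close>, so \<open>a = \<one>\<close> codes the empty set.\<close>
    have "\<not> divides (?m u) \<one>" for u
    proof
      assume "divides (?m u) \<one>"
      then obtain q where q: "\<one> = ?m u \<otimes> q" by (auto simp: divides_def)
      have "\<zero> \<sqsubset> q"
        using q pa_ax(17)[of q] by auto
      have "\<zero> \<sqsubset> (u \<oplus> \<one>) \<otimes> b"
        using b(1) by (intro R.mult_pos_pos) (simp_all add: less_Suc_iff)
      then have "\<one> \<sqsubset> ?m u" using pa_ax(12)[of \<zero> "(u \<oplus> \<one>) \<otimes> b" \<one>] by simp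
      then have "q \<sqsubset> ?m u \<otimes> q" using pa_ax(13)[of q \<one> "?m u"] \<open>\<zero> \<sqsubset> q\<close> by simp
      then have "q \<sqsubset> \<one>" using q by metis
      then show False using \<open>\<zero> \<sqsubset> q\<close> by (metis R.add_0_left R.not_less less_iff_Suc_le)
    qed
    then show "\<exists>a. \<forall>u. u \<sqsubset> c \<longrightarrow> (X u \<and> u \<sqsubset> \<zero> \<longleftrightarrow> divides (?m u) a)"
      using zero_le R.not_less by blast
  next
    fix k assume "\<exists>a. \<forall>u. u \<sqsubset> c \<longrightarrow> (X u \<and> u \<sqsubset> k \<longleftrightarrow> divides (?m u) a)"
    then obtain a where a: "\<And>u. u \<sqsubset> c \<Longrightarrow> X u \<and> u \<sqsubset> k \<longleftrightarrow> divides (?m u) a" by blast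
    have less: "u \<sqsubset> k \<oplus> \<one> \<longleftrightarrow> u \<sqsubset> k \<or> u = k" for u
      by (simp add: less_Suc_iff leq_S_def)
    show "\<exists>a. \<forall>u. u \<sqsubset> c \<longrightarrow> (X u \<and> u \<sqsubset> k \<oplus> \<one> \<longleftrightarrow> divides (?m u) a)"
    proof (cases "X k \<and> k \<sqsubset> c")
      case False
      then show ?thesis using a less by blast
    next
      case True
      have "X u \<and> u \<sqsubset> k \<oplus> \<one> \<longleftrightarrow> divides (?m u) (?m k \<otimes> a)" if u: "u \<sqsubset> c" for u
      proof (cases "u = k")
        case True
        have "divides (?m k) (?m k \<otimes> a)" by (auto simp: divides_def)
        then show ?thesis using \<open>u = k\<close> \<open>X k \<and> k \<sqsubset> c\<close> less by blast
      next
        case False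
        have "divides (?m u) (?m k \<otimes> a) \<longleftrightarrow> divides (?m u) a"
          using divides_modulus[OF b(2) u _ False, of a] divides_mult(2) True by blast
        then show ?thesis using a[OF u] less False by blast
      qed
      then show ?thesis by blast
    qed
  qed
  from this[of c] show ?thesis by blast
qed

end

text \<open>One element pairs the two numbers provided by \<open>comprehension\<close>, because a
  type has a single variable to realise. Indices 2, 1 and 0 are the product, the base of the moduli
  and the cofactor.\<close>

definition Code_In :: "'f tm \<Rightarrow> 'f tm \<Rightarrow> ('f, 'r) fm" where
  "Code_In s x = Exi (Exi (Exi (And (Eq x (Opair (Var 2) (Var 1)))
     (Eq (Var 2) (Mul (Add (Mul (Add s One) (Var 1)) One) (Var 0))))))"

text \<open>\<open>Var 0\<close> codes a set that decides \<open>p(t)\<close> correctly for all closed terms \<open>t\<close> with a code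
  below \<open>Var 1\<close>. The arguments of \<open>Code_In\<close> refer to \<open>t\<close> and \<open>Var 0\<close> from below its own
  three quantifiers.\<close>

definition Approx :: "('f, 'r) fm \<Rightarrow> ('f, 'r) fm" where
  "Approx p = Uni (Imp (Less (Var 0) (Var 2)) (Imp Closed_Term
     (And (Exi Value) (Uni (Imp Value (Iff (Code_In (Code_Inst 0 (Var 4) p) (Var 5)) p))))))"

lemma sat_Or: "sat M e (Or p q) \<longleftrightarrow> sat M e p \<or> sat M e q"
  and sat_And: "sat M e (And p q) \<longleftrightarrow> sat M e p \<and> sat M e q"
  and sat_Exi: "sat M e (Exi p) \<longleftrightarrow> (\<exists>x\<in>carr M. sat M (case_nat x e) p)"
  by auto

context pa
begin

section \<open>Pairs\<close>

definition pair_val where "pair_val a b = (a \<oplus> b) \<otimes> (a \<oplus> b) \<oplus> a \<oplus> \<one>"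

definition num_val :: "nat \<Rightarrow> nat" where "num_val n = ((\<lambda>x. x \<oplus> \<one>) ^^ n) \<zero>"

lemma num_val_simps [simp]: "num_val 0 = \<zero>" "num_val (Suc n) = num_val n \<oplus> \<one>"
  by (simp_all add: num_val_def)

lemma val_num: "val_tm S e (num n) = num_val n"
  by (induction n) simp_all

lemma val_Opair: "val_tm S e (Opair s t) = pair_val (val_tm S e s) (val_tm S e t)"
  by (simp add: Opair_def pair_val_def)

lemma less_add_one: "x \<sqsubset> x \<oplus> \<one>"
  by (simp add: less_Suc_iff)

lemma square_ge: "x \<sqsubseteq> x \<otimes> x"
proof (cases "x = \<zero>")
  case False
  then have "\<one> \<sqsubseteq> x" using pa_ax(17)[of x] less_iff_Suc_le[of \<zero> x] by simp
  then show ?thesis using R.mult_left_mono[of \<one> x x] by simp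
qed simp

lemma less_pair_val: "a \<sqsubset> pair_val a b" "b \<sqsubset> pair_val a b"
proof -
  let ?s = "a \<oplus> b"
  have "?s \<sqsubseteq> ?s \<otimes> ?s \<oplus> a"
    using R.add_increasing2[of a ?s "?s \<otimes> ?s"] square_ge[of ?s] by simp
  then have "?s \<sqsubset> pair_val a b" by (simp add: pair_val_def less_Suc_iff)
  moreover have "a \<sqsubseteq> ?s" "b \<sqsubseteq> ?s" by (simp_all add: R.add_increasing R.add_increasing2)
  ultimately show "a \<sqsubset> pair_val a b" "b \<sqsubset> pair_val a b" by (metis R.le_less_trans)+
qed

lemma pair_val_mono: "a \<sqsubseteq> a' \<Longrightarrow> b \<sqsubseteq> b' \<Longrightarrow> pair_val a b \<sqsubseteq> pair_val a' b'"
  unfolding pair_val_def by (intro R.add_mono R.mult_mono) (simp_all add: R.add_nonneg_nonneg)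

text \<open>With \<open>s\<close> for the sum of its components, a pair is at most the square of
  \<open>s \<oplus> \<one>\<close>, while a pair with a larger sum exceeds that square. So the sum
  can be read off a pair, and then the first component.\<close>

lemma pair_val_sum_less: "a \<oplus> b \<sqsubset> a' \<oplus> b' \<Longrightarrow> pair_val a b \<sqsubset> pair_val a' b'"
proof -
  let ?s = "a \<oplus> b" and ?s' = "a' \<oplus> b'"
  assume "?s \<sqsubset> ?s'"
  then have "?s \<oplus> \<one> \<sqsubseteq> ?s'" by (simp add: less_iff_Suc_le)
  then have "(?s \<oplus> \<one>) \<otimes> (?s \<oplus> \<one>) \<sqsubseteq> ?s' \<otimes> ?s'" by (intro R.mult_mono) simp_all
  moreover have "pair_val a b \<oplus> (b \<oplus> ?s) = (?s \<oplus> \<one>) \<otimes> (?s \<oplus> \<one>)"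
    unfolding pair_val_def by (simp add: algebra_simps)
  ultimately have "pair_val a b \<sqsubseteq> ?s' \<otimes> ?s'" by (metis R.order.trans leq_iff)
  then show ?thesis
    unfolding pair_val_def[of a' b'] less_Suc_iff using R.add_increasing2[of a'] by simp
qed

lemma pair_val_inject [simp]: "pair_val a b = pair_val a' b' \<longleftrightarrow> a = a' \<and> b = b'"
proof
  assume eq: "pair_val a b = pair_val a' b'"
  then have s: "a \<oplus> b = a' \<oplus> b'"
    using pair_val_sum_less[of a b a' b'] pair_val_sum_less[of a' b' a b] by (metis R.less_irrefl R.linorder_cases)
  then have "a = a'" using eq unfolding pair_val_def by simp
  then show "a = a' \<and> b = b'" using s by simp
qed simp

lemma num_val_inject [simp]: "num_val m = num_val n \<longleftrightarrow> m = n"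
proof -
  have "num_val m \<sqsubset> num_val n" if "m < n" for m n
    using that by (induction n) (auto simp: less_Suc_eq less_Suc_iff leq_S_def)
  then show ?thesis by (metis R.less_irrefl linorder_neqE_nat)
qed

definition "zero_code = pair_val (num_val 1) (num_val 0)"
definition "one_code = pair_val (num_val 2) (num_val 0)"
definition "add_code s t = pair_val (num_val 3) (pair_val s t)"
definition "mul_code s t = pair_val (num_val 4) (pair_val s t)"

lemma val_codes:
  "val_tm S e Code_Zero = zero_code" "val_tm S e Code_One = one_code"
  "val_tm S e (Code_Add s t) = add_code (val_tm S e s) (val_tm S e t)"
  "val_tm S e (Code_Mul s t) = mul_code (val_tm S e s) (val_tm S e t)"
  by (simp_all only: Code_Zero_def Code_One_def Code_Add_def Code_Mul_def val_Opair val_num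
      zero_code_def one_code_def add_code_def mul_code_def)

lemma codes_distinct [simp]:
  "zero_code \<noteq> one_code" "zero_code \<noteq> add_code s t" "zero_code \<noteq> mul_code s t" "one_code \<noteq> zero_code" "one_code \<noteq> add_code s t" "one_code \<noteq> mul_code s t"
  "add_code s t \<noteq> zero_code" "add_code s t \<noteq> one_code" "add_code s t \<noteq> mul_code s' t'" "mul_code s t \<noteq> zero_code" "mul_code s t \<noteq> one_code" "mul_code s t \<noteq> add_code s' t'"
  "add_code s t = add_code s' t' \<longleftrightarrow> s = s' \<and> t = t'" "mul_code s t = mul_code s' t' \<longleftrightarrow> s = s' \<and> t = t'"
  "zero_code \<noteq> pair_val (num_val 0) i" "one_code \<noteq> pair_val (num_val 0) i" "add_code s t \<noteq> pair_val (num_val 0) i" "mul_code s t \<noteq> pair_val (num_val 0) i"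
  "pair_val (num_val 0) i \<noteq> zero_code" "pair_val (num_val 0) i \<noteq> one_code" "pair_val (num_val 0) i \<noteq> add_code s t" "pair_val (num_val 0) i \<noteq> mul_code s t"
  unfolding zero_code_def one_code_def add_code_def mul_code_def pair_val_inject num_val_inject by simp_all

lemma term_fun_pair_val: "term_fun F \<Longrightarrow> term_fun G \<Longrightarrow> term_fun (\<lambda>e. pair_val (F e) (G e))"
  unfolding pair_val_def by (intro definable_intros)

lemma term_fun_codes:
  "term_fun F \<Longrightarrow> term_fun G \<Longrightarrow> term_fun (\<lambda>e. add_code (F e) (G e))"
  "term_fun F \<Longrightarrow> term_fun G \<Longrightarrow> term_fun (\<lambda>e. mul_code (F e) (G e))"
  unfolding add_code_def mul_code_def by (intro term_fun_const term_fun_pair_val; assumption)+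

lemma less_add_code: "s \<sqsubset> add_code s t" "t \<sqsubset> add_code s t" and less_mul_code: "s \<sqsubset> mul_code s t" "t \<sqsubset> mul_code s t"
  unfolding add_code_def mul_code_def by (metis R.less_trans less_pair_val)+

section \<open>Values of closed terms\<close>

definition coded_mem where "coded_mem u a b c \<longleftrightarrow> u \<sqsubset> c \<and> divides ((u \<oplus> \<one>) \<otimes> b \<oplus> \<one>) a"

lemma definable_coded_mem: "term_fun F \<Longrightarrow> definable (\<lambda>e. coded_mem (F e) a b c)"
  by (rule definable_app[where P = "\<lambda>u. coded_mem u a b c"])
    (unfold coded_mem_def, intro definable_intros definable_divides)

lemma sat_Mem:
  "sat S e (Mem u a b c) \<longleftrightarrow> coded_mem (val_tm S e u) (val_tm S e a) (val_tm S e b) (val_tm S e c)"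
  by (simp add: Mem_def coded_mem_def divides_def val_subst_tm carr)

definition closed_term where
  "closed_term t \<longleftrightarrow> (\<exists>a b c. coded_mem t a b c \<and> (\<forall>u. coded_mem u a b c \<longrightarrow> u = zero_code \<or> u = one_code \<or>
     (\<exists>y x. coded_mem x a b c \<and> coded_mem y a b c \<and> (u = add_code x y \<or> u = mul_code x y))))"

lemma sat_Closed_Term: "sat S e Closed_Term \<longleftrightarrow> closed_term (e 0)"
  unfolding Closed_Term_def closed_term_def sat_Or sat_And sat_Exi sat.simps(5,6)
  by (simp add: sat_Mem val_codes carr disj_imp)

text \<open>Stated for relations rather than codes, so that it also applies to definable relations
  that are yet to be coded.\<close>

definition back_closed where
  "back_closed A \<longleftrightarrow> (\<forall>y w. A y w \<longrightarrow> (y = zero_code \<and> w = \<zero>) \<or> (y = one_code \<and> w = \<one>) \<or>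
     (\<exists>y1 y2 w1 w2. A y1 w1 \<and> A y2 w2 \<and>
       (y = add_code y1 y2 \<and> w = w1 \<oplus> w2 \<or> y = mul_code y1 y2 \<and> w = w1 \<otimes> w2)))"

definition has_value where
  "has_value t v \<longleftrightarrow> (\<exists>a b c. coded_mem (pair_val t v) a b c \<and> back_closed (\<lambda>y w. coded_mem (pair_val y w) a b c))"

lemma sat_Value: "sat S e Value \<longleftrightarrow> has_value (e 1) (e 0)"
  unfolding Value_def has_value_def back_closed_def sat_Or sat_And sat_Exi sat.simps(5,6)
  by (simp add: sat_Mem val_codes val_Opair carr disj_imp)

lemma definable_has_value_args: "definable (\<lambda>e. has_value (e 0) (e (Suc 0)))"
  unfolding has_value_def back_closed_def coded_mem_def
  by (intro definable_intros definable_divides term_fun_pair_val term_fun_codes)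

lemmas definable_has_value = definable_app2[where P = has_value, OF definable_has_value_args]

text \<open>\<open>comprehension\<close> codes any bounded definable relation, so a witness for
  \<open>Value\<close> need only be described.\<close>

lemma has_valueI:
  assumes "definable (\<lambda>e. A (e 0) (e (Suc 0)))" and bound: "\<And>y w. A y w \<Longrightarrow> pair_val y w \<sqsubset> c"
    and "back_closed A" "A t v"
  shows "has_value t v"
proof -
  let ?X = "\<lambda>u. \<exists>y w. u = pair_val y w \<and> A y w"
  have "definable (\<lambda>e. ?X (e 0))"
    by (intro definable_intros definable_app2[where P = A, OF assms(1)] term_fun_pair_val)
  then obtain a b where ab: "\<And>u. u \<sqsubset> c \<Longrightarrow> ?X u \<longleftrightarrow> divides ((u \<oplus> \<one>) \<otimes> b \<oplus> \<one>) a"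
    using comprehension[of ?X c] by blast
  have "coded_mem (pair_val y w) a b c \<longleftrightarrow> A y w" for y w
    unfolding coded_mem_def using ab[of "pair_val y w"] bound[of y w] by auto
  then show ?thesis
    unfolding has_value_def using assms(3,4) by (intro exI[of _ a] exI[of _ b] exI[of _ c]) simp
qed

text \<open>The coded set that witnesses the value of a term witnesses those of its subterms as
  well.\<close>

lemma has_value_cases:
  assumes "has_value t v"
  shows "(t = zero_code \<and> v = \<zero>) \<or> (t = one_code \<and> v = \<one>) \<or>
     (\<exists>t1 t2 v1 v2. has_value t1 v1 \<and> has_value t2 v2 \<and>
       (t = add_code t1 t2 \<and> v = v1 \<oplus> v2 \<or> t = mul_code t1 t2 \<and> v = v1 \<otimes> v2))"
proof -
  obtain a b c where "coded_mem (pair_val t v) a b c" and A: "back_closed (\<lambda>y w. coded_mem (pair_val y w) a b c)"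
    using assms by (auto simp: has_value_def)
  moreover have "has_value t' v'" if "coded_mem (pair_val t' v') a b c" for t' v'
    using that A by (auto simp: has_value_def)
  ultimately show ?thesis unfolding back_closed_def by blast
qed

lemma has_value_base: "has_value zero_code \<zero>" "has_value one_code \<one>"
proof -
  have *: "has_value y w" if closed: "back_closed (\<lambda>y' w'. y' = y \<and> w' = w)" for y w
  proof (rule has_valueI[where c = "pair_val y w \<oplus> \<one>", OF _ _ closed])
    show "definable (\<lambda>e. e 0 = y \<and> e (Suc 0) = w)" by (intro definable_intros)
  qed (simp_all add: less_add_one)
  show "has_value zero_code \<zero>" by (rule *) (simp add: back_closed_def)
  show "has_value one_code \<one>" by (rule *) (simp add: back_closed_def)
qed

lemma back_closed_join:
  assumes A: "back_closed A" and B: "back_closed B" and "A t1 v1" "B t2 v2"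
    and tv: "t = add_code t1 t2 \<and> v = v1 \<oplus> v2 \<or> t = mul_code t1 t2 \<and> v = v1 \<otimes> v2"
  shows "back_closed (\<lambda>y w. (A y w \<or> B y w) \<or> y = t \<and> w = v)" (is "back_closed ?C")
  unfolding back_closed_def
proof (intro allI impI)
  fix y w assume "?C y w"
  then consider "A y w" | "B y w" | "y = t" "w = v" by blast
  then show "(y = zero_code \<and> w = \<zero>) \<or> (y = one_code \<and> w = \<one>) \<or> (\<exists>y1 y2 w1 w2. ?C y1 w1 \<and> ?C y2 w2 \<and>
    (y = add_code y1 y2 \<and> w = w1 \<oplus> w2 \<or> y = mul_code y1 y2 \<and> w = w1 \<otimes> w2))"
  proof cases
    case 1
    from A[unfolded back_closed_def, rule_format, OF this] show ?thesis by blast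
  next
    case 2
    from B[unfolded back_closed_def, rule_format, OF this] show ?thesis by blast
  next
    case 3
    then show ?thesis using assms(3,4) tv by blast
  qed
qed

text \<open>The union of both witnesses and the new pair is definable with their codes as
  parameters, and \<open>has_valueI\<close> codes it afresh.\<close>

lemma has_value_step:
  assumes "has_value t1 v1" "has_value t2 v2"
    and tv: "t = add_code t1 t2 \<and> v = v1 \<oplus> v2 \<or> t = mul_code t1 t2 \<and> v = v1 \<otimes> v2"
  shows "has_value t v"
proof -
  obtain a b c where A: "coded_mem (pair_val t1 v1) a b c" "back_closed (\<lambda>y w. coded_mem (pair_val y w) a b c)"
    using assms(1) by (auto simp: has_value_def)
  obtain a' b' c' where A': "coded_mem (pair_val t2 v2) a' b' c'" "back_closed (\<lambda>y w. coded_mem (pair_val y w) a' b' c')"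
    using assms(2) by (auto simp: has_value_def)
  let ?A = "\<lambda>y w. (coded_mem (pair_val y w) a b c \<or> coded_mem (pair_val y w) a' b' c') \<or> y = t \<and> w = v"
  show ?thesis
  proof (rule has_valueI)
    show "definable (\<lambda>e. ?A (e 0) (e (Suc 0)))"
      by (intro definable_intros definable_coded_mem term_fun_pair_val)
    show "pair_val y w \<sqsubset> c \<oplus> c' \<oplus> pair_val t v \<oplus> \<one>" if "?A y w" for y w
    proof -
      have "pair_val y w \<sqsubseteq> c \<or> pair_val y w \<sqsubseteq> c' \<or> pair_val y w \<sqsubseteq> pair_val t v"
        using that unfolding coded_mem_def by (metis R.less_imp_le R.order_refl)
      moreover have "c \<sqsubseteq> c \<oplus> c' \<oplus> pair_val t v" "c' \<sqsubseteq> c \<oplus> c' \<oplus> pair_val t v" "pair_val t v \<sqsubseteq> c \<oplus> c' \<oplus> pair_val t v"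
        by (auto intro: R.add_increasing R.add_increasing2)
      ultimately show ?thesis unfolding less_Suc_iff using R.order.trans by blast
    qed
    show "back_closed ?A"
      by (rule back_closed_join[OF A(2) A'(2) A(1) A'(1) tv])
    show "?A t v" by simp
  qed
qed

text \<open>Codes of closed terms may be nonstandard, so recursion over HOL terms is out of reach;
  the induction runs inside \<open>S\<close>, on the code, which exceeds the codes of the
  subterms.\<close>

lemma has_value_unique: "has_value t v \<Longrightarrow> has_value t v' \<Longrightarrow> v = v'"
proof -
  have "\<forall>v v'. has_value t v \<longrightarrow> has_value t v' \<longrightarrow> v = v'"
  proof (rule strong_induction[of "\<lambda>t. \<forall>v v'. has_value t v \<longrightarrow> has_value t v' \<longrightarrow> v = v'"])
    show "definable (\<lambda>e. \<forall>v v'. has_value (e 0) v \<longrightarrow> has_value (e 0) v' \<longrightarrow> v = v')"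
      by (intro definable_intros definable_has_value)
    fix t assume IH: "\<And>t'. t' \<sqsubset> t \<Longrightarrow> \<forall>v v'. has_value t' v \<longrightarrow> has_value t' v' \<longrightarrow> v = v'"
    show "\<forall>v v'. has_value t v \<longrightarrow> has_value t v' \<longrightarrow> v = v'"
    proof (intro allI impI)
      fix v v' assume "has_value t v" "has_value t v'"
      from this[THEN has_value_cases] show "v = v'"
        using IH less_add_code less_mul_code by (elim disjE exE conjE) (simp_all, (metis)+)
    qed
  qed
  then show "has_value t v \<Longrightarrow> has_value t v' \<Longrightarrow> v = v'" by blast
qed

text \<open>Again an induction inside \<open>S\<close>, now restricted to the coded set of subterms
  that witnesses closedness.\<close>

lemma closed_term_has_value:
  assumes "closed_term t"
  shows "\<exists>v. has_value t v"
proof -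
  obtain a b c where t: "coded_mem t a b c" and step: "\<And>u. coded_mem u a b c \<Longrightarrow> u = zero_code \<or> u = one_code \<or>
     (\<exists>y x. coded_mem x a b c \<and> coded_mem y a b c \<and> (u = add_code x y \<or> u = mul_code x y))"
    using assms unfolding closed_term_def by blast
  have "coded_mem u a b c \<longrightarrow> (\<exists>v. has_value u v)" for u
  proof (rule strong_induction[of "\<lambda>u. coded_mem u a b c \<longrightarrow> (\<exists>v. has_value u v)"])
    show "definable (\<lambda>e. coded_mem (e 0) a b c \<longrightarrow> (\<exists>v. has_value (e 0) v))"
      by (intro definable_intros definable_coded_mem definable_has_value)
    fix u assume IH: "\<And>u'. u' \<sqsubset> u \<Longrightarrow> coded_mem u' a b c \<longrightarrow> (\<exists>v. has_value u' v)"
    show "coded_mem u a b c \<longrightarrow> (\<exists>v. has_value u v)"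
      using step[of u] IH has_value_base has_value_step less_add_code less_mul_code by metis
  qed
  then show ?thesis using t by blast
qed

end

section \<open>Codes of instances\<close>

lemma wf_num: "wf_tm F (num n)"
  by (induction n) simp_all

lemma wf_Opair: "wf_tm F (Opair s t) \<longleftrightarrow> wf_tm F s \<and> wf_tm F t"
  by (auto simp: Opair_def)

lemma wf_Codes:
  "wf_tm F Code_Zero" "wf_tm F Code_One"
  "wf_tm F (Code_Add s t) \<longleftrightarrow> wf_tm F s \<and> wf_tm F t"
  "wf_tm F (Code_Mul s t) \<longleftrightarrow> wf_tm F s \<and> wf_tm F t"
  by (simp_all only: Code_Zero_def Code_One_def Code_Add_def Code_Mul_def wf_Opair wf_num simp_thms)

lemma wf_Code_Inst_tm: "wf_tm F \<tau> \<Longrightarrow> wf_tm F (Code_Inst_tm k \<tau> r)"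
  by (induction r) (simp_all add: wf_Codes wf_Opair wf_num del: num.simps)

lemma wf_Code_Inst: "wf_tm F \<tau> \<Longrightarrow> wf_tm F (Code_Inst k \<tau> p)"
  by (induction p arbitrary: k) (simp_all add: wf_Code_Inst_tm wf_Opair wf_num del: num.simps One_nat_def)

context pa
begin

definition inst_code_tm where "inst_code_tm k t r = val_tm S (\<lambda>_. t) (Code_Inst_tm k (Var 0) r)"
definition inst_code where "inst_code k t p = val_tm S (\<lambda>_. t) (Code_Inst k (Var 0) p)"

lemma inst_code_tm_simps [simp]:
  "inst_code_tm k t (Var i) = (if i = k then t else pair_val (num_val 0) (num_val (if i < k then i else i - 1)))"
  "inst_code_tm k t Zero = zero_code" "inst_code_tm k t One = one_code"
  "inst_code_tm k t (Add r s) = add_code (inst_code_tm k t r) (inst_code_tm k t s)"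
  "inst_code_tm k t (Mul r s) = mul_code (inst_code_tm k t r) (inst_code_tm k t s)"
  by (simp_all add: inst_code_tm_def val_Opair val_num val_codes del: num.simps num_val_simps One_nat_def)

lemma inst_code_simps [simp]:
  "inst_code k t Fls = pair_val (num_val 0) (num_val 0)"
  "inst_code k t (Eq r s) = pair_val (num_val 1) (pair_val (inst_code_tm k t r) (inst_code_tm k t s))"
  "inst_code k t (Less r s) = pair_val (num_val 2) (pair_val (inst_code_tm k t r) (inst_code_tm k t s))"
  "inst_code k t (Imp p q) = pair_val (num_val 3) (pair_val (inst_code k t p) (inst_code k t q))"
  "inst_code k t (Uni p) = pair_val (num_val 4) (inst_code (Suc k) t p)"
  by (simp_all add: inst_code_def inst_code_tm_def val_Opair val_num del: num.simps num_val_simps One_nat_def)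

lemma val_Code_Inst_tm: "val_tm S e (Code_Inst_tm k \<tau> r) = inst_code_tm k (val_tm S e \<tau>) r"
  unfolding inst_code_tm_def
  by (induction r) (simp_all add: val_Opair val_num val_codes del: num.simps num_val_simps One_nat_def)

lemma val_Code_Inst: "val_tm S e (Code_Inst k \<tau> p) = inst_code k (val_tm S e \<tau>) p"
  unfolding inst_code_def
  by (induction p arbitrary: k)
    (simp_all add: val_Opair val_num val_Code_Inst_tm del: num.simps num_val_simps One_nat_def)

lemma inst_code_tm_mono: "t \<sqsubseteq> t' \<Longrightarrow> inst_code_tm k t r \<sqsubseteq> inst_code_tm k t' r"
proof (induction r)
  case (Fn f ts)
  then show ?case by (simp add: inst_code_tm_def)
qed (simp_all add: add_code_def mul_code_def pair_val_mono del: num_val_simps)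

text \<open>Bounds all instances at \<open>t \<sqsubset> d\<close> by the one at \<open>d\<close>;
  such a bound is what allows the truth set below \<open>d\<close> to be coded.\<close>

lemma inst_code_mono: "t \<sqsubseteq> t' \<Longrightarrow> inst_code k t p \<sqsubseteq> inst_code k t' p"
proof (induction p arbitrary: k)
  case (Rel r ts)
  then show ?case by (simp add: inst_code_def)
qed (simp_all add: pair_val_mono inst_code_tm_mono del: num_val_simps)

text \<open>Tells a variable that was left in place from a closed term that was substituted, when
  only codes are compared.\<close>

lemma no_value_var: "\<not> has_value (pair_val (num_val 0) i) v"
proof
  assume "has_value (pair_val (num_val 0) i) v"
  from has_value_cases[OF this] show False by (auto simp del: num_val_simps)
qed

text \<open>If the instance has a value, then \<open>r\<close> has no variable besides the replaced
  one, by \<open>no_value_var\<close>; this is why \<open>e\<close> is arbitrary.\<close>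

lemma has_value_inst_code_tm:
  assumes "has_value t v"
  shows "has_value (inst_code_tm k t r) w \<Longrightarrow> wf_tm {} r \<Longrightarrow> fvb_tm r \<le> Suc k \<Longrightarrow>
    w = val_tm S (\<lambda>i. if i = k then v else e i) r"
proof (induction r arbitrary: w)
  case (Var i)
  then show ?case
    using assms has_value_unique no_value_var by (cases "i = k") (auto simp del: num_val_simps)
next
  case Zero
  then show ?case using has_value_base(1) has_value_unique by (auto simp del: num_val_simps)
next
  case One
  then show ?case using has_value_base(2) has_value_unique by (auto simp del: num_val_simps)
next
  case (Add r s)
  from has_value_cases[OF Add.prems(1)] obtain w1 w2
    where "has_value (inst_code_tm k t r) w1" "has_value (inst_code_tm k t s) w2" "w = w1 \<oplus> w2"
    by auto
  then show ?case using Add by simp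
next
  case (Mul r s)
  from has_value_cases[OF Mul.prems(1)] obtain w1 w2
    where "has_value (inst_code_tm k t r) w1" "has_value (inst_code_tm k t s) w2" "w = w1 \<otimes> w2"
    by auto
  then show ?case using Mul by simp
qed simp

text \<open>The shapes of \<open>r\<close> and \<open>r'\<close> may differ: where one has the
  replaced variable, the other may spell out the closed term substituted there. The common code then
  has a value, and \<open>has_value_inst_code_tm\<close> evaluates the other side.\<close>

lemma inst_code_tm_eq:
  assumes "has_value t v" "has_value t' v'"
  shows "inst_code_tm k t r = inst_code_tm k t' r' \<Longrightarrow> wf_tm {} r \<Longrightarrow> fvb_tm r \<le> Suc k \<Longrightarrow>
    wf_tm {} r' \<Longrightarrow> fvb_tm r' \<le> Suc k \<Longrightarrow> val_tm S (\<lambda>i. if i = k then v else e i) r = val_tm S (\<lambda>i. if i = k then v' else e i) r'"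
proof (induction r arbitrary: r')
  case (Var i)
  show ?case
  proof (cases "i = k")
    case True
    then have "has_value (inst_code_tm k t' r') v" using Var(1) assms(1) by simp
    from has_value_inst_code_tm[OF assms(2) this] show ?thesis using Var True by simp
  next
    case i: False
    \<comment> \<open>By the bound on free indices, \<open>i\<close> lies below \<open>k\<close> and
      is kept unchanged; its code has no value, so it cannot stem from the substituted term on the
      other side.\<close>
    then have "inst_code_tm k t' r' = pair_val (num_val 0) (num_val i)" "i < k"
      using Var(1,3) by (simp_all del: num_val_simps)
    then show ?thesis
      using Var(4,5) no_value_var assms(2) i
      by (cases r') (auto simp del: num_val_simps split: if_splits)
  qed
next
  case Zero
  show ?case
  proof (cases "r' = Var k")
    case True
    then have "has_value (inst_code_tm k t Zero) v'" using Zero(1) assms(2) by simp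
    from has_value_inst_code_tm[OF assms(1) this] show ?thesis using True by simp
  next
    case False
    then show ?thesis using Zero by (cases r') (auto simp del: num_val_simps)
  qed
next
  case One
  show ?case
  proof (cases "r' = Var k")
    case True
    then have "has_value (inst_code_tm k t One) v'" using One(1) assms(2) by simp
    from has_value_inst_code_tm[OF assms(1) this] show ?thesis using True by simp
  next
    case False
    then show ?thesis using One by (cases r') (auto simp del: num_val_simps)
  qed
next
  case (Add r s)
  show ?case
  proof (cases "r' = Var k")
    case True
    then have "has_value (inst_code_tm k t (Add r s)) v'" using Add(3) assms(2) by simp
    from has_value_inst_code_tm[OF assms(1) this] show ?thesis using True Add(4,5) by simp
  next
    case False
    then obtain r1 s1 where "r' = Add r1 s1"
      using Add(3,6,7) by (cases r') (auto simp del: num_val_simps)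
    then show ?thesis using Add by simp
  qed
next
  case (Mul r s)
  show ?case
  proof (cases "r' = Var k")
    case True
    then have "has_value (inst_code_tm k t (Mul r s)) v'" using Mul(3) assms(2) by simp
    from has_value_inst_code_tm[OF assms(1) this] show ?thesis using True Mul(4,5) by simp
  next
    case False
    then obtain r1 s1 where "r' = Mul r1 s1"
      using Mul(3,6,7) by (cases r') (auto simp del: num_val_simps)
    then show ?thesis using Mul by simp
  qed
qed simp

text \<open>A code arising as an instance of two formulae belongs to the same sentence, hence the
  coded truth set is well defined.\<close>

lemma inst_code_eq:
  assumes "has_value t v" "has_value t' v'"
  shows "inst_code k t p = inst_code k t' p' \<Longrightarrow> p \<in> formulas L_PA \<Longrightarrow> fvb p \<le> Suc k \<Longrightarrow>
    p' \<in> formulas L_PA \<Longrightarrow> fvb p' \<le> Suc k \<Longrightarrow> sat S (\<lambda>i. if i = k then v else e i) p \<longleftrightarrow> sat S (\<lambda>i. if i = k then v' else e i) p'"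
proof (induction p arbitrary: p' k e)
  case Fls
  then show ?case by (cases p') (auto simp del: num_val_simps)
next
  case (Eq r s)
  then obtain r' s' where "p' = Eq r' s'" by (cases p') (auto simp del: num_val_simps)
  then show ?case using Eq inst_code_tm_eq[OF assms, of k r r' e] inst_code_tm_eq[OF assms, of k s s' e]
    by (simp del: num_val_simps)
next
  case (Less r s)
  then obtain r' s' where "p' = Less r' s'" by (cases p') (auto simp del: num_val_simps)
  then show ?case using Less inst_code_tm_eq[OF assms, of k r r' e] inst_code_tm_eq[OF assms, of k s s' e]
    by (simp del: num_val_simps)
next
  case (Imp p q)
  then obtain r s where p': "p' = Imp r s" by (cases p') (auto simp del: num_val_simps)
  have "sat S (\<lambda>i. if i = k then v else e i) p \<longleftrightarrow> sat S (\<lambda>i. if i = k then v' else e i) r" "sat S (\<lambda>i. if i = k then v else e i) q \<longleftrightarrow> sat S (\<lambda>i. if i = k then v' else e i) s"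
    using Imp p' by (simp_all del: num_val_simps)
  then show ?case using p' by simp
next
  case (Uni p)
  then obtain r where p': "p' = Uni r" by (cases p') (auto simp del: num_val_simps)
  have upd: "case_nat x (\<lambda>i. if i = k then w else e i) = (\<lambda>i. if i = Suc k then w else case_nat x e i)" for x w
    by (rule ext) (simp split: nat.split)
  have "sat S (\<lambda>i. if i = Suc k then v else case_nat x e i) p \<longleftrightarrow> sat S (\<lambda>i. if i = Suc k then v' else case_nat x e i) r" for x
    using Uni p' by (simp del: num_val_simps)
  then show ?case by (simp add: p' upd)
qed (simp del: num_val_simps)

section \<open>Finite satisfiability of the type\<close>

lemma sat_Code_In:
  "sat S e (Code_In s x) \<longleftrightarrow> (\<exists>a b c. val_tm S (case_nat c (case_nat b (case_nat a e))) x = pair_val a b \<and>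
    a = ((val_tm S (case_nat c (case_nat b (case_nat a e))) s \<oplus> \<one>) \<otimes> b \<oplus> \<one>) \<otimes> c)"
  unfolding Code_In_def sat_Exi sat_And by (simp add: carr val_Opair numeral_2_eq_2)

lemma sat_Approx:
  assumes "fvb p \<le> 1"
  shows "sat S (case_nat x (case_nat d e)) (Approx p) \<longleftrightarrow>
    (\<forall>t. t \<sqsubset> d \<longrightarrow> closed_term t \<longrightarrow> (\<exists>v. has_value t v) \<and> (\<forall>v. has_value t v \<longrightarrow>
      ((\<exists>a b. x = pair_val a b \<and> divides ((inst_code 0 t p \<oplus> \<one>) \<otimes> b \<oplus> \<one>) a) \<longleftrightarrow> sat S (\<lambda>_. v) p)))"
proof -
  have "sat S (case_nat v e') p \<longleftrightarrow> sat S (\<lambda>_. v) p" for v e'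
    using assms by (intro sat_cong) (simp split: nat.split)
  then show ?thesis
    unfolding Approx_def sat_Exi sat_And
    by (simp add: carr sat_Closed_Term sat_Value sat_Code_In val_Code_Inst divides_def
      numeral_eq_Suc) blast
qed

lemma term_fun_inst_code: "term_fun F \<Longrightarrow> term_fun (\<lambda>e. inst_code k (F e) p)"
  unfolding term_fun_def by (metis val_Code_Inst wf_Code_Inst)

lemma definable_sat:
  assumes "p \<in> formulas L_PA" "term_fun F"
  shows "definable (\<lambda>e. sat S (\<lambda>_. F e) p)"
proof (rule definable_app[where P = "\<lambda>v. sat S (\<lambda>_. v) p", OF _ assms(2)])
  have "subst_fm (\<lambda>_. Var 0) p \<in> formulas L_PA"
    using assms(1) by (auto simp: formulas_def intro!: wf_subst_fm)
  then show "definable (\<lambda>e. sat S (\<lambda>_. e 0) p)"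
    unfolding definable_def
    by (intro exI[of _ "subst_fm (\<lambda>_. Var 0) p"]) (simp add: sat_subst_fm with_params_def)
qed

lemma definable_bex_finite:
  assumes "finite Q" "\<And>p. p \<in> Q \<Longrightarrow> definable (P p)"
  shows "definable (\<lambda>e. \<exists>p\<in>Q. P p e)"
  using assms
proof (induction rule: finite_induct)
  case empty
  then show ?case using definable_const[of False] by simp
next
  case (insert q Q)
  then have "definable (\<lambda>e. P q e \<or> (\<exists>p\<in>Q. P p e))" by (intro definable_disj) auto
  then show ?case by simp
qed

text \<open>For finitely many formulae the truth of instances is arithmetical, being a finite
  disjunction, so \<open>comprehension\<close> codes it. By \<open>inst_code_eq\<close>, no code
  arises from a true and a false instance at once.\<close>

lemma finitely_approximable:
  assumes "finite Q" and Q: "\<And>p. p \<in> Q \<Longrightarrow> p \<in> formulas L_PA" "\<And>p. p \<in> Q \<Longrightarrow> fvb p \<le> 1"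
  shows "\<exists>x. \<forall>p\<in>Q. sat S (case_nat x (case_nat d e)) (Approx p)"
proof -
  have "\<exists>c. \<forall>p\<in>Q. \<forall>t. t \<sqsubset> d \<longrightarrow> inst_code 0 t p \<sqsubset> c"
    using assms(1)
  proof (induction rule: finite_induct)
    case (insert q Q)
    then obtain c where c: "\<And>p t. p \<in> Q \<Longrightarrow> t \<sqsubset> d \<Longrightarrow> inst_code 0 t p \<sqsubset> c" by blast
    \<comment> \<open>The new instances are bounded through \<open>inst_code_mono\<close>; adding
      \<open>\<one>\<close> below makes the bound strict.\<close>
    let ?c = "c \<oplus> inst_code 0 d q"
    have le: "c \<sqsubseteq> ?c" "inst_code 0 d q \<sqsubseteq> ?c" by (auto intro: R.add_increasing R.add_increasing2)
    have "inst_code 0 t p \<sqsubset> ?c \<oplus> \<one>" if "p \<in> insert q Q" "t \<sqsubset> d" for p t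
    proof -
      have "inst_code 0 t p \<sqsubseteq> c \<or> inst_code 0 t p \<sqsubseteq> inst_code 0 d q"
        using that c inst_code_mono[of t d 0 q] R.less_imp_le by blast
      then show ?thesis unfolding less_Suc_iff using le R.order.trans by blast
    qed
    then show ?case by blast
  qed simp
  then obtain c where c: "\<And>p t. p \<in> Q \<Longrightarrow> t \<sqsubset> d \<Longrightarrow> inst_code 0 t p \<sqsubset> c" by blast
  let ?X = "\<lambda>u. \<exists>t. t \<sqsubset> d \<and> (\<exists>p\<in>Q. u = inst_code 0 t p \<and> (\<exists>v. has_value t v \<and> sat S (\<lambda>_. v) p))"
  have "definable (\<lambda>e. ?X (e 0))"
    by (intro definable_intros definable_bex_finite assms(1) term_fun_inst_code definable_has_value
      definable_sat Q)
  then obtain a b where ab: "\<And>u. u \<sqsubset> c \<Longrightarrow> ?X u \<longleftrightarrow> divides ((u \<oplus> \<one>) \<otimes> b \<oplus> \<one>) a"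
    using comprehension[of ?X c] by blast
  have "sat S (case_nat (pair_val a b) (case_nat d e)) (Approx p)" if p: "p \<in> Q" for p
    unfolding sat_Approx[OF Q(2)[OF p]]
  proof (intro allI impI conjI)
    fix t assume t: "t \<sqsubset> d" "closed_term t"
    then show "\<exists>v. has_value t v" by (intro closed_term_has_value)
    fix v assume v: "has_value t v"
    have "(\<exists>a' b'. pair_val a b = pair_val a' b' \<and> divides ((inst_code 0 t p \<oplus> \<one>) \<otimes> b' \<oplus> \<one>) a') \<longleftrightarrow> ?X (inst_code 0 t p)"
      using ab[OF c[OF p t(1)]] by simp
    also have "\<dots> \<longleftrightarrow> sat S (\<lambda>_. v) p"
    proof
      assume "sat S (\<lambda>_. v) p"
      then show "?X (inst_code 0 t p)" using t v p by blast
    next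
      assume "?X (inst_code 0 t p)"
      then obtain t' p' v' where t': "p' \<in> Q" "inst_code 0 t p = inst_code 0 t' p'" "has_value t' v'"
        "sat S (\<lambda>_. v') p'" by blast
      have env: "sat S (\<lambda>_. w) q \<longleftrightarrow> sat S (\<lambda>i. if i = 0 then w else \<zero>) q" if "q \<in> Q" for q w
        using Q(2)[OF that] by (intro sat_cong) simp
      show "sat S (\<lambda>_. v) p"
        using inst_code_eq[OF v t'(3,2)] Q p t'(1,4) env by fastforce
    qed
    finally show "(\<exists>a' b'. pair_val a b = pair_val a' b' \<and> divides ((inst_code 0 t p \<oplus> \<one>) \<otimes> b' \<oplus> \<one>) a') \<longleftrightarrow>
      sat S (\<lambda>_. v) p" .
  qed
  then show ?thesis by blast
qed

end

section \<open>Computable functions\<close>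

text \<open>\<open>recursive_fun n f\<close> also fixes the values of \<open>f\<close> at lists of other lengths; \<open>computable\<close>
  abstracts from them.\<close>

definition computable :: "nat \<Rightarrow> (nat list \<Rightarrow> nat) \<Rightarrow> bool" where
  "computable n f \<longleftrightarrow> (\<exists>g. recursive_fun n g \<and> (\<forall>xs. length xs = n \<longrightarrow> g xs = f xs))"

lemma computableI: "recursive_fun n f \<Longrightarrow> computable n f"
  by (auto simp: computable_def)

lemma computable_cong:
  "computable n f \<Longrightarrow> (\<And>xs. length xs = n \<Longrightarrow> f xs = g xs) \<Longrightarrow> computable n g"
  by (auto simp: computable_def)

lemma computable_proj: "i < n \<Longrightarrow> computable n (\<lambda>xs. xs ! i)"
  by (intro computableI recursive_fun.proj)

lemma computable_comp:
  assumes "computable (length fs) G" "\<And>f. f \<in> set fs \<Longrightarrow> computable n f"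
  shows "computable n (\<lambda>xs. G (map (\<lambda>f. f xs) fs))"
proof -
  obtain g where g: "recursive_fun (length fs) g" "\<And>ys. length ys = length fs \<Longrightarrow> g ys = G ys"
    using assms(1) by (auto simp: computable_def)
  obtain h where h: "\<And>f. f \<in> set fs \<Longrightarrow> recursive_fun n (h f)"
    "\<And>f xs. f \<in> set fs \<Longrightarrow> length xs = n \<Longrightarrow> h f xs = f xs"
    using assms(2) unfolding computable_def by metis
  have "recursive_fun n (\<lambda>xs. g (map (\<lambda>h. h xs) (map h fs)))"
    by (rule recursive_fun.comp) (use g(1) h(1) in auto)
  then show ?thesis
  proof (rule computable_cong[OF computableI])
    fix xs :: "nat list" assume "length xs = n"
    then have "map (\<lambda>h. h xs) (map h fs) = map (\<lambda>f. f xs) fs" using h(2) by simp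
    then show "g (map (\<lambda>h. h xs) (map h fs)) = G (map (\<lambda>f. f xs) fs)"
      using g(2)[of "map (\<lambda>f. f xs) fs"] by (simp only: length_map)
  qed
qed

lemma computable_app1:
  "computable 1 (\<lambda>xs. F (xs ! 0)) \<Longrightarrow> computable n f \<Longrightarrow> computable n (\<lambda>xs. F (f xs))"
  using computable_comp[of "[f]" "\<lambda>xs. F (xs ! 0)" n] by simp

lemma computable_app2:
  "computable 2 (\<lambda>xs. F (xs ! 0) (xs ! 1)) \<Longrightarrow> computable n f \<Longrightarrow> computable n g \<Longrightarrow>
    computable n (\<lambda>xs. F (f xs) (g xs))"
  using computable_comp[of "[f, g]" "\<lambda>xs. F (xs ! 0) (xs ! 1)" n]
  by (simp add: numeral_2_eq_2) blast

lemma computable_app3: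
  "computable 3 (\<lambda>xs. F (xs ! 0) (xs ! 1) (xs ! 2)) \<Longrightarrow>
    computable n f \<Longrightarrow> computable n g \<Longrightarrow> computable n h \<Longrightarrow>
    computable n (\<lambda>xs. F (f xs) (g xs) (h xs))"
  using computable_comp[of "[f, g, h]" "\<lambda>xs. F (xs ! 0) (xs ! 1) (xs ! 2)" n]
  by (simp add: numeral_3_eq_3) blast

lemma computable_Suc: "computable n f \<Longrightarrow> computable n (\<lambda>xs. Suc (f xs))"
  by (rule computable_app1[OF computableI]) (rule recursive_fun.succ)

lemma computable_const: "computable n (\<lambda>xs. c)"
  by (induction c) (auto intro: computableI recursive_fun.zero computable_Suc)

text \<open>In the step function, the recursion index and the previous value precede the parameters.\<close>

lemma computable_rec:
  assumes "computable n b" "computable n l" "computable (Suc (Suc n)) (\<lambda>ys. s (ys ! 0) (ys ! 1) (drop 2 ys))"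
  shows "computable n (\<lambda>xs. rec_nat (b xs) (\<lambda>k r. s k r xs) (l xs))"
proof -
  obtain b' where b': "recursive_fun n b'" "\<And>xs. length xs = n \<Longrightarrow> b' xs = b xs"
    using assms(1) by (auto simp: computable_def)
  obtain s' where s': "recursive_fun (Suc (Suc n)) s'"
    "\<And>ys. length ys = Suc (Suc n) \<Longrightarrow> s' ys = s (ys ! 0) (ys ! 1) (drop 2 ys)"
    using assms(3) by (auto simp: computable_def)
  \<comment> \<open>The projections pass the parameter list on unchanged behind the recursion bound,
    in the form that \<open>prim_rec\<close> expects.\<close>
  have "computable (length (l # map (\<lambda>i xs. xs ! i) [0..<n]))
    (\<lambda>xs. rec_nat (b' (tl xs)) (\<lambda>k r. s' (k # r # tl xs)) (hd xs))"
    using recursive_fun.prim_rec[OF b'(1) s'(1)] by (auto intro: computableI)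
  then have "computable n (\<lambda>xs. (\<lambda>xs. rec_nat (b' (tl xs)) (\<lambda>k r. s' (k # r # tl xs)) (hd xs))
    (map (\<lambda>f. f xs) (l # map (\<lambda>i xs. xs ! i) [0..<n])))"
    by (rule computable_comp) (use assms(2) in \<open>auto intro: computable_proj\<close>)
  then show ?thesis
  proof (rule computable_cong)
    fix xs :: "nat list" assume xs: "length xs = n"
    then have "map (\<lambda>f. f xs) (l # map (\<lambda>i xs. xs ! i) [0..<n]) = l xs # xs"
      by (auto intro!: nth_equalityI)
    then show "(\<lambda>xs. rec_nat (b' (tl xs)) (\<lambda>k r. s' (k # r # tl xs)) (hd xs))
      (map (\<lambda>f. f xs) (l # map (\<lambda>i xs. xs ! i) [0..<n])) =
      rec_nat (b xs) (\<lambda>k r. s k r xs) (l xs)"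
      using xs b'(2) s'(2) by (simp add: numeral_2_eq_2)
  qed
qed

lemma computable_Least:
  assumes "computable (Suc n) g" "\<And>xs. length xs = n \<Longrightarrow> \<exists>y. g (y # xs) = 0"
  shows "computable n (\<lambda>xs. LEAST y. g (y # xs) = 0)"
proof -
  obtain g' where g': "recursive_fun (Suc n) g'" "\<And>xs. length xs = Suc n \<Longrightarrow> g' xs = g xs"
    using assms(1) by (auto simp: computable_def)
  have "recursive_fun n (\<lambda>xs. LEAST y. g' (y # xs) = 0)"
    by (rule recursive_fun.minim) (use g' assms(2) in auto)
  then show ?thesis by (rule computable_cong[OF computableI]) (simp add: g'(2))
qed

lemma computable_add:
  assumes "computable n f" "computable n g"
  shows "computable n (\<lambda>xs. f xs + g xs)"
proof (rule computable_app2[OF _ assms])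
  have "computable 2 (\<lambda>xs. rec_nat (xs ! 0) (\<lambda>k r. Suc r) (xs ! 1))"
    by (intro computable_rec[where s = "\<lambda>k r xs. Suc r"] computable_proj computable_Suc) auto
  moreover have "rec_nat a (\<lambda>k r. Suc r) b = a + b" for a b by (induction b) auto
  ultimately show "computable 2 (\<lambda>xs. xs ! 0 + xs ! 1)" by (simp only:)
qed

lemma computable_mult:
  assumes "computable n f" "computable n g"
  shows "computable n (\<lambda>xs. f xs * g xs)"
proof (rule computable_app2[OF _ assms])
  have "computable (Suc (Suc 2)) (\<lambda>ys. ys ! 1 + ys ! 2)"
    by (intro computable_add computable_proj) auto
  then have "computable (Suc (Suc 2)) (\<lambda>ys. ys ! 1 + drop 2 ys ! 0)"
    by (rule computable_cong) simp
  then have "computable 2 (\<lambda>xs. rec_nat 0 (\<lambda>k r. r + xs ! 0) (xs ! 1))"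
    by (intro computable_rec[where s = "\<lambda>k r xs. r + xs ! 0"] computable_proj computable_const) auto
  moreover have "rec_nat 0 (\<lambda>k r. r + a) b = a * b" for a b :: nat by (induction b) auto
  ultimately show "computable 2 (\<lambda>xs. xs ! 0 * xs ! 1)" by (simp only:)
qed

lemma computable_pred:
  assumes "computable n f"
  shows "computable n (\<lambda>xs. f xs - 1)"
proof (rule computable_app1[OF _ assms])
  have "computable 1 (\<lambda>xs. rec_nat 0 (\<lambda>k r. k) (xs ! 0))"
    by (intro computable_rec[where s = "\<lambda>k r xs. k"] computable_proj computable_const) auto
  moreover have "rec_nat 0 (\<lambda>k r. k) b = b - 1" for b :: nat by (cases b) auto
  ultimately show "computable 1 (\<lambda>xs. xs ! 0 - 1)" by (simp only:)
qed

lemma computable_diff: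
  assumes "computable n f" "computable n g"
  shows "computable n (\<lambda>xs. f xs - g xs)"
proof (rule computable_app2[OF _ assms])
  have "computable 2 (\<lambda>xs. rec_nat (xs ! 0) (\<lambda>k r. r - 1) (xs ! 1))"
    by (intro computable_rec[where s = "\<lambda>k r xs. r - 1"] computable_proj computable_pred) auto
  moreover have "rec_nat a (\<lambda>k r. r - 1) b = a - b" for a b :: nat by (induction b) auto
  ultimately show "computable 2 (\<lambda>xs. xs ! 0 - xs ! 1)" by (simp only:)
qed

lemma computable_if_0:
  assumes "computable n c" "computable n f" "computable n g"
  shows "computable n (\<lambda>xs. if c xs = 0 then f xs else g xs)"
proof (rule computable_app3[OF _ assms, of "\<lambda>c x y. if c = 0 then x else y"])
  have "computable (Suc (Suc 3)) (\<lambda>ys. drop 2 ys ! 2)"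
    by (rule computable_cong[OF computable_proj[of 4]]) auto
  then have "computable 3 (\<lambda>xs. rec_nat (xs ! 1) (\<lambda>k r. xs ! 2) (xs ! 0))"
    by (intro computable_rec[where s = "\<lambda>k r xs. xs ! 2"] computable_proj) auto
  moreover have "rec_nat a (\<lambda>k r. b) c = (if c = 0 then a else b)" for a b c :: nat
    by (cases c) auto
  ultimately show "computable 3 (\<lambda>xs. if xs ! 0 = 0 then xs ! 1 else xs ! 2)" by (simp only:)
qed

lemma computable_if_le:
  assumes "computable n a" "computable n b" "computable n f" "computable n g"
  shows "computable n (\<lambda>xs. if a xs \<le> b xs then f xs else g xs)"
  using computable_if_0[OF computable_diff[OF assms(1,2)] assms(3,4)] by (simp only: diff_is_0_eq)

lemma computable_if_eq:
  assumes "computable n a" "computable n b" "computable n f" "computable n g"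
  shows "computable n (\<lambda>xs. if a xs = b xs then f xs else g xs)"
proof -
  have "a xs - b xs + (b xs - a xs) = 0 \<longleftrightarrow> a xs = b xs" for xs by auto
  with computable_if_0[OF computable_add[OF computable_diff[OF assms(1,2)]
    computable_diff[OF assms(2,1)]] assms(3,4)] show ?thesis by (simp only:)
qed

lemma computable_opair:
  "computable n f \<Longrightarrow> computable n g \<Longrightarrow> computable n (\<lambda>xs. opair (f xs) (g xs))"
  unfolding opair_def by (intro computable_add computable_mult computable_const)

section \<open>Inverting the pairing function\<close>

definition isqrt :: "nat \<Rightarrow> nat" where "isqrt z = (LEAST s. z < Suc s * Suc s)"

text \<open>One less than \<open>opair a b\<close> is the square of \<open>a + b\<close> plus
  \<open>a\<close>, which is below the next square. So its integer root is \<open>a + b\<close> and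
  the remainder is \<open>a\<close>.\<close>

definition pfst :: "nat \<Rightarrow> nat" where "pfst z = (z - 1) - isqrt (z - 1) * isqrt (z - 1)"
definition psnd :: "nat \<Rightarrow> nat" where "psnd z = isqrt (z - 1) - pfst z"

lemma isqrt_eq:
  assumes "s * s \<le> z" "z < Suc s * Suc s"
  shows "isqrt z = s"
  unfolding isqrt_def
proof (rule Least_equality)
  fix y assume y: "z < Suc y * Suc y"
  show "s \<le> y"
  proof (rule ccontr)
    assume "\<not> s \<le> y"
    then have "Suc y * Suc y \<le> s * s" by (intro mult_le_mono) auto
    then show False using y assms(1) by linarith
  qed
qed fact

lemma isqrt_opair: "isqrt (opair a b - 1) = a + b"
  by (rule isqrt_eq) (auto simp: opair_def algebra_simps)

lemma pfst_opair [simp]: "pfst (opair a b) = a" and psnd_opair [simp]: "psnd (opair a b) = b"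
  unfolding psnd_def pfst_def isqrt_opair by (simp_all add: opair_def)

lemma isqrt_square_le: "isqrt z * isqrt z \<le> z"
proof (cases "isqrt z")
  case (Suc s)
  then have "\<not> z < Suc s * Suc s"
    using not_less_Least[of s "\<lambda>s. z < Suc s * Suc s"] by (simp add: isqrt_def)
  then show ?thesis using Suc by simp
qed simp

lemma pfst_less: "0 < z \<Longrightarrow> pfst z < z" and psnd_less: "0 < z \<Longrightarrow> psnd z < z"
proof -
  assume z: "0 < z"
  show "pfst z < z" using z by (simp add: pfst_def)
  have "isqrt (z - 1) \<le> isqrt (z - 1) * isqrt (z - 1)" by (rule le_square)
  then show "psnd z < z" using z isqrt_square_le[of "z - 1"] unfolding psnd_def by linarith
qed

lemma pfst_le: "pfst z \<le> z" and psnd_le: "psnd z \<le> z"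
proof -
  have "isqrt 0 = 0" by (rule isqrt_eq) auto
  then have "pfst 0 = 0" "psnd 0 = 0" by (simp_all add: pfst_def psnd_def)
  then show "pfst z \<le> z" "psnd z \<le> z"
    using pfst_less[of z] psnd_less[of z] by (cases "z = 0"; simp)+
qed

lemma computable_isqrt: "computable n f \<Longrightarrow> computable n (\<lambda>xs. isqrt (f xs))"
proof (rule computable_app1[where F = isqrt])
  \<comment> \<open>Truncated subtraction turns the strict inequality in \<open>isqrt\<close> into a
    test for zero, as minimisation requires.\<close>
  have "computable (Suc 1) (\<lambda>xs. Suc (xs ! 1) - Suc (xs ! 0) * Suc (xs ! 0))"
    by (intro computable_diff computable_mult computable_Suc computable_proj) auto
  then have "computable 1 (\<lambda>xs. LEAST y. Suc ((y # xs) ! 1) - Suc ((y # xs) ! 0) * Suc ((y # xs) ! 0) = 0)"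
  proof (rule computable_Least)
    show "\<exists>y. Suc ((y # xs) ! 1) - Suc ((y # xs) ! 0) * Suc ((y # xs) ! 0) = 0" for xs :: "nat list"
      by (rule exI[of _ "xs ! 0"]) simp
  qed
  then have "computable 1 (\<lambda>xs. LEAST y. Suc (xs ! 0) - Suc y * Suc y = 0)"
    by (simp only: nth_Cons_0 One_nat_def nth_Cons_Suc)
  moreover have "Suc z - Suc y * Suc y = 0 \<longleftrightarrow> z < Suc y * Suc y" for y z by linarith
  ultimately show "computable 1 (\<lambda>xs. isqrt (xs ! 0))" by (simp only: isqrt_def)
qed

lemma computable_pfst: "computable n f \<Longrightarrow> computable n (\<lambda>xs. pfst (f xs))"
  and computable_psnd: "computable n f \<Longrightarrow> computable n (\<lambda>xs. psnd (f xs))"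
  unfolding psnd_def pfst_def
  by (intro computable_diff computable_mult computable_isqrt computable_const; assumption)+

lemmas computable_intros = computable_const computable_opair computable_pfst computable_psnd
  computable_if_eq computable_if_le computable_diff

section \<open>Course-of-values recursion and decidable ranges\<close>

lemma computable_psnd_funpow:
  assumes "computable n f" "computable n g"
  shows "computable n (\<lambda>xs. (psnd ^^ f xs) (g xs))"
proof (rule computable_app2[OF _ assms, of "\<lambda>k x. (psnd ^^ k) x"])
  have "computable 2 (\<lambda>xs. rec_nat (xs ! 1) (\<lambda>k r. psnd r) (xs ! 0))"
    by (intro computable_rec[where s = "\<lambda>k r xs. psnd r"] computable_proj computable_psnd) auto
  moreover have "rec_nat a (\<lambda>k r. psnd r) b = (psnd ^^ b) a" for a b by (induction b) auto
  ultimately show "computable 2 (\<lambda>xs. (psnd ^^ (xs ! 0)) (xs ! 1))" by (simp only:)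
qed

text \<open>Primitive recursion carries the history along: \<open>hist n\<close> pairs
  \<open>f n\<close> with the history before it, so the value at \<open>j\<close> is found after
  \<open>n - j\<close> applications of \<open>psnd\<close>.\<close>

lemma computable_course_of_values:
  fixes f :: "nat \<Rightarrow> nat"
  assumes f: "\<And>n. 0 < n \<Longrightarrow> f n = H n (f (A n)) (f (B n))"
    and less: "\<And>n. 0 < n \<Longrightarrow> A n < n" "\<And>n. 0 < n \<Longrightarrow> B n < n"
    and H: "computable 3 (\<lambda>xs. H (xs ! 0) (xs ! 1) (xs ! 2))"
    and A: "computable 1 (\<lambda>xs. A (xs ! 0))" and B: "computable 1 (\<lambda>xs. B (xs ! 0))"
  shows "computable 1 (\<lambda>xs. f (xs ! 0))"
proof -
  define hist where "hist = rec_nat (opair (f 0) 0) (\<lambda>n r. opair (f (Suc n)) r)"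
  have hist: "hist 0 = opair (f 0) 0" "hist (Suc n) = opair (f (Suc n)) (hist n)" for n
    by (simp_all add: hist_def)
  have "(psnd ^^ k) (hist (j + k)) = hist j" for j k
    by (induction k) (simp_all add: hist funpow_swap1[of psnd])
  note funpow = this
  have look: "pfst ((psnd ^^ (n - j)) (hist n)) = f j" if "j \<le> n" for n j
  proof -
    have "(psnd ^^ (n - j)) (hist n) = hist j"
      using funpow[of "n - j" j] that by simp
    then show ?thesis by (cases j) (simp_all add: hist)
  qed
  let ?s = "\<lambda>n r. opair (H (Suc n) (pfst ((psnd ^^ (n - A (Suc n))) r))
    (pfst ((psnd ^^ (n - B (Suc n))) r))) r"
  have hist_rec: "hist n = rec_nat (opair (f 0) 0) ?s n" for n
  proof (induction n)
    case (Suc n)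
    have "A (Suc n) \<le> n" "B (Suc n) \<le> n" using less[of "Suc n"] by auto
    then have "?s n (hist n) = opair (f (Suc n)) (hist n)"
      using f[of "Suc n"] look by simp
    then show ?case using Suc hist by simp
  qed (simp add: hist)
  have "computable (Suc (Suc 1)) (\<lambda>ys. ?s (ys ! 0) (ys ! 1))"
    by (intro computable_intros computable_psnd_funpow computable_app3[OF H] computable_app1[OF A]
      computable_app1[OF B] computable_Suc computable_proj) auto
  then have "computable 1 (\<lambda>xs. rec_nat (opair (f 0) 0) ?s (xs ! 0))"
    by (intro computable_rec[where s = "\<lambda>n r xs. ?s n r"] computable_const computable_proj) auto
  then have "computable 1 (\<lambda>xs. hist (xs ! 0))" by (simp add: hist_rec)
  from computable_pfst[OF this] have "computable 1 (\<lambda>xs. pfst (hist (xs ! 0)))" .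
  moreover have "pfst (hist n) = f n" for n using look[of n n] by simp
  ultimately show ?thesis by simp
qed

text \<open>A preimage of \<open>k\<close> can only be found among the numbers up to
  \<open>k\<close>, so a bounded search decides the range.\<close>

lemma recursive_set_range:
  assumes "computable 1 (\<lambda>xs. f (xs ! 0))" "\<And>n. n \<le> f n"
  shows "recursive_set (range f)"
proof -
  let ?c = "\<lambda>k m. rec_nat (0::nat) (\<lambda>n r. if f n = k then 1 else r) m"
  have "computable (Suc (Suc 1)) (\<lambda>ys. if f (ys ! 0) = ys ! 2 then 1 else ys ! 1)"
    by (intro computable_intros computable_app1[OF assms(1)] computable_proj) auto
  then have "computable (Suc (Suc 1)) (\<lambda>ys. if f (ys ! 0) = drop 2 ys ! 0 then 1 else ys ! 1)"
    by (rule computable_cong) simp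
  then have "computable 1 (\<lambda>xs. ?c (xs ! 0) (Suc (xs ! 0)))"
    by (intro computable_rec[where s = "\<lambda>n r xs. if f n = xs ! 0 then 1 else r"]
      computable_const computable_Suc computable_proj) auto
  moreover have "?c k m = (if \<exists>n<m. f n = k then 1 else 0)" for k m
    by (induction m) (auto simp: less_Suc_eq)
  moreover have "(\<exists>n<Suc k. f n = k) \<longleftrightarrow> k \<in> range f" for k
    using assms(2) by (auto simp: less_Suc_eq_le)
  ultimately have "computable 1 (\<lambda>xs. if xs ! 0 \<in> range f then 1 else 0)" by (simp only:)
  then show ?thesis unfolding recursive_set_def computable_def by auto
qed

section \<open>A recursive enumeration of the type\<close>

type_synonym ('f, 'r) item = "nat \<times> 'f tm \<times> ('f, 'r) fm"

text \<open>An item \<open>(k, t, p)\<close> is a term and a formula below \<open>k\<close> quantifiers; the depth is recorded since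
  it determines which index \<open>Code_Inst k\<close> instantiates. Incompatible combinations yield the
  default item.\<close>

definition combine :: "nat \<Rightarrow> nat \<Rightarrow> nat \<Rightarrow> ('f, 'r) item \<Rightarrow> ('f, 'r) item \<Rightarrow> ('f, 'r) item" where
  "combine c a b x y = (case (x, y) of ((k, t, p), (k', t', p')) \<Rightarrow>
     if c = 0 then (a, if b \<le> a then Var b else Zero, Fls)
     else if c = 1 then (a, One, Fls)
     else if c = 2 then if k = 0 then (0, Zero, Fls) else (k - 1, Zero, Uni p)
     else if k = k' then
       if c = 3 then (k, Add t t', Fls)
       else if c = 4 then (k, Mul t t', Fls)
       else if c = 5 then (k, Zero, Eq t t')
       else if c = 6 then (k, Zero, Less t t')
       else (k, Zero, Imp p p')
     else (0, Zero, Fls))"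

text \<open>A number is read as a building instruction \<open>opair c (opair a b)\<close>, where
  \<open>a\<close> and \<open>b\<close> number the parts, or give depth and index at a leaf. Unlike
  in a search through Goedel numbers, every number yields a valid item and well-formedness never has
  to be decided.\<close>

function item :: "nat \<Rightarrow> ('f, 'r) item" where
  "item n = (if n = 0 then (0, Zero, Fls)
     else combine (pfst n) (pfst (psnd n)) (psnd (psnd n))
       (item (pfst (psnd n))) (item (psnd (psnd n))))"
  by auto
termination
  by (relation "measure id") (auto intro: le_less_trans[OF pfst_le psnd_less] le_less_trans[OF psnd_le psnd_less])

declare item.simps [simp del]

lemma item_opair: "item (opair c (opair a b)) = combine c a b (item a) (item b)"
proof -
  have "opair c (opair a b) \<noteq> 0" by (simp add: opair_def)
  then show ?thesis by (subst item.simps) simp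
qed

lemma item_valid:
  fixes p :: "('f, 'r) fm"
  shows "item n = (k, t, p) \<Longrightarrow> wf_tm {} t \<and> fvb_tm t \<le> Suc k \<and> p \<in> formulas L_PA \<and> fvb p \<le> Suc k"
proof (induction n arbitrary: k t p rule: less_induct)
  case (less n)
  show ?case
  proof (cases "n = 0")
    case True
    then show ?thesis using less.prems by (auto simp: item.simps)
  next
    case False
    let ?a = "pfst (psnd n)" and ?b = "psnd (psnd n)"
    have ab: "?a < n" "?b < n"
      using False pfst_le[of "psnd n"] psnd_le[of "psnd n"] psnd_less[of n] by auto
    obtain k1 k2 t1 t2 and p1 p2 :: "('f, 'r) fm"
      where x: "item ?a = (k1, t1, p1)" "item ?b = (k2, t2, p2)"
      by (metis prod_cases3)
    have "(k, t, p) = combine (pfst n) ?a ?b (k1, t1, p1) (k2, t2, p2)"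
      using less.prems False by (subst (asm) item.simps) (simp add: x)
    then show ?thesis
      using less.IH[OF ab(1) x(1)] less.IH[OF ab(2) x(2)]
      by (auto simp: combine_def split: if_splits)
  qed
qed

lemma item_surj_tm:
  "wf_tm {} t \<Longrightarrow> fvb_tm t \<le> Suc k \<Longrightarrow> \<exists>n p. item n = (k, t, p :: ('f, 'r) fm)"
proof (induction t)
  case (Var i)
  then show ?case
    by (intro exI[of _ "opair 0 (opair k i)"]) (simp add: item_opair combine_def split: prod.split)
next
  case Zero
  show ?case
    \<comment> \<open>An index above the depth makes the instruction for variables yield
      \<open>Zero\<close>.\<close>
    by (intro exI[of _ "opair 0 (opair k (Suc k))"])
      (simp add: item_opair combine_def split: prod.split)
next
  case One
  show ?case
    by (intro exI[of _ "opair 1 (opair k 0)"]) (simp add: item_opair combine_def split: prod.split)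
next
  case (Add s t)
  then have "\<exists>n p. item n = (k, s, p :: ('f, 'r) fm)" "\<exists>n p. item n = (k, t, p :: ('f, 'r) fm)"
    by auto
  then obtain m n and p q :: "('f, 'r) fm" where "item m = (k, s, p)" "item n = (k, t, q)"
    by blast
  then show ?case
    by (intro exI[of _ "opair 3 (opair m n)"]) (simp add: item_opair combine_def)
next
  case (Mul s t)
  then have "\<exists>n p. item n = (k, s, p :: ('f, 'r) fm)" "\<exists>n p. item n = (k, t, p :: ('f, 'r) fm)"
    by auto
  then obtain m n and p q :: "('f, 'r) fm" where "item m = (k, s, p)" "item n = (k, t, q)"
    by blast
  then show ?case
    by (intro exI[of _ "opair 4 (opair m n)"]) (simp add: item_opair combine_def)
qed simp

lemma item_surj_fm:
  fixes p :: "('f, 'r) fm"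
  shows "p \<in> formulas L_PA \<Longrightarrow> fvb p \<le> Suc k \<Longrightarrow> \<exists>n t. item n = (k, t, p)"
proof (induction p arbitrary: k)
  case Fls
  show ?case
    by (intro exI[of _ "opair 1 (opair k 0)"]) (simp add: item_opair combine_def split: prod.split)
next
  case (Eq s t)
  then obtain m n and p q :: "('f, 'r) fm" where "item m = (k, s, p)" "item n = (k, t, q)"
    using item_surj_tm[of s k] item_surj_tm[of t k] by auto
  then show ?case
    by (intro exI[of _ "opair 5 (opair m n)"]) (simp add: item_opair combine_def)
next
  case (Less s t)
  then obtain m n and p q :: "('f, 'r) fm" where "item m = (k, s, p)" "item n = (k, t, q)"
    using item_surj_tm[of s k] item_surj_tm[of t k] by auto
  then show ?case
    by (intro exI[of _ "opair 6 (opair m n)"]) (simp add: item_opair combine_def)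
next
  case (Imp p q)
  then have "\<exists>n t. item n = (k, t, p)" "\<exists>n t. item n = (k, t, q)" by simp_all
  then obtain m s n t where "item m = (k, s, p)" "item n = (k, t, q)" by blast
  then show ?case
    by (intro exI[of _ "opair 7 (opair m n)"]) (simp add: item_opair combine_def)
next
  case (Uni p)
  then have "\<exists>n t. item n = (Suc k, t, p)" by (simp add: le_diff_conv)
  then obtain m t where "item m = (Suc k, t, p)" by blast
  then show ?case
    by (intro exI[of _ "opair 2 (opair m 0)"]) (simp add: item_opair combine_def split: prod.split)
qed simp

text \<open>Not the pairing itself but its effect on syntax: from the codes of two terms it computes
  the code of the term denoting their pair. \<open>Approx\<close> contains such terms, as it speaks
  about codes.\<close>

definition code_Opair :: "nat \<Rightarrow> nat \<Rightarrow> nat" where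
  "code_Opair a b = (let s = opair 3 (opair a b) in
     opair 3 (opair (opair 3 (opair (opair 4 (opair s s)) a)) (opair 2 0)))"

lemma code_tm_Opair: "code_tm (Opair s t) = code_Opair (code_tm s) (code_tm t)"
  by (simp add: Opair_def code_Opair_def Let_def)

definition code_num :: "nat \<Rightarrow> nat" where
  "code_num = rec_nat (opair 1 0) (\<lambda>k r. opair 3 (opair r (opair 2 0)))"

lemma code_tm_num: "code_tm (num n) = code_num n"
  by (induction n) (simp_all add: code_num_def)

lemma computable_code_Opair:
  "computable n f \<Longrightarrow> computable n g \<Longrightarrow> computable n (\<lambda>xs. code_Opair (f xs) (g xs))"
  unfolding code_Opair_def Let_def by (intro computable_intros)

lemma computable_code_num: "computable n f \<Longrightarrow> computable n (\<lambda>xs. code_num (f xs))"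
proof (rule computable_app1[where F = code_num])
  have "computable 1 (\<lambda>xs. rec_nat (opair 1 0) (\<lambda>k r. opair 3 (opair r (opair 2 0))) (xs ! 0))"
    by (intro computable_rec[where s = "\<lambda>k r xs. opair 3 (opair r (opair 2 0))"]
      computable_intros computable_proj) auto
  then show "computable 1 (\<lambda>xs. code_num (xs ! 0))" by (simp only: code_num_def)
qed

text \<open>\<open>Approx p\<close> contains both \<open>p\<close> and the term that denotes the
  code of its instance, so the codes of both are computed in parallel, for terms and for
  formulae.\<close>

definition encode_parts :: "nat \<Rightarrow> nat \<Rightarrow> nat \<Rightarrow> nat \<Rightarrow> nat \<Rightarrow> nat" where
  "encode_parts k t t' p p' = opair k (opair (opair t t') (opair p p'))"

text \<open>\<open>Var 4\<close> is the argument at which \<open>Approx\<close> uses \<open>Code_Inst\<close>.\<close>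

definition encode :: "('f, 'r) item \<Rightarrow> nat" where
  "encode x = (case x of (k, t, p) \<Rightarrow>
     encode_parts k (code_tm t) (code_tm (Code_Inst_tm k (Var 4) t :: 'f tm)) (code p) (code_tm (Code_Inst k (Var 4) p :: 'f tm)))"

definition "depth x = pfst x"
definition "tm_part x = pfst (pfst (psnd x))"
definition "tm_inst_part x = psnd (pfst (psnd x))"
definition "fm_part x = pfst (psnd (psnd x))"
definition "fm_inst_part x = psnd (psnd (psnd x))"

lemma unpack [simp]:
  "depth (encode_parts k t t' p p') = k" "tm_part (encode_parts k t t' p p') = t" "tm_inst_part (encode_parts k t t' p p') = t'"
  "fm_part (encode_parts k t t' p p') = p" "fm_inst_part (encode_parts k t t' p p') = p'"
  by (simp_all add: depth_def tm_part_def tm_inst_part_def fm_part_def fm_inst_part_def encode_parts_def)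

text \<open>The counterpart of \<open>combine\<close> on codes. At a leaf, \<open>b = a\<close> is
  the index to be replaced, by \<open>Var 4\<close> with code \<open>opair 0 4\<close>; smaller
  indices are kept, and larger ones do not arise.\<close>

definition combine_codes :: "nat \<Rightarrow> nat \<Rightarrow> nat \<Rightarrow> nat \<Rightarrow> nat \<Rightarrow> nat" where
  "combine_codes c a b x y =
    (let Z = opair 1 0; Z' = code_Opair (code_num 1) (code_num 0); U = opair 2 0;
         U' = code_Opair (code_num 2) (code_num 0); F = opair 0 0; F' = code_Opair (code_num 0) (code_num 0);
         k = depth x in
     if c = 0 then encode_parts a (if b \<le> a then opair 0 b else Z)
       (if b \<le> a then if b = a then opair 0 4 else code_Opair (code_num 0) (code_num b) else Z') F F'
     else if c = 1 then encode_parts a U U' F F'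
     else if c = 2 then if k = 0 then encode_parts 0 Z Z' F F'
       else encode_parts (k - 1) Z Z' (opair 4 (fm_part x)) (code_Opair (code_num 4) (fm_inst_part x))
     else if k = depth y then
       if c = 3 then encode_parts k (opair 3 (opair (tm_part x) (tm_part y)))
         (code_Opair (code_num 3) (code_Opair (tm_inst_part x) (tm_inst_part y))) F F'
       else if c = 4 then encode_parts k (opair 4 (opair (tm_part x) (tm_part y)))
         (code_Opair (code_num 4) (code_Opair (tm_inst_part x) (tm_inst_part y))) F F'
       else if c = 5 then encode_parts k Z Z' (opair 1 (opair (tm_part x) (tm_part y)))
         (code_Opair (code_num 1) (code_Opair (tm_inst_part x) (tm_inst_part y)))
       else if c = 6 then encode_parts k Z Z' (opair 2 (opair (tm_part x) (tm_part y)))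
         (code_Opair (code_num 2) (code_Opair (tm_inst_part x) (tm_inst_part y)))
       else encode_parts k Z Z' (opair 3 (opair (fm_part x) (fm_part y)))
         (code_Opair (code_num 3) (code_Opair (fm_inst_part x) (fm_inst_part y)))
     else encode_parts 0 Z Z' F F')"

lemma encode_combine: "encode (combine c a b x y) = combine_codes c a b (encode x) (encode y)"
proof (cases x, cases y)
  fix k t p k' t' p' assume xy: "x = (k, t, p)" "y = (k', t', p')"
  show ?thesis
    unfolding xy
    by (auto simp: combine_def combine_codes_def encode_def Let_def code_tm_Opair code_tm_num Code_Zero_def Code_One_def
      Code_Add_def Code_Mul_def simp del: num.simps One_nat_def)
qed

lemma computable_combine_codes:
  assumes "computable n c" "computable n a" "computable n b" "computable n x" "computable n y"
  shows "computable n (\<lambda>xs. combine_codes (c xs) (a xs) (b xs) (x xs) (y xs))"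
  unfolding combine_codes_def Let_def encode_parts_def depth_def tm_part_def tm_inst_part_def fm_part_def fm_inst_part_def
  by (intro computable_if_eq computable_if_le computable_const computable_opair computable_code_Opair
    computable_code_num computable_pfst computable_psnd computable_diff assms)

lemma computable_encode_item: "computable 1 (\<lambda>xs. encode (item (xs ! 0) :: ('f, 'r) item))"
proof (rule computable_course_of_values[where f = "\<lambda>n. encode (item n :: ('f, 'r) item)"])
  show "encode (item n :: ('f, 'r) item) = combine_codes (pfst n) (pfst (psnd n)) (psnd (psnd n))
    (encode (item (pfst (psnd n)) :: ('f, 'r) item)) (encode (item (psnd (psnd n)) :: ('f, 'r) item))" if "0 < n" for n
    using that by (subst item.simps) (simp add: encode_combine)
  show "pfst (psnd n) < n" "psnd (psnd n) < n" if "0 < n" for n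
    using that pfst_le[of "psnd n"] psnd_le[of "psnd n"] psnd_less[of n] by auto
  show "computable 3 (\<lambda>xs. combine_codes (pfst (xs ! 0)) (pfst (psnd (xs ! 0))) (psnd (psnd (xs ! 0)))
    (xs ! 1) (xs ! 2))"
    by (intro computable_combine_codes computable_pfst computable_psnd computable_proj) auto
  show "computable 1 (\<lambda>xs. pfst (psnd (xs ! 0)))" "computable 1 (\<lambda>xs. psnd (psnd (xs ! 0)))"
    by (intro computable_pfst computable_psnd computable_proj; simp)+
qed

definition nth_formula :: "nat \<Rightarrow> ('f, 'r) fm" where
  "nth_formula n = (case item n of (k, t, p) \<Rightarrow> if k = 0 then p else Fls)"

lemma range_nth_formula: "range nth_formula = {p \<in> formulas L_PA. fvb p \<le> 1}"
proof (intro equalityI subsetI)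
  fix p :: "('f, 'r) fm" assume "p \<in> range nth_formula"
  then obtain n where "p = nth_formula n" ..
  then show "p \<in> {p \<in> formulas L_PA. fvb p \<le> 1}"
    using item_valid[of n] by (auto simp: nth_formula_def split: prod.splits if_splits)
next
  fix p :: "('f, 'r) fm" assume "p \<in> {p \<in> formulas L_PA. fvb p \<le> 1}"
  then obtain n t where "item n = (0, t, p)" using item_surj_fm[of p 0] by auto
  then have "nth_formula n = p" by (simp add: nth_formula_def)
  then show "p \<in> range nth_formula" by blast
qed

text \<open>The antecedent makes the code of the formula exceed \<open>n\<close>, so that the set of all these
  codes is decidable.\<close>

definition padded_Approx :: "nat \<Rightarrow> ('f, 'r) fm" where
  "padded_Approx n = Imp (Eq (num n) (num n)) (Approx (nth_formula n))"

lemma recursive_Approx: "recursive_set (code ` range (padded_Approx :: nat \<Rightarrow> ('f, 'r) fm))"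
proof -
  let ?p = "nth_formula :: nat \<Rightarrow> ('f, 'r) fm"
  let ?x = "\<lambda>n. encode (item n :: ('f, 'r) item)"
  have code_p: "code (?p n) = (if depth (?x n) = 0 then fm_part (?x n) else opair 0 0)" for n
    by (simp add: nth_formula_def encode_def split: prod.split)
  have code_ip: "code_tm (Code_Inst 0 (Var 4) (?p n) :: 'f tm) =
    (if depth (?x n) = 0 then fm_inst_part (?x n) else code_Opair (code_num 0) (code_num 0))" for n
    by (simp add: nth_formula_def encode_def code_tm_Opair code_tm_num split: prod.split del: num.simps)
  have p: "computable 1 (\<lambda>xs. code (?p (xs ! 0)))"
    unfolding code_p depth_def fm_part_def
    by (intro computable_intros computable_encode_item)
  have ip: "computable 1 (\<lambda>xs. code_tm (Code_Inst 0 (Var 4) (?p (xs ! 0)) :: 'f tm))"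
    unfolding code_ip depth_def fm_inst_part_def
    by (intro computable_intros computable_encode_item)
  \<comment> \<open>\<open>Closed_Term\<close> and \<open>Value\<close> contribute constants; only
    the padding, the formula and the term for its instance vary with the index.\<close>
  have "computable 1 (\<lambda>xs. code (padded_Approx (xs ! 0) :: ('f, 'r) fm))"
    unfolding padded_Approx_def Approx_def Code_In_def code.simps code_tm.simps code_tm_num
    by (intro computable_opair computable_const computable_code_num computable_proj p ip) auto
  moreover have "n \<le> code (padded_Approx n :: ('f, 'r) fm)" for n
  proof -
    have pair_val: "a < opair a b" "b < opair a b" for a b
      using le_square[of "a + b"] unfolding opair_def by linarith+
    have "n \<le> code_num n"
    proof (induction n)
      case (Suc n)
      have "code_num (Suc n) = opair 3 (opair (code_num n) (opair 2 0))" by (simp add: code_num_def)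
      then show ?case
        using Suc pair_val(1)[of "code_num n" "opair 2 0"] pair_val(2)[of "opair (code_num n) (opair 2 0)" 3] by linarith
    qed simp
    then show ?thesis
      unfolding padded_Approx_def code.simps code_tm_num
      using pair_val by (meson le_less_trans less_imp_le_nat less_trans)
  qed
  ultimately have "recursive_set (range (\<lambda>n. code (padded_Approx n :: ('f, 'r) fm)))"
    by (rule recursive_set_range)
  then show ?thesis by (simp add: image_image)
qed

section \<open>Transfer\<close>

lemma sat_cong1: "fvb p \<le> 1 \<Longrightarrow> e 0 = e' 0 \<Longrightarrow> sat M e p \<longleftrightarrow> sat M e' p"
  by (rule sat_cong) (metis One_nat_def less_Suc0 order.strict_trans2)

lemma sat_cong2:
  assumes "fvb p \<le> 2" "e 0 = e' 0" "e 1 = e' 1"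
  shows "sat M e p \<longleftrightarrow> sat M e' p"
proof (rule sat_cong)
  fix i assume "i < fvb p"
  then have "i = 0 \<or> i = 1" using assms(1) by auto
  then show "e i = e' i" using assms by auto
qed

lemma univ_close_formulas_L_PA: "univ_close p \<in> formulas L_PA \<longleftrightarrow> p \<in> formulas L_PA"
proof -
  have "(Uni ^^ k) p \<in> formulas L_PA \<longleftrightarrow> p \<in> formulas L_PA" for k by (induction k) auto
  then show ?thesis by (simp add: univ_close_def)
qed

lemma PA_unbounded_struct:
  assumes "countable_lang L" "is_struct L M"
    and PA: "\<And>p e. p \<in> PA_minus \<Longrightarrow> e \<in> assignments M \<Longrightarrow> sat M e p"
  shows "unbounded_struct L M"
proof
  fix m m' assume "m \<in> carr M" "m' \<in> carr M"
  then show "\<exists>m''\<in>carr M. \<forall>x\<in>carr M. iless M m'' x \<longrightarrow> iless M m x \<and> iless M m' x"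
    using PA_less_linear[OF PA, of m m'] PA_less_trans[OF PA] by blast
next
  fix m assume m: "m \<in> carr M"
  have c: "izero M \<in> carr M" "ione M \<in> carr M" using assms(2) by (auto simp: is_struct_def)
  then have "iless M (iadd M (izero M) m) (iadd M (ione M) m)"
    using PA_add_mono[OF PA c m] PA_zero_less_one[OF PA c m] by blast
  moreover have "iadd M (izero M) m = m"
    using PA_add_commute[OF PA m c(1) m] PA_add_0[OF PA m m m] by metis
  moreover have "iadd M (ione M) m \<in> carr M" using c m assms(2) by (auto simp: is_struct_def)
  ultimately show "\<exists>x\<in>carr M. iless M m x" by auto
qed fact+

text \<open>By directedness and unboundedness every finite subset has a strict upper bound; a finite
  carrier would thus have an element above itself.\<close>

lemma PA_infinite:
  assumes "is_struct L M"
    and PA: "\<And>p e. p \<in> PA_minus \<Longrightarrow> e \<in> assignments M \<Longrightarrow> sat M e p"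
  shows "infinite (carr M)"
proof
  assume fin: "finite (carr M)"
  have "carr M \<noteq> {}" using assms(1) by (auto simp: is_struct_def)
  interpret unbounded_struct "({}, {})" M
    by (rule PA_unbounded_struct[OF _ _ PA])
      (use assms(1) in \<open>auto simp: countable_lang_def is_struct_def\<close>)
  have "\<exists>x\<in>carr M. \<forall>y\<in>A. iless M y x" if "finite A" "A \<subseteq> carr M" for A
    using that
  proof (induction rule: finite_induct)
    case empty
    then show ?case using \<open>carr M \<noteq> {}\<close> by auto
  next
    case (insert a A)
    then obtain x where x: "x \<in> carr M" "\<forall>y\<in>A. iless M y x" by auto
    obtain m where m: "m \<in> carr M" "\<forall>z\<in>carr M. iless M m z \<longrightarrow> iless M x z \<and> iless M a z"
      using directed x(1) insert.prems by blast
    obtain z where z: "z \<in> carr M" "iless M m z" using unbounded m(1) by blast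
    have "iless M y z" if "y \<in> A" for y
      using PA_less_trans[OF PA, of y x z] x m(2) z insert.prems that by blast
    then show ?case using m(2) z by blast
  qed
  from this[OF fin] show False using PA_less_irrefl[OF PA] by blast
qed

text \<open>The least index equal to \<open>i\<close> according to \<open>\<Gamma>\<close> is a
  canonical name for its class, which gives an enumeration with the kernel that
  \<open>henkin_model\<close> expects.\<close>

lemma henkin_kernel:
  assumes "henkin L M \<Gamma>"
  shows "(LEAST k. Eq (Var i) (Var k) \<in> \<Gamma>) = (LEAST k. Eq (Var j) (Var k) \<in> \<Gamma>) \<longleftrightarrow>
    Eq (Var i) (Var j) \<in> \<Gamma>"
proof -
  have closed: "finite \<Delta> \<Longrightarrow> \<Delta> \<subseteq> \<Gamma> \<Longrightarrow> p \<in> formulas L \<Longrightarrow> entails M \<Delta> p \<Longrightarrow> p \<in> \<Gamma>" for \<Delta> p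
    using assms unfolding henkin_def by blast
  have refl: "Eq (Var i) (Var i) \<in> \<Gamma>" for i
    by (rule closed[of "{}"]) (auto simp: entails_def formulas_def)
  have trans: "Eq (Var j) (Var k) \<in> \<Gamma>" if "Eq (Var i) (Var j) \<in> \<Gamma>" "Eq (Var i) (Var k) \<in> \<Gamma>" for i j k
    by (rule closed[of "{Eq (Var i) (Var j), Eq (Var i) (Var k)}"])
      (use that in \<open>auto simp: entails_def formulas_def\<close>)
  have least: "Eq (Var i) (Var (LEAST k. Eq (Var i) (Var k) \<in> \<Gamma>)) \<in> \<Gamma>" for i
    by (rule LeastI[of "\<lambda>k. Eq (Var i) (Var k) \<in> \<Gamma>", OF refl])
  show ?thesis
  proof
    assume "(LEAST k. Eq (Var i) (Var k) \<in> \<Gamma>) = (LEAST k. Eq (Var j) (Var k) \<in> \<Gamma>)"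
    then have "Eq (Var j) (Var (LEAST k. Eq (Var i) (Var k) \<in> \<Gamma>)) \<in> \<Gamma>" using least[of j] by simp
    then show "Eq (Var i) (Var j) \<in> \<Gamma>" using least[of i] trans refl by blast
  next
    assume "Eq (Var i) (Var j) \<in> \<Gamma>"
    then have "Eq (Var i) (Var k) \<in> \<Gamma> \<longleftrightarrow> Eq (Var j) (Var k) \<in> \<Gamma>" for k
      using trans refl by blast
    then show "(LEAST k. Eq (Var i) (Var k) \<in> \<Gamma>) = (LEAST k. Eq (Var j) (Var k) \<in> \<Gamma>)" by simp
  qed
qed

lemma henkin_transfer:
  assumes henkin: "henkin L M \<Gamma>" and N: "carr N = range q"
    "\<And>p \<rho>. p \<in> formulas L \<Longrightarrow> sat N (\<lambda>i. q (\<rho> i)) p \<longleftrightarrow> subst_fm (\<lambda>i. Var (\<rho> i)) p \<in> \<Gamma>"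
    and p: "p \<in> formulas L" "\<And>e. e \<in> assignments M \<Longrightarrow> sat M e p"
    and e: "e \<in> assignments N"
  shows "sat N e p"
proof -
  have "\<forall>i. \<exists>j. e i = q j" using e N(1) by (auto simp: assignments_def)
  then obtain \<rho> where \<rho>: "\<And>i. e i = q (\<rho> i)" by metis
  have "subst_fm (\<lambda>i. Var (\<rho> i)) p \<in> formulas L"
    using p(1) by (auto simp: formulas_def intro!: wf_subst_fm)
  moreover have "entails M {} (subst_fm (\<lambda>i. Var (\<rho> i)) p)"
    using p(2) by (auto simp: entails_def sat_subst_fm assignments_def image_subset_iff)
  ultimately have "subst_fm (\<lambda>i. Var (\<rho> i)) p \<in> \<Gamma>"
    using henkin unfolding henkin_def by blast
  moreover have "e = (\<lambda>i. q (\<rho> i))" using \<rho> by blast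
  ultimately show ?thesis using N(2)[OF p(1), of \<rho>] by simp
qed

text \<open>\<open>M\<close> is elementarily equivalent to a term model whose carrier is the whole type \<open>nat\<close>.\<close>

lemma PA_transfer:
  fixes M :: "('f, 'r, 'm) struct"
  assumes L: "countable_lang L" "is_struct L M"
    and PA: "\<And>p e. p \<in> PA \<Longrightarrow> e \<in> assignments M \<Longrightarrow> sat M e p"
    and p: "p \<in> formulas L_PA" "\<And>S :: ('f, 'r, nat) struct. \<And>e. pa S \<Longrightarrow> sat S e p"
    and e: "e \<in> assignments M"
  shows "sat M e p"
proof -
  have PA_minus: "q \<in> PA_minus \<Longrightarrow> e \<in> assignments M \<Longrightarrow> sat M e q" for q e
    using PA by (simp add: Defs.PA_def)
  interpret unbounded_struct L M using PA_unbounded_struct[OF L PA_minus] .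
  have PA_formulas: "PA \<subseteq> (formulas L :: ('f, 'r) fm set)"
  proof -
    have "PA_minus \<subseteq> (formulas L_PA :: ('f, 'r) fm set)"
      by (auto simp: PA_minus_def Let_def univ_close_formulas_L_PA)
    moreover have "induction_axiom q \<in> formulas L_PA" if "q \<in> formulas L_PA" for q :: "('f, 'r) fm"
      using that unfolding induction_axiom_def univ_close_formulas_L_PA formulas_L_PA
      by (auto simp: formulas_def intro!: wf_subst_fm split: nat.split)
    ultimately show ?thesis
      using formulas_L_PA_subset[of L] by (auto simp: Defs.PA_def)
  qed
  \<comment> \<open>No type is to be omitted here, so the dense sets are trivial.\<close>
  obtain \<Gamma> where \<Gamma>: "henkin L M \<Gamma>"
    using henkin_exists[of "\<lambda>_. {Neg Fls}"] by (auto simp: formulas_def unbounded_sat_def)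
  define q where "q i = (LEAST k. Eq (Var i) (Var k) \<in> \<Gamma>)" for i :: nat
  have q: "q i = q j \<longleftrightarrow> Eq (Var i) (Var j) \<in> \<Gamma>" for i j
    unfolding q_def by (rule henkin_kernel[OF \<Gamma>])
  obtain N :: "('f, 'r, nat) struct" where N: "carr N = range q" "is_struct L N"
    "\<And>p \<rho>. p \<in> formulas L \<Longrightarrow> sat N (\<lambda>i. q (\<rho> i)) p \<longleftrightarrow> subst_fm (\<lambda>i. Var (\<rho> i)) p \<in> \<Gamma>"
    using henkin_model[OF \<Gamma> L(2) q] by blast
  \<comment> \<open>The first term model serves to show that there are infinitely many classes of
    variables; they can then be renumbered so as to exhaust \<open>nat\<close>.\<close>
  have "infinite (range q)"
    using PA_infinite[OF N(2)] henkin_transfer[OF \<Gamma> N(1,3)] PA PA_formulas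
    unfolding N(1) Defs.PA_def by blast
  then have h: "bij_betw (to_nat_on (range q)) (range q) UNIV"
    by (intro to_nat_on_infinite) auto
  define q' where "q' i = to_nat_on (range q) (q i)" for i
  have q': "q' i = q' j \<longleftrightarrow> Eq (Var i) (Var j) \<in> \<Gamma>" for i j
    using inj_on_eq_iff[OF bij_betw_imp_inj_on[OF h] rangeI rangeI] q by (simp add: q'_def)
  have range_q': "range q' = UNIV"
    using bij_betw_imp_surj_on[OF h] by (simp add: q'_def[abs_def] image_image)
  obtain S :: "('f, 'r, nat) struct" where S: "carr S = range q'"
    "\<And>p \<rho>. p \<in> formulas L \<Longrightarrow> sat S (\<lambda>i. q' (\<rho> i)) p \<longleftrightarrow> subst_fm (\<lambda>i. Var (\<rho> i)) p \<in> \<Gamma>"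
    using henkin_model[OF \<Gamma> L(2) q'] by blast
  have S_PA: "pa S"
  proof
    show "carr S = UNIV" using S(1) range_q' by simp
    then show "sat S e p" if "p \<in> PA" for p e
      using henkin_transfer[OF \<Gamma> S] PA PA_formulas that by (auto simp: assignments_def)
  qed
  have closed: "Neg (univ_close p) \<in> formulas L"
    using univ_close_formulas_L_PA[of p] p(1) formulas_L_PA_subset[of L] by (auto simp: formulas_def)
  show ?thesis
  proof (rule ccontr)
    assume "\<not> sat M e p"
    \<comment> \<open>A failure under one assignment refutes the universal closure under all of
      them, and this negated closure passes to \<open>S\<close>.\<close>
    then have "sat M e' (Neg (univ_close p))" if "e' \<in> assignments M" for e'
      using sat_univ_close[OF that, of p] e by auto
    from henkin_transfer[OF \<Gamma> S closed this]
    have "\<not> sat S e' (univ_close p)" for e'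
      using S(1) range_q' by (auto simp: assignments_def)
    moreover have "e' \<in> assignments S" for e' using S(1) range_q' by (auto simp: assignments_def)
    ultimately show False using p(2)[OF S_PA] sat_univ_close by blast
  qed
qed

section \<open>Well-formedness and free indices of the arithmetised syntax\<close>

lemma wf_Closed_Term: "Closed_Term \<in> formulas L_PA" and wf_Value: "Value \<in> formulas L_PA"
  by (auto simp: Closed_Term_def Value_def Mem_def wf_Codes wf_Opair wf_subst_tm)

lemma wf_Approx: "p \<in> formulas L_PA \<Longrightarrow> Approx p \<in> formulas L_PA"
  by (simp add: Approx_def Code_In_def wf_Closed_Term wf_Value wf_Opair wf_Code_Inst)

lemma fvb_tm_le:
  "fvb_tm (Var i) \<le> k \<longleftrightarrow> i < k" "fvb_tm Zero \<le> k" "fvb_tm One \<le> k"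
  "fvb_tm (Add s t) \<le> k \<longleftrightarrow> fvb_tm s \<le> k \<and> fvb_tm t \<le> k"
  "fvb_tm (Mul s t) \<le> k \<longleftrightarrow> fvb_tm s \<le> k \<and> fvb_tm t \<le> k"
  "fvb_tm (Opair s t) \<le> k \<longleftrightarrow> fvb_tm s \<le> k \<and> fvb_tm t \<le> k"
  "fvb_tm (num n) \<le> k"
  by (auto simp: Opair_def Suc_le_eq) (induction n; simp)

lemma fvb_Codes_le:
  "fvb_tm Code_Zero \<le> k" "fvb_tm Code_One \<le> k"
  "fvb_tm (Code_Add s t) \<le> k \<longleftrightarrow> fvb_tm s \<le> k \<and> fvb_tm t \<le> k"
  "fvb_tm (Code_Mul s t) \<le> k \<longleftrightarrow> fvb_tm s \<le> k \<and> fvb_tm t \<le> k"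
  by (simp_all only: Code_Zero_def Code_One_def Code_Add_def Code_Mul_def fvb_tm_le simp_thms)

lemma fvb_lift_tm: "fvb_tm (lift_tm t) \<le> Suc k \<longleftrightarrow> fvb_tm t \<le> k"
  by (induction t) (auto simp: foldr_max_le)

lemma fvb_le:
  "fvb Fls \<le> k"
  "fvb (Eq s t) \<le> k \<longleftrightarrow> fvb_tm s \<le> k \<and> fvb_tm t \<le> k"
  "fvb (Less s t) \<le> k \<longleftrightarrow> fvb_tm s \<le> k \<and> fvb_tm t \<le> k"
  "fvb (Imp p q) \<le> k \<longleftrightarrow> fvb p \<le> k \<and> fvb q \<le> k"
  "fvb (Uni p) \<le> k \<longleftrightarrow> fvb p \<le> Suc k"
  by auto

lemma fvb_Mem_le:
  "fvb (Mem u a b c) \<le> k \<longleftrightarrow> fvb_tm u \<le> k \<and> fvb_tm a \<le> k \<and> fvb_tm b \<le> k \<and> fvb_tm c \<le> k"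
  unfolding Mem_def fvb_le fvb_tm_le fvb_lift_tm by auto

lemma fvb_Code_Inst: "fvb_tm t \<le> n \<Longrightarrow> fvb_tm (Code_Inst k t p) \<le> n"
proof -
  assume t: "fvb_tm t \<le> n"
  have "fvb_tm (Code_Inst_tm k t r) \<le> n" for k r
    by (induction r) (simp_all add: t fvb_tm_le fvb_Codes_le del: num.simps fvb_tm.simps(1-5))
  then show ?thesis
    by (induction p arbitrary: k) (simp_all add: fvb_tm_le del: num.simps fvb_tm.simps(1-5))
qed

lemma fvb_Closed_Term: "fvb Closed_Term \<le> 1" and fvb_Value: "fvb Value \<le> 2"
  unfolding Closed_Term_def Value_def fvb_le fvb_Mem_le fvb_tm_le fvb_Codes_le
  by (simp_all add: fvb_Codes_le)

lemma fvb_Approx: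
  assumes "fvb p \<le> 1"
  shows "fvb (Approx p) \<le> 2"
  unfolding Approx_def Code_In_def fvb_le fvb_tm_le
  using assms
  by (simp add: order_trans[OF fvb_Closed_Term] order_trans[OF fvb_Value] fvb_Code_Inst)

fun conj_list :: "('f, 'r) fm list \<Rightarrow> ('f, 'r) fm" where
  "conj_list [] = Neg Fls"
| "conj_list (p # ps) = And p (conj_list ps)"

lemma sat_conj_list: "sat M e (conj_list ps) \<longleftrightarrow> (\<forall>p\<in>set ps. sat M e p)"
  by (induction ps) auto

lemma conj_list_formulas_L_PA: "conj_list ps \<in> formulas L_PA \<longleftrightarrow> set ps \<subseteq> formulas L_PA"
  by (induction ps) auto

text \<open>As \<open>Q\<close> is finite, the claim for all \<open>d\<close> is a single
  arithmetical formula, and \<open>PA_transfer\<close> carries it over from the structures on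
  \<open>nat\<close>.\<close>

lemma PA_finitely_approximable:
  fixes M :: "('f, 'r, 'm) struct"
  assumes L: "countable_lang L" "is_struct L M"
    and PA: "\<And>p e. p \<in> PA \<Longrightarrow> e \<in> assignments M \<Longrightarrow> sat M e p"
    and "finite Q" "Q \<subseteq> {p \<in> formulas L_PA. fvb p \<le> 1}"
    and "d \<in> carr M" "e \<in> assignments M"
  shows "\<exists>x\<in>carr M. \<forall>p\<in>Q. sat M (case_nat x (case_nat d e)) (Approx p)"
proof -
  obtain ps where ps: "set ps = Q" using finite_list[OF assms(4)] by blast
  let ?p = "Uni (Exi (conj_list (map Approx ps)))"
  have "sat M e ?p"
  proof (rule PA_transfer[OF L PA _ _ assms(7)])
    show "?p \<in> formulas L_PA"
      using assms(5) ps wf_Approx by (auto simp: conj_list_formulas_L_PA)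
    fix S :: "('f, 'r, nat) struct" and e' assume "pa S"
    then interpret pa S .
    show "sat S e' ?p"
      using finitely_approximable[OF assms(4)] assms(5)
      by (auto simp: sat_conj_list carr ps)
  qed
  then show ?thesis using assms(6) by (auto simp: sat_conj_list ps)
qed

section \<open>Substituting a definition of truth\<close>

text \<open>Arithmetical formulae occur both over \<open>truth\<close> and over the relation names
  of \<open>U\<close>; the cast moves them from one type to the other. The clause for
  \<open>Rel\<close> is junk.\<close>

primrec PA_cast :: "('f, truth) fm \<Rightarrow> ('f, 'r) fm" where
  "PA_cast Fls = Fls"
| "PA_cast (Eq s t) = Eq s t"
| "PA_cast (Less s t) = Less s t"
| "PA_cast (Rel r ts) = Fls"
| "PA_cast (Imp p q) = Imp (PA_cast p) (PA_cast q)"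
| "PA_cast (Uni p) = Uni (PA_cast p)"

lemma T_subst_PA_cast: "p \<in> formulas L_PA \<Longrightarrow> T_subst \<theta> k p = PA_cast p"
  by (induction p arbitrary: k) auto

lemma PA_cast_formulas_L_PA: "p \<in> formulas L_PA \<Longrightarrow> PA_cast p \<in> formulas L_PA"
  by (induction p) auto

lemma fvb_PA_cast: "p \<in> formulas L_PA \<Longrightarrow> fvb (PA_cast p) = fvb p"
  by (induction p) auto

lemma PA_cast_subst: "PA_cast (subst_fm \<sigma> p) = subst_fm \<sigma> (PA_cast p)"
  by (induction p arbitrary: \<sigma>) auto

lemma PA_cast_univ_close: "p \<in> formulas L_PA \<Longrightarrow> PA_cast (univ_close p) = univ_close (PA_cast p)"
proof -
  have "PA_cast ((Uni ^^ k) p) = (Uni ^^ k) (PA_cast p)" for k by (induction k) auto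
  then show "p \<in> formulas L_PA \<Longrightarrow> ?thesis" by (simp add: univ_close_def fvb_PA_cast)
qed

lemma PA_cast_Code_Inst: "p \<in> formulas L_PA \<Longrightarrow> Code_Inst k t (PA_cast p) = Code_Inst k t p"
  by (induction p arbitrary: k) auto

lemma PA_cast_Closed_Term: "PA_cast Closed_Term = Closed_Term" and PA_cast_Value: "PA_cast Value = Value"
  by (simp_all add: Closed_Term_def Value_def Mem_def)

text \<open>Induction is only assumed for formulae without \<open>Tr\<close>, so the substitution
  merely changes their type.\<close>

lemma T_subst_PA:
  assumes "\<Phi> \<in> PA"
  shows "T_subst \<theta> k \<Phi> \<in> PA"
proof (cases "\<Phi> \<in> PA_minus")
  case True
  have "PA_minus \<subseteq> (formulas L_PA :: ('a, truth) fm set)"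
    by (auto simp: PA_minus_def Let_def univ_close_formulas_L_PA)
  then have "T_subst \<theta> k \<Phi> = PA_cast \<Phi>" using True T_subst_PA_cast by blast
  also have "PA_cast \<Phi> \<in> PA_minus"
  proof -
    have "PA_cast ` PA_minus = PA_minus"
      by (simp only: PA_minus_def Let_def image_insert image_empty PA_cast_univ_close formulas_L_PA
        wf_tm.simps PA_cast.simps subst_tm.simps simp_thms)
    then show ?thesis using True by blast
  qed
  finally show ?thesis by (simp add: PA_def)
next
  case False
  then obtain p where p: "p \<in> formulas L_PA" "\<Phi> = induction_axiom p"
    using assms by (auto simp: PA_def)
  let ?p = "Imp (And (subst_fm (case_nat Zero Var) p)
    (Uni (Imp p (subst_fm (case_nat (Add (Var 0) One) (\<lambda>i. Var (Suc i))) p)))) (Uni p)"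
  have wf: "?p \<in> formulas L_PA"
    using p(1) unfolding formulas_L_PA
    by (auto simp: formulas_def intro!: wf_subst_fm split: nat.split)
  then have "\<Phi> \<in> formulas L_PA"
    by (simp only: p(2) induction_axiom_def univ_close_formulas_L_PA)
  then have "T_subst \<theta> k \<Phi> = PA_cast \<Phi>" by (rule T_subst_PA_cast)
  also have "\<dots> = induction_axiom (PA_cast p)"
    unfolding p(2) induction_axiom_def PA_cast_univ_close[OF wf] by (simp add: PA_cast_subst)
  also have "\<dots> \<in> PA" using PA_cast_formulas_L_PA[OF p(1)] by (auto simp: PA_def)
  finally show ?thesis .
qed

lemma T_subst_UTB_axiom:
  assumes "p \<in> formulas L_PA"
  shows "T_subst \<theta> 0 (UTB_axiom p) = Uni (Imp Closed_Term (Exi (And Value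
    (Iff (subst_fm (case_nat (Code_Inst 0 (Var 1) p) (\<lambda>j. Var (Suc (Suc j)))) \<theta>) (PA_cast p)))))"
  by (simp add: UTB_axiom_def T_subst_PA_cast assms wf_Closed_Term wf_Value PA_cast_Closed_Term PA_cast_Value)

section \<open>The formula defining truth\<close>

lemma val_Code_Inst_cong:
  "val_tm M e s = val_tm M e' t \<Longrightarrow> val_tm M e (Code_Inst k s p) = val_tm M e' (Code_Inst k t p)"
proof -
  assume st: "val_tm M e s = val_tm M e' t"
  have num: "val_tm M e (num n) = val_tm M e' (num n)" for n by (induction n) simp_all
  have "val_tm M e (Code_Inst_tm k s r) = val_tm M e' (Code_Inst_tm k t r)" for r k
    by (induction r) (simp_all add: st num Code_Zero_def Code_One_def Code_Add_def Code_Mul_def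
      Opair_def del: num.simps)
  then show ?thesis
    by (induction p arbitrary: k) (simp_all add: num Opair_def del: num.simps One_nat_def)
qed

text \<open>In \<open>M\<close>, with its arbitrary carrier, the arithmetic of \<open>pa\<close> is
  not at hand; the relation expressed by \<open>Code_In\<close> is only carried along and
  compared.\<close>

definition coded_in :: "('f, 'r, 'm) struct \<Rightarrow> 'm \<Rightarrow> 'm \<Rightarrow> bool" where
  "coded_in M s x \<longleftrightarrow> (\<exists>a\<in>carr M. \<exists>b\<in>carr M. \<exists>c\<in>carr M.
     x = iadd M (iadd M (imul M (iadd M a b) (iadd M a b)) a) (ione M) \<and>
     a = imul M (iadd M (imul M (iadd M s (ione M)) b) (ione M)) c)"

lemma sat_Code_In_iff:
  assumes "\<And>a b c. val_tm M (case_nat c (case_nat b (case_nat a e))) s = s'"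
    and "\<And>a b c. val_tm M (case_nat c (case_nat b (case_nat a e))) x = x'"
  shows "sat M e (Code_In s x) \<longleftrightarrow> coded_in M s' x'"
  unfolding Code_In_def coded_in_def sat_Exi sat_And
  by (simp add: assms Opair_def numeral_2_eq_2)

lemma sat_Approx_iff:
  assumes "fvb p \<le> 1"
  shows "sat M (case_nat x (case_nat d e)) (Approx p) \<longleftrightarrow> (\<forall>t\<in>carr M. iless M t d \<longrightarrow>
    sat M (case_nat t e) Closed_Term \<longrightarrow>
      (\<exists>v\<in>carr M. sat M (case_nat v (case_nat t e)) Value) \<and>
      (\<forall>v\<in>carr M. sat M (case_nat v (case_nat t e)) Value \<longrightarrow>
        (coded_in M (val_tm M (\<lambda>_. t) (Code_Inst 0 (Var 0) p)) x \<longleftrightarrow> sat M (case_nat v e) p)))"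
proof -
  have "sat M (case_nat t (case_nat x (case_nat d e))) Closed_Term \<longleftrightarrow> sat M (case_nat t e) Closed_Term" for t
    by (rule sat_cong1[OF fvb_Closed_Term]) simp
  moreover have "sat M (case_nat v (case_nat t (case_nat x (case_nat d e)))) Value \<longleftrightarrow>
    sat M (case_nat v (case_nat t e)) Value" for v t
    by (rule sat_cong2[OF fvb_Value]) simp_all
  moreover have "sat M (case_nat v (case_nat t (case_nat x (case_nat d e)))) p \<longleftrightarrow>
    sat M (case_nat v e) p" for v t
    by (rule sat_cong1[OF assms]) simp
  moreover have "sat M (case_nat v (case_nat t (case_nat x (case_nat d e)))) (Code_In (Code_Inst 0 (Var 4) p) (Var 5)) \<longleftrightarrow>
    coded_in M (val_tm M (\<lambda>_. t) (Code_Inst 0 (Var 0) p)) x" for v t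
    by (rule sat_Code_In_iff) (auto intro!: val_Code_Inst_cong simp: numeral_eq_Suc)
  ultimately show ?thesis
    unfolding Approx_def sat_Exi sat_And by (auto simp: numeral_2_eq_2)
qed

text \<open>A code is true if it belongs to sets isolated by \<open>p\<close> for arbitrarily large bounds \<open>d\<close>; for
  each single formula these sets agree with the truth once \<open>d\<close> is large enough.\<close>

definition Truth :: "('f, 'r) fm \<Rightarrow> nat \<Rightarrow> ('f, 'r) fm" where
  "Truth p n = (let k = Suc (max (fvb p) n) in
     Uni (((\<lambda>q. Exi q) ^^ k) (And (Less (Var k) (Var 0)) (And p (Code_In (Var (k + 4)) (Var (n + 3)))))))"

lemma wf_Truth: "p \<in> formulas L \<Longrightarrow> Truth p n \<in> formulas L"
proof -
  assume "p \<in> formulas L"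
  moreover have "((\<lambda>q. Exi q) ^^ k) q \<in> formulas L \<longleftrightarrow> q \<in> formulas L" for k q
    by (induction k) (auto simp: formulas_def)
  moreover have "Code_In (Var i) (Var j) \<in> formulas L" for i j
    by (simp add: Code_In_def formulas_def wf_Opair)
  ultimately show ?thesis by (simp add: Truth_def Let_def formulas_def)
qed

lemma sat_Truth:
  assumes "e \<in> assignments M"
  shows "sat M e (Truth p n) \<longleftrightarrow> (\<forall>m\<in>carr M. \<exists>f\<in>assignments M.
    iless M m (f 0) \<and> sat M f p \<and> coded_in M (e 0) (f n))"
proof -
  \<comment> \<open>The \<open>k\<close> existential quantifiers cover index 0 for \<open>d\<close>,
    index \<open>n\<close> and all free indices of \<open>p\<close>. Below them, \<open>k\<close> is
    the bound and \<open>k + 1\<close> the code, which \<open>Code_In\<close> sees at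
    \<open>k + 4\<close> from under its three quantifiers.\<close>
  define k where "k = Suc (max (fvb p) n)"
  let ?g = "\<lambda>f m i. if i < k then f i else case_nat m e (i - k)"
  have "sat M (?g f m) p \<longleftrightarrow> sat M f p" for f m
    by (rule sat_cong) (auto simp: k_def)
  moreover have "sat M (?g f m) (Code_In (Var (k + 4)) (Var (n + 3))) \<longleftrightarrow> coded_in M (e 0) (f n)" for f m
    by (rule sat_Code_In_iff) (auto simp: k_def numeral_eq_Suc)
  ultimately have "sat M (?g f m) (And (Less (Var k) (Var 0)) (And p (Code_In (Var (k + 4)) (Var (n + 3))))) \<longleftrightarrow>
    iless M m (f 0) \<and> sat M f p \<and> coded_in M (e 0) (f n)" for f m
    unfolding sat_And by (simp add: k_def)
  then show ?thesis
    using assms unfolding Truth_def Let_def k_def[symmetric]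
    by (simp add: sat_Exi_funpow case_nat_in_assignments)
qed

text \<open>If no condition isolated the type, a term model generic for these dense sets would omit it.\<close>

lemma isolated_Approx:
  fixes L :: "('f, 'r) lang" and M :: "('f, 'r, 'm) struct"
  assumes L: "countable_lang L" and U: "U \<subseteq> formulas L" "PA \<subseteq> U"
    and sat: "imposes_PA_recursive_saturation TYPE('m) L U" and M: "is_model L M U"
  shows "\<exists>p\<in>formulas L. unbounded_sat M p \<and> (\<exists>n. \<forall>m.
    \<not> unbounded_sat M (And p (Neg (subst_fm (\<lambda>i. Var (case_nat n (\<lambda>_. 0) i)) (padded_Approx m)))))"
proof (rule ccontr)
  \<comment> \<open>The renaming reads the type at variable \<open>n\<close>, as its realisation,
    and at variable 0, as \<open>d\<close>. Meeting \<open>?R n\<close> prevents the n-th element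
    from realising it.\<close>
  let ?R = "\<lambda>n. range (\<lambda>m. Neg (subst_fm (\<lambda>i. Var (case_nat n (\<lambda>_. 0) i)) (padded_Approx m))) :: ('f, 'r) fm set"
  assume "\<not> ?thesis"
  then have R: "\<exists>r\<in>?R n. unbounded_sat M (And p r)" if "p \<in> formulas L" "unbounded_sat M p" for n p
    using that by blast
  have padded: "padded_Approx m \<in> formulas L_PA" "fvb (padded_Approx m) \<le> 2" for m
    using range_nth_formula fvb_Approx wf_Approx by (auto simp: padded_Approx_def wf_num fvb_tm_le)
  have M_PA: "p \<in> PA \<Longrightarrow> e \<in> assignments M \<Longrightarrow> sat M e p" for p e
    using M U(2) by (auto simp: is_model_def)
  have M_struct: "is_struct L M" using M by (simp add: is_model_def)
  interpret unbounded_struct L M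
    using PA_unbounded_struct[OF L M_struct] M_PA by (simp add: PA_def)
  have "?R n \<subseteq> formulas L" for n
  proof -
    have "padded_Approx m \<in> formulas L" for m using padded(1) formulas_L_PA_subset[of L] by blast
    then show ?thesis by (auto simp: formulas_def intro!: wf_subst_fm)
  qed
  from henkin_exists[of ?R, OF this R] obtain \<Gamma>
    where \<Gamma>: "henkin L M \<Gamma>" "\<And>n. ?R n \<inter> \<Gamma> \<noteq> {}" by blast
  \<comment> \<open>Saturation is only known for models inside the type \<open>'m\<close>. As
    \<open>M\<close> is infinite, that type has room for the countable carrier, placed there by
    \<open>h\<close>.\<close>
  have "infinite (carr M)"
    using PA_infinite[OF M_struct] M_PA by (simp add: PA_def)
  then obtain h :: "nat \<Rightarrow> 'm" where h: "inj h"
    using infinite_countable_subset by blast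
  define q where "q i = h (LEAST k. Eq (Var i) (Var k) \<in> \<Gamma>)" for i
  have q: "q i = q j \<longleftrightarrow> Eq (Var i) (Var j) \<in> \<Gamma>" for i j
    unfolding q_def inj_eq[OF h] by (rule henkin_kernel[OF \<Gamma>(1)])
  obtain N :: "('f, 'r, 'm) struct" where N: "carr N = range q" "is_struct L N"
    "\<And>p \<rho>. p \<in> formulas L \<Longrightarrow> sat N (\<lambda>i. q (\<rho> i)) p \<longleftrightarrow> subst_fm (\<lambda>i. Var (\<rho> i)) p \<in> \<Gamma>"
    using henkin_model[OF \<Gamma>(1) M_struct q] by blast
  have N_U: "sat N e p" if "p \<in> U" "e \<in> assignments N" for p e
    using henkin_transfer[OF \<Gamma>(1) N(1,3) _ _ that(2), of p] that(1) M U(1)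
    by (auto simp: is_model_def)
  then have "is_model L N U" using N(2) by (simp add: is_model_def)
  then have saturated: "PA_recursively_saturated N"
    using sat by (simp add: imposes_PA_recursive_saturation_def)
  \<comment> \<open>The parameter is the generic element \<open>d\<close>; repeating it at every
    index makes prefixing it once more harmless.\<close>
  let ?e = "\<lambda>_::nat. q 0"
  have e: "?e \<in> assignments N" using N(1) by (auto simp: assignments_def)
  have e_case: "case_nat (q 0) ?e = ?e" by (rule ext) (simp split: nat.split)
  have sat_padded: "sat N e (padded_Approx m) \<longleftrightarrow> sat N e (Approx (nth_formula m))" for e m
    by (simp add: padded_Approx_def)
  have "\<exists>x\<in>carr N. \<forall>p\<in>Q. sat N (case_nat x ?e) p" if Q: "Q \<subseteq> range padded_Approx" "finite Q" for Q
  proof -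
    obtain I where I: "finite I" "Q = padded_Approx ` I"
      using finite_subset_image[OF Q(2,1)] by blast
    have "\<exists>x\<in>carr N. \<forall>p\<in>nth_formula ` I. sat N (case_nat x (case_nat (q 0) ?e)) (Approx p)"
    proof (rule PA_finitely_approximable[OF L N(2) _ _ _ _ e])
      show "nth_formula ` I \<subseteq> {p \<in> formulas L_PA. fvb p \<le> 1}"
        using range_nth_formula by blast
    qed (use N_U U(2) I(1) N(1) in auto)
    then show ?thesis unfolding I(2) e_case by (simp add: sat_padded)
  qed
  then have "\<exists>x\<in>carr N. \<forall>p\<in>range padded_Approx. sat N (case_nat x ?e) p"
    using saturated[unfolded PA_recursively_saturated_def, rule_format, OF e, of "range padded_Approx" 1]
      padded recursive_Approx by (auto simp: numeral_2_eq_2)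
  then obtain n where n: "\<And>m. sat N (case_nat (q n) ?e) (padded_Approx m)"
    unfolding N(1) by blast
  have env: "case_nat (q n) ?e = (\<lambda>i. q (case_nat n (\<lambda>_. 0) i))"
    by (rule ext) (simp split: nat.split)
  have "subst_fm (\<lambda>i. Var (case_nat n (\<lambda>_. 0) i)) (padded_Approx m) \<in> \<Gamma>" for m
    using n[of m] N(3)[of "padded_Approx m" "case_nat n (\<lambda>_. 0)"] padded(1) formulas_L_PA_subset[of L]
    unfolding env by blast
  moreover obtain m where "Neg (subst_fm (\<lambda>i. Var (case_nat n (\<lambda>_. 0) i)) (padded_Approx m)) \<in> \<Gamma>"
    using \<Gamma>(2)[of n] by blast
  moreover have "\<not> (p \<in> \<Gamma> \<and> Neg p \<in> \<Gamma>)" for p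
  proof
    assume "p \<in> \<Gamma> \<and> Neg p \<in> \<Gamma>"
    moreover have "entails M {p, Neg p} Fls" by (simp add: entails_def)
    moreover have "Fls \<in> formulas L" by (simp add: formulas_def)
    moreover have "\<forall>\<Delta> p. finite \<Delta> \<and> \<Delta> \<subseteq> \<Gamma> \<and> p \<in> formulas L \<and> entails M \<Delta> p \<longrightarrow> p \<in> \<Gamma>" "Fls \<notin> \<Gamma>"
      using \<Gamma>(1) unfolding henkin_def by blast+
    ultimately show False by (metis finite.emptyI finite_insert empty_subsetI insert_subset)
  qed
  ultimately show False by blast
qed

theorem theorem63:
  fixes L :: "('f, 'r) lang" and U :: "('f, 'r) fm set"
  assumes "countable_lang L"
    and "U \<subseteq> sentences L"
    and "PA \<subseteq> U"
    and "imposes_PA_recursive_saturation TYPE('m) L U"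
  shows "semantically_defines TYPE('m) L U UTB_minus"
  unfolding semantically_defines_def
proof (intro allI impI)
  fix M :: "('f, 'r, 'm) struct" assume M: "is_model L M U"
  have U: "U \<subseteq> formulas L" using assms(2) by (auto simp: sentences_def)
  have M_PA: "p \<in> PA \<Longrightarrow> e \<in> assignments M \<Longrightarrow> sat M e p" for p e
    using M assms(3) by (auto simp: is_model_def)
  have M_struct: "is_struct L M" using M by (simp add: is_model_def)
  interpret unbounded_struct L M
    using PA_unbounded_struct[OF assms(1) M_struct] M_PA by (simp add: PA_def)
  obtain p n where p: "p \<in> formulas L" "unbounded_sat M p"
    and iso: "\<And>m. \<not> unbounded_sat M (And p (Neg (subst_fm (\<lambda>i. Var (case_nat n (\<lambda>_. 0) i)) (padded_Approx m))))"
    using isolated_Approx[OF assms(1) U assms(3,4) M] by blast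
  \<comment> \<open>Isolation read for one formula: counterexamples to \<open>Approx q\<close> among
    the solutions of \<open>p\<close> are bounded in \<open>d\<close>, by a bound that depends on
    \<open>q\<close>.\<close>
  have bound: "\<exists>m\<in>carr M. \<forall>f\<in>assignments M. iless M m (f 0) \<longrightarrow> sat M f p \<longrightarrow>
    sat M (case_nat (f n) (case_nat (f 0) f)) (Approx q)"
    if q: "q \<in> formulas L_PA" "fvb q \<le> 1" for q
  proof -
    obtain m where m: "q = nth_formula m" using q range_nth_formula by blast
    have "sat M (\<lambda>i. f (case_nat n (\<lambda>_. 0) i)) (Approx q) \<longleftrightarrow>
      sat M (case_nat (f n) (case_nat (f 0) f)) (Approx q)" for f
      by (rule sat_cong2[OF fvb_Approx[OF q(2)]]) simp_all
    then show ?thesis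
      using iso[of m] m by (auto simp: unbounded_sat_def sat_subst_fm padded_Approx_def)
  qed
  have "(\<lambda>_. izero M) \<in> assignments M"
    using M_struct by (intro assignmentsI) (simp add: is_struct_def)
  \<comment> \<open>Any assignment serves: by \<open>sat_Truth\<close>, the defining formula looks
    at index 0 only and so uses no parameters.\<close>
  then obtain e where e: "e \<in> assignments M" by blast
  have "sat M e (T_subst (Truth p n) 0 (UTB_axiom q))" if q: "q \<in> formulas L_PA" "fvb q \<le> 1" for q
  proof -
    let ?q = "PA_cast q :: ('f, 'r) fm"
    have q': "?q \<in> formulas L_PA" "fvb ?q \<le> 1" using q by (simp_all add: PA_cast_formulas_L_PA fvb_PA_cast)
    obtain m0 where m0: "m0 \<in> carr M" "\<And>f. f \<in> assignments M \<Longrightarrow> iless M m0 (f 0) \<Longrightarrow> sat M f p \<Longrightarrow>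
      sat M (case_nat (f n) (case_nat (f 0) f)) (Approx ?q)"
      using bound[OF q'] by blast
    have "\<exists>v\<in>carr M. sat M (case_nat v (case_nat t e)) Value \<and>
      (sat M (case_nat v (case_nat t e)) (subst_fm (case_nat (Code_Inst 0 (Var 1) q) (\<lambda>j. Var (Suc (Suc j)))) (Truth p n)) \<longleftrightarrow>
        sat M (case_nat v (case_nat t e)) ?q)"
      if t: "t \<in> carr M" "sat M (case_nat t e) Closed_Term" for t
    proof -
      let ?s = "val_tm M (\<lambda>_. t) (Code_Inst 0 (Var 0) ?q)"
      \<comment> \<open>\<open>d\<close> has to pass the bound belonging to \<open>?q\<close> and
        also to lie above the code \<open>t\<close>.\<close>
      obtain m1 where m1: "m1 \<in> carr M"
        "\<forall>x\<in>carr M. iless M m1 x \<longrightarrow> iless M m0 x \<and> iless M t x"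
        using directed[OF m0(1) t(1)] by blast
      have approx: "(\<exists>v\<in>carr M. sat M (case_nat v (case_nat t e)) Value) \<and>
        (\<forall>v\<in>carr M. sat M (case_nat v (case_nat t e)) Value \<longrightarrow>
          (coded_in M ?s (f n) \<longleftrightarrow> sat M (case_nat v (case_nat t e)) ?q))"
        if f: "f \<in> assignments M" "iless M m1 (f 0)" "sat M f p" for f
      proof -
        have less: "iless M m0 (f 0)" "iless M t (f 0)" using m1(2) f assignmentsD by blast+
        have env1: "sat M (case_nat t f) Closed_Term \<longleftrightarrow> sat M (case_nat t e) Closed_Term"
          by (rule sat_cong1[OF fvb_Closed_Term]) simp
        have env2: "sat M (case_nat v (case_nat t f)) Value \<longleftrightarrow> sat M (case_nat v (case_nat t e)) Value" for v
          by (rule sat_cong2[OF fvb_Value]) simp_all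
        have env3: "sat M (case_nat v f) ?q \<longleftrightarrow> sat M (case_nat v (case_nat t e)) ?q" for v
          by (rule sat_cong1[OF q'(2)]) simp
        show ?thesis
          using bspec[OF m0(2)[OF f(1) less(1) f(3), unfolded sat_Approx_iff[OF q'(2)]] t(1)]
            less(2) t(2) unfolding env1 env2 env3 by blast
      qed
      obtain f where "f \<in> assignments M" "iless M m1 (f 0)" "sat M f p"
        using p(2) m1(1) by (auto simp: unbounded_sat_def)
      \<comment> \<open>The value exists because \<open>Approx\<close> itself asserts it, so nothing
        about values has to be proved in \<open>M\<close> directly.\<close>
      then obtain v where v: "v \<in> carr M" "sat M (case_nat v (case_nat t e)) Value"
        using approx by blast
      let ?e = "case_nat v (case_nat t e)"
      have env: "(\<lambda>i. val_tm M ?e (case_nat (Code_Inst 0 (Var 1) q) (\<lambda>j. Var (Suc (Suc j))) i)) = case_nat ?s e"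
        by (rule ext) (auto split: nat.split simp: PA_cast_Code_Inst[OF q(1)] intro!: val_Code_Inst_cong)
      have "?e \<in> assignments M" using t(1) v(1) e by (intro case_nat_in_assignments)
      then have "?s \<in> carr M"
        using val_tm_in_carr[OF M_struct, of "\<lambda>_. t" "Code_Inst 0 (Var 0) ?q"] t(1)
        by (auto simp: wf_Code_Inst assignments_def)
      then have "sat M ?e (subst_fm (case_nat (Code_Inst 0 (Var 1) q) (\<lambda>j. Var (Suc (Suc j)))) (Truth p n)) \<longleftrightarrow>
        (\<forall>m\<in>carr M. \<exists>f\<in>assignments M. iless M m (f 0) \<and> sat M f p \<and> coded_in M ?s (f n))"
        unfolding sat_subst_fm env using e by (simp add: sat_Truth case_nat_in_assignments)
      \<comment> \<open>Beyond \<open>m1\<close> all coded sets agree on this instance, so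
        membership for arbitrarily large \<open>d\<close> and for a single \<open>d\<close> past
        \<open>m1\<close> amount to the same.\<close>
      also have "\<dots> \<longleftrightarrow> sat M ?e ?q"
      proof
        assume "\<forall>m\<in>carr M. \<exists>f\<in>assignments M. iless M m (f 0) \<and> sat M f p \<and> coded_in M ?s (f n)"
        then show "sat M ?e ?q" using m1(1) approx v by blast
      next
        assume *: "sat M ?e ?q"
        show "\<forall>m\<in>carr M. \<exists>f\<in>assignments M. iless M m (f 0) \<and> sat M f p \<and> coded_in M ?s (f n)"
        proof
          fix m assume "m \<in> carr M"
          then obtain m2 where m2: "m2 \<in> carr M"
            "\<forall>x\<in>carr M. iless M m2 x \<longrightarrow> iless M m x \<and> iless M m1 x"
            using directed[OF _ m1(1)] by blast
          then obtain f where "f \<in> assignments M" "iless M m2 (f 0)" "sat M f p"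
            using p(2) by (auto simp: unbounded_sat_def)
          then show "\<exists>f\<in>assignments M. iless M m (f 0) \<and> sat M f p \<and> coded_in M ?s (f n)"
            using m2(2) approx[of f] v * by (auto dest: assignmentsD)
        qed
      qed
      finally show ?thesis using v by blast
    qed
    then show ?thesis
      unfolding T_subst_UTB_axiom[OF q(1)] by (simp add: sat_Exi sat_And) blast
  qed
  moreover have "sat M e (T_subst (Truth p n) 0 \<Phi>)" if "\<Phi> \<in> PA" for \<Phi>
    using T_subst_PA[OF that] M_PA e by blast
  ultimately show "\<exists>\<theta>\<in>formulas L. \<exists>e\<in>assignments M. \<forall>\<Phi>\<in>UTB_minus. sat M e (T_subst \<theta> 0 \<Phi>)"
    using wf_Truth[OF p(1), of n] e by (intro bexI[of _ "Truth p n"] bexI[of _ e]) (auto simp: UTB_minus_def)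
qed

end
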